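(* Let $B$ be a finite Blaschke product of degree $n$ and let $C:L^2(\mathbb{T})\to L^2(\mathbb{T})$ be a conjugation. (i) If $CM_B=M_{\bar B}C$, then there exist $\phi_1,\phi_2,\ldots,\phi_n\in L^\infty(\mathbb{T})$ such that $C=M_{[\phi_1,\phi_2,\ldots,\phi_n]}\mathscr{C}_B$, where $M_{[\phi_1,\phi_2,\ldots,\phi_n]}$ is unitary and $\mathscr{C}_B$-symmetric. (ii) If $CM_B=M_BC$, then there exist $\psi_1,\psi_2,\ldots,\psi_n\in L^\infty(\mathbb{T})$ such that $C=M_{[\psi_1,\psi_2,\ldots,\psi_n]}\mathscr{C}_B^\star$, where $M_{[\psi_1,\psi_2,\ldots,\psi_n]}$ is unitary and $\mathscr{C}_B^\star$-symmetric.
   Context: $\mathbb{T}$ is the unit circle with normalized Lebesgue measure, $\mathbb{D}$ is the open unit disc, and $H^2\subset L^2(\mathbb{T})$ is the Hardy space (functions whose negative Fourier coefficients vanish). For $\phi\in L^\infty(\mathbb{T})$, $M_\phi f=\phi f$ on $L^2(\mathbb{T})$. A conjugation on a Hilbert space $\mathcal{H}$ is an antilinear map $C:\mathcal{H}\to\mathcal{H}$ with $C^2=I$ and $\langle Cf,Cg\rangle=\langle g,f\rangle$ for all $f,g$. A bounded linear operator $T$ is $C$-symmetric if $CTC=T^*$. A finite Blaschke product of degree $n$ is $B(z)=\prod_{k=1}^n\frac{\lambda_k-z}{1-\overline{\lambda_k}z}$ with $\lambda_1,\dots,\lambda_n\in\mathbb{D}$ (possibly repeated). For $1\le j\le n$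 put $e_j(z)=\Big(\prod_{k=1}^{j-1}\frac{\lambda_k-z}{1-\overline{\lambda_k}z}\Big)\frac{\sqrt{1-|\lambda_j|^2}}{1-\overline{\lambda_j}z}$; $\{e_1,\dots,e_n\}$ is an orthonormal basis of $K_B=H^2\ominus BH^2$. Let $\mathcal{H}_j(e_j,B)$ be the closed linear span in $L^2(\mathbb{T})$ of $\{e_jB^k:k\in\mathbb{Z}\}$. Then $L^2(\mathbb{T})$ is the orthogonal direct sum of $\mathcal{H}_1(e_1,B),\dots,\mathcal{H}_n(e_n,B)$; write $f=f_1+\cdots+f_n$ with $f_j\in\mathcal{H}_j(e_j,B)$. For $\phi_1,\dots,\phi_n\in L^\infty(\mathbb{T})$, $M_{[\phi_1,\ldots,\phi_n]}$ is the bounded linear operator $M_{[\phi_1,\ldots,\phi_n]}f=\phi_1f_1+\cdots+\phi_nf_n$ on $L^2(\mathbb{T})$. One also has $L^2(\mathbb{T})=\bigoplus_{k\in\mathbb{Z}}B^kK_B$ (orthogonal). The conjugations $\mathscr{C}_B$ and $\mathscr{C}_B^\star$ on $L^2(\mathbb{T})$ are defined by $\mathscr{C}_Bf=B\,\overline{zf}$ and, for $f=\sum_{k\in\mathbb{Z}}g_kB^k$ with $g_k\in K_B$, $\mathscr{C}_B^\star f=\sum_{k\in\mathbb{Z}}(B\,\overline{zg_k})B^k$. *)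

theory Defs
  imports "HOL-Analysis.Analysis"
begin

section \<open>The space \<open>L\<^sup>2\<close> of the unit circle\<close>

definition circle :: "complex measure" where
  "circle = distr (uniform_measure lborel {0..2 * pi}) (restrict_space borel (sphere 0 1)) cis"

definition L2_fun :: "(complex \<Rightarrow> complex) set" where
  "L2_fun = {f. f \<in> borel_measurable circle \<and> integrable circle (\<lambda>z. (cmod (f z))\<^sup>2)}"

definition Linf_fun :: "(complex \<Rightarrow> complex) set" where
  "Linf_fun = {f. f \<in> borel_measurable circle \<and> (\<exists>M. AE z in circle. cmod (f z) \<le> M)}"

lemma L2_fun_scale: "f \<in> L2_fun \<Longrightarrow> (\<lambda>z. c * f z) \<in> L2_fun"
  by (auto simp: L2_fun_def norm_mult power_mult_distrib)

lemma L2_fun_add: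
  assumes "f \<in> L2_fun" "g \<in> L2_fun"
  shows "(\<lambda>z. f z + g z) \<in> L2_fun"
proof -
  have [measurable]: "f \<in> borel_measurable circle" "g \<in> borel_measurable circle"
    using assms by (auto simp: L2_fun_def)
  have "(cmod (f z + g z))\<^sup>2 \<le> 2 * (cmod (f z))\<^sup>2 + 2 * (cmod (g z))\<^sup>2" for z
  proof -
    have "(cmod (f z + g z))\<^sup>2 \<le> (cmod (f z) + cmod (g z))\<^sup>2"
      by (intro power_mono norm_triangle_ineq) auto
    also have "\<dots> \<le> 2 * (cmod (f z))\<^sup>2 + 2 * (cmod (g z))\<^sup>2"
      using sum_squares_bound[of "cmod (f z)" "cmod (g z)"] by (simp add: power2_sum)
    finally show ?thesis .
  qed
  then have *: "AE z in circle. norm ((cmod (f z + g z))\<^sup>2)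
      \<le> norm (2 * (cmod (f z))\<^sup>2 + 2 * (cmod (g z))\<^sup>2)"
    by simp
  have "integrable circle (\<lambda>z. 2 * (cmod (f z))\<^sup>2 + 2 * (cmod (g z))\<^sup>2)"
    using assms by (simp add: L2_fun_def)
  then have "integrable circle (\<lambda>z. (cmod (f z + g z))\<^sup>2)"
    by (rule Bochner_Integration.integrable_bound) (measurable, fact *)
  then show ?thesis by (simp add: L2_fun_def)
qed

lemma L2_fun_cnj: "f \<in> L2_fun \<Longrightarrow> (\<lambda>z. cnj (f z)) \<in> L2_fun"
  by (auto simp: L2_fun_def intro: measurable_compose[OF _ borel_measurable_continuous_onI]
      continuous_on_cnj continuous_on_id)

lemma L2_fun_mult_Linf:
  assumes "p \<in> Linf_fun" "f \<in> L2_fun"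
  shows "(\<lambda>z. p z * f z) \<in> L2_fun"
proof -
  obtain M where M: "AE z in circle. cmod (p z) \<le> M" using assms by (auto simp: Linf_fun_def)
  have [measurable]: "f \<in> borel_measurable circle" "p \<in> borel_measurable circle"
    using assms by (auto simp: L2_fun_def Linf_fun_def)
  have "AE z in circle. norm ((cmod (p z * f z))\<^sup>2) \<le> norm (M\<^sup>2 * (cmod (f z))\<^sup>2)"
    using M
  proof eventually_elim
    case (elim z)
    then have "(cmod (p z))\<^sup>2 \<le> M\<^sup>2" by (intro power_mono) auto
    then show ?case by (auto simp: norm_mult power_mult_distrib intro: mult_right_mono)
  qed
  note * = this
  have "integrable circle (\<lambda>z. M\<^sup>2 * (cmod (f z))\<^sup>2)"
    using assms by (simp add: L2_fun_def)
  then have "integrable circle (\<lambda>z. (cmod (p z * f z))\<^sup>2)"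
    by (rule Bochner_Integration.integrable_bound) (measurable, fact *)
  then show ?thesis by (simp add: L2_fun_def)
qed

lemma L2_fun_integrable:
  assumes "f \<in> L2_fun" "g \<in> L2_fun"
  shows "integrable circle (\<lambda>z. f z * cnj (g z))"
proof -
  have [measurable]: "f \<in> borel_measurable circle" "(\<lambda>z. cnj (g z)) \<in> borel_measurable circle"
    using assms L2_fun_cnj by (auto simp: L2_fun_def)
  have "cmod (f z * cnj (g z)) \<le> (cmod (f z))\<^sup>2 + (cmod (g z))\<^sup>2" for z
  proof -
    have "0 \<le> cmod (f z) * cmod (g z)" by simp
    moreover have "2 * (cmod (f z) * cmod (g z)) \<le> (cmod (f z))\<^sup>2 + (cmod (g z))\<^sup>2"
      using sum_squares_bound[of "cmod (f z)" "cmod (g z)"] by (simp add: mult.assoc)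
    ultimately show ?thesis unfolding norm_mult complex_mod_cnj by linarith
  qed
  then have *: "AE z in circle. norm (f z * cnj (g z)) \<le> norm ((cmod (f z))\<^sup>2 + (cmod (g z))\<^sup>2)"
    by simp
  have "integrable circle (\<lambda>z. (cmod (f z))\<^sup>2 + (cmod (g z))\<^sup>2)"
    using assms by (simp add: L2_fun_def)
  then show ?thesis
    by (rule Bochner_Integration.integrable_bound) (measurable, fact *)
qed

definition L2_eq :: "(complex \<Rightarrow> complex) \<Rightarrow> (complex \<Rightarrow> complex) \<Rightarrow> bool" where
  "L2_eq f g \<longleftrightarrow> f \<in> L2_fun \<and> g \<in> L2_fun \<and> (AE z in circle. f z = g z)"

quotient_type L2 = "complex \<Rightarrow> complex" / partial: L2_eq
proof (rule part_equivpI)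
  show "\<exists>f. L2_eq f f"
    by (intro exI[of _ "\<lambda>_. 0"]) (simp add: L2_eq_def L2_fun_def)
  show "symp L2_eq" by (auto simp: symp_def L2_eq_def)
  show "transp L2_eq" by (auto simp: transp_def L2_eq_def)
qed

(* The class of a square-integrable function; 0 for any other function. *)
lift_definition L2_of :: "(complex \<Rightarrow> complex) \<Rightarrow> L2"
  is "\<lambda>f. if f \<in> L2_fun then f else (\<lambda>_. 0)"
  by (auto simp: L2_eq_def L2_fun_def)

lift_definition cinner :: "L2 \<Rightarrow> L2 \<Rightarrow> complex"
  is "\<lambda>f g. (LINT z|circle. f z * cnj (g z))"
  subgoal premises p for f f' g g'
  proof (rule integral_cong_AE)
    show "(\<lambda>z. f z * cnj (g z)) \<in> borel_measurable circle"
      using p by (intro borel_measurable_integrable L2_fun_integrable) (auto simp: L2_eq_def)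
    show "(\<lambda>z. f' z * cnj (g' z)) \<in> borel_measurable circle"
      using p by (intro borel_measurable_integrable L2_fun_integrable) (auto simp: L2_eq_def)
    have "AE z in circle. f z = f' z" "AE z in circle. g z = g' z"
      using p by (auto simp: L2_eq_def)
    then show "AE z in circle. f z * cnj (g z) = f' z * cnj (g' z)"
      by eventually_elim simp
  qed
  done

lift_definition scaleC :: "complex \<Rightarrow> L2 \<Rightarrow> L2" is "\<lambda>c f z. c * f z"
  by (auto simp: L2_eq_def L2_fun_scale)

lift_definition cnj_L2 :: "L2 \<Rightarrow> L2" is "\<lambda>f z. cnj (f z)"
  by (auto simp: L2_eq_def L2_fun_cnj)

(* Multiplication operator; its symbol ranges over representatives of elements of L-infinity,
   and the value for any other symbol is a dummy. *)
lift_definition mult_op :: "(complex \<Rightarrow> complex) \<Rightarrow> L2 \<Rightarrow> L2"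
  is "\<lambda>p f. if p \<in> Linf_fun then (\<lambda>z. p z * f z) else (\<lambda>_. 0)"
  by (auto simp: L2_eq_def L2_fun_mult_Linf) (auto simp: L2_fun_def)

instantiation L2 :: real_vector
begin

lift_definition zero_L2 :: L2 is "\<lambda>_. 0"
  by (simp add: L2_eq_def L2_fun_def)

lift_definition plus_L2 :: "L2 \<Rightarrow> L2 \<Rightarrow> L2" is "\<lambda>f g z. f z + g z"
  by (auto simp: L2_eq_def L2_fun_add)

lift_definition uminus_L2 :: "L2 \<Rightarrow> L2" is "\<lambda>f z. - f z"
  using L2_fun_scale[of _ "-1"] by (auto simp: L2_eq_def)

definition minus_L2 :: "L2 \<Rightarrow> L2 \<Rightarrow> L2" where "minus_L2 f g = f + (- g)"

definition scaleR_L2 :: "real \<Rightarrow> L2 \<Rightarrow> L2" where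
  "scaleR_L2 r f = scaleC (complex_of_real r) f"

instance
proof
  fix a b c :: L2 and r s :: real
  show "a + b + c = a + (b + c)"
    by transfer (auto simp: L2_eq_def algebra_simps L2_fun_add)
  show "a + b = b + a"
    by transfer (auto simp: L2_eq_def algebra_simps L2_fun_add)
  show "0 + a = a"
    by transfer (auto simp: L2_eq_def)
  show "- a + a = 0"
    by transfer (auto simp: L2_eq_def L2_fun_def)
  show "a - b = a + - b"
    by (simp add: minus_L2_def)
  show "r *\<^sub>R (a + b) = r *\<^sub>R a + r *\<^sub>R b"
    unfolding scaleR_L2_def
    by transfer (auto simp: L2_eq_def L2_fun_add L2_fun_scale distrib_left)
  show "(r + s) *\<^sub>R a = r *\<^sub>R a + s *\<^sub>R a"
    unfolding scaleR_L2_def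
    by transfer (auto simp: L2_eq_def L2_fun_add L2_fun_scale distrib_right)
  show "r *\<^sub>R s *\<^sub>R a = (r * s) *\<^sub>R a"
    unfolding scaleR_L2_def
    by transfer (auto simp: L2_eq_def L2_fun_scale mult.assoc simp flip: of_real_mult)
  show "1 *\<^sub>R a = a"
    unfolding scaleR_L2_def by transfer (auto simp: L2_eq_def)
qed

end

lemma cinner_commute: "cinner f g = cnj (cinner g f)"
proof -
  have "(LINT z|circle. f z * cnj (g z)) = cnj (LINT z|circle. g z * cnj (f z))"
    for f g :: "complex \<Rightarrow> complex"
    by (subst Bochner_Integration.integral_cnj [symmetric]) (simp add: mult.commute)
  then show ?thesis by transfer
qed

lemma cinner_add_left: "cinner (f + g) h = cinner f h + cinner g h"
  by transfer (auto simp: L2_eq_def distrib_right L2_fun_integrable)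

lemma cinner_scaleC_left: "cinner (scaleC c f) g = c * cinner f g"
  by transfer (auto simp: L2_eq_def mult.assoc)

lemma cinner_self:
  "Re (cinner f f) \<ge> 0" "Re (cinner f f) = 0 \<longleftrightarrow> f = 0"
proof -
  have *: "Re (LINT z|circle. h z * cnj (h z)) = (LINT z|circle. (cmod (h z))\<^sup>2)"
    if "h \<in> L2_fun" for h
    using L2_fun_integrable[OF that that]
    by (subst integral_Re [symmetric]) (auto simp: cmod_power2 simp flip: power2_eq_square)
  show "Re (cinner f f) \<ge> 0"
    by transfer (simp add: L2_eq_def *)
  show "Re (cinner f f) = 0 \<longleftrightarrow> f = 0"
    by transfer
      (auto simp: L2_eq_def * L2_fun_def integral_nonneg_eq_0_iff_AE)
qed

text \<open>The real inner product is the real part of the complex one, so that both induce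
  the same norm.\<close>

instantiation L2 :: real_inner
begin

definition inner_L2 :: "L2 \<Rightarrow> L2 \<Rightarrow> real" where "inner_L2 f g = Re (cinner f g)"
definition norm_L2 :: "L2 \<Rightarrow> real" where "norm_L2 f = sqrt (Re (cinner f f))"
definition sgn_L2 :: "L2 \<Rightarrow> L2" where "sgn_L2 f = f /\<^sub>R norm f"
definition dist_L2 :: "L2 \<Rightarrow> L2 \<Rightarrow> real" where "dist_L2 f g = norm (f - g)"
definition uniformity_L2 :: "(L2 \<times> L2) filter" where
  "uniformity_L2 = (INF e\<in>{0 <..}. principal {(x, y). dist x y < e})"
definition open_L2 :: "L2 set \<Rightarrow> bool" where
  "open_L2 U \<longleftrightarrow> (\<forall>x\<in>U. eventually (\<lambda>(x', y). x' = x \<longrightarrow> y \<in> U) uniformity)"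

instance
proof
  fix x y z :: L2 and r :: real
  show "inner x y = inner y x"
    unfolding inner_L2_def by (subst cinner_commute) simp
  show "inner (x + y) z = inner x z + inner y z"
    by (simp add: inner_L2_def cinner_add_left)
  show "inner (r *\<^sub>R x) y = r * inner x y"
    by (simp add: inner_L2_def scaleR_L2_def cinner_scaleC_left)
  show "0 \<le> inner x x" "(inner x x = 0) = (x = 0)"
    by (simp_all add: inner_L2_def cinner_self)
  show "norm x = sqrt (inner x x)"
    by (simp add: norm_L2_def inner_L2_def)
qed (simp_all add: sgn_L2_def dist_L2_def uniformity_L2_def open_L2_def)

end

interpretation L2: vector_space scaleC
proof
  fix a b :: complex and x y :: L2
  show "scaleC a (x + y) = scaleC a x + scaleC a y"
    by transfer (auto simp: L2_eq_def L2_fun_add L2_fun_scale distrib_left)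
  show "scaleC (a + b) x = scaleC a x + scaleC b x"
    by transfer (auto simp: L2_eq_def L2_fun_add L2_fun_scale distrib_right)
  show "scaleC a (scaleC b x) = scaleC (a * b) x"
    by transfer (auto simp: L2_eq_def L2_fun_scale mult.assoc)
  show "scaleC 1 x = x"
    by transfer (auto simp: L2_eq_def)
qed

section \<open>Operators\<close>

definition conjugation :: "(L2 \<Rightarrow> L2) \<Rightarrow> bool" where
  "conjugation C \<longleftrightarrow>
     (\<forall>f g. C (f + g) = C f + C g) \<and> (\<forall>a f. C (scaleC a f) = scaleC (cnj a) (C f)) \<and>
     C \<circ> C = id \<and> (\<forall>f g. cinner (C f) (C g) = cinner g f)"

definition bounded_op :: "(L2 \<Rightarrow> L2) \<Rightarrow> bool" where
  "bounded_op T \<longleftrightarrow>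
     (\<forall>f g. T (f + g) = T f + T g) \<and> (\<forall>a f. T (scaleC a f) = scaleC a (T f)) \<and>
     (\<exists>K. \<forall>f. norm (T f) \<le> K * norm f)"

definition adj :: "(L2 \<Rightarrow> L2) \<Rightarrow> L2 \<Rightarrow> L2" where
  "adj T = (THE S. \<forall>f g. cinner (T f) g = cinner f (S g))"

definition unitary :: "(L2 \<Rightarrow> L2) \<Rightarrow> bool" where
  "unitary T \<longleftrightarrow> bounded_op T \<and> adj T \<circ> T = id \<and> T \<circ> adj T = id"

definition C_symmetric :: "(L2 \<Rightarrow> L2) \<Rightarrow> (L2 \<Rightarrow> L2) \<Rightarrow> bool" where
  "C_symmetric C T \<longleftrightarrow> bounded_op T \<and> C \<circ> T \<circ> C = adj T"

section \<open>Blaschke products and the associated decompositions\<close>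

definition blaschke_factor :: "complex \<Rightarrow> complex \<Rightarrow> complex" where
  "blaschke_factor a z = (a - z) / (1 - cnj a * z)"

definition blaschke :: "(nat \<Rightarrow> complex) \<Rightarrow> nat \<Rightarrow> complex \<Rightarrow> complex" where
  "blaschke lam n z = (\<Prod>k=1..n. blaschke_factor (lam k) z)"

definition blaschke_basis :: "(nat \<Rightarrow> complex) \<Rightarrow> nat \<Rightarrow> complex \<Rightarrow> complex" where
  "blaschke_basis lam j z =
     (\<Prod>k=1..<j. blaschke_factor (lam k) z) *
     (complex_of_real (sqrt (1 - (cmod (lam j))\<^sup>2)) / (1 - cnj (lam j) * z))"

definition H_space :: "(nat \<Rightarrow> complex) \<Rightarrow> nat \<Rightarrow> nat \<Rightarrow> L2 set" where
  "H_space lam n j =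
     closure (L2.span (range (\<lambda>k::int. L2_of (\<lambda>z. blaschke_basis lam j z * blaschke lam n z powi k))))"

(* f = f_1 + ... + f_n with f_j in the j-th summand; indices outside 1..n are sent to 0
   so that the family is unique as a function on all of nat. *)
definition components :: "(nat \<Rightarrow> complex) \<Rightarrow> nat \<Rightarrow> L2 \<Rightarrow> nat \<Rightarrow> L2" where
  "components lam n f =
     (THE h. (\<forall>j\<in>{1..n}. h j \<in> H_space lam n j) \<and> (\<forall>j. j \<notin> {1..n} \<longrightarrow> h j = 0) \<and>
        f = (\<Sum>j=1..n. h j))"

definition multi_mult_op ::
  "(nat \<Rightarrow> complex) \<Rightarrow> nat \<Rightarrow> (nat \<Rightarrow> complex \<Rightarrow> complex) \<Rightarrow> L2 \<Rightarrow> L2" where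
  "multi_mult_op lam n p f = (\<Sum>j=1..n. mult_op (p j) (components lam n f j))"

definition fourier_coeff :: "L2 \<Rightarrow> int \<Rightarrow> complex" where
  "fourier_coeff f k = cinner f (L2_of (\<lambda>z. z powi k))"

definition hardy :: "L2 set" where
  "hardy = {f. \<forall>k<0. fourier_coeff f k = 0}"

definition model_space :: "(complex \<Rightarrow> complex) \<Rightarrow> L2 set" where
  "model_space B = {f \<in> hardy. \<forall>g\<in>hardy. cinner f (mult_op B g) = 0}"

definition conj_B :: "(complex \<Rightarrow> complex) \<Rightarrow> L2 \<Rightarrow> L2" where
  "conj_B B f = mult_op B (cnj_L2 (mult_op (\<lambda>z. z) f))"

(* The coefficients g_k in f = sum of g_k B^k over k in Z, g_k in the model space. *)
definition B_coeffs :: "(complex \<Rightarrow> complex) \<Rightarrow> L2 \<Rightarrow> int \<Rightarrow> L2" where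
  "B_coeffs B f =
     (THE g. (\<forall>k. g k \<in> model_space B) \<and>
        ((\<lambda>k. mult_op (\<lambda>z. B z powi k) (g k)) has_sum f) UNIV)"

definition conj_B_star :: "(complex \<Rightarrow> complex) \<Rightarrow> L2 \<Rightarrow> L2" where
  "conj_B_star B f = (\<Sum>\<^sub>\<infinity>k. mult_op (\<lambda>z. B z powi k) (conj_B B (B_coeffs B f k)))"

end

theory Submission
  imports Defs
begin

text \<open>
  If \<open>D\<close> is \<open>conj_B B\<close> in case (i) and \<open>conj_B_star B\<close> in case (ii), then \<open>U = C \<circ> D\<close> is a unitary
  operator commuting with multiplication by \<open>B\<close>. The functions \<open>e\<^sub>j B\<^sup>k\<close> form an orthonormal basis
  and \<open>U (e\<^sub>j B\<^sup>k) = B\<^sup>k \<cdot> U e\<^sub>j\<close>, so on the \<open>j\<close>-th summand \<open>U\<close> can only be multiplication by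
  \<open>\<phi>\<^sub>j = U e\<^sub>j / e\<^sub>j\<close>. That \<open>\<phi>\<^sub>j\<close> is bounded follows from writing multiplication by it, on all of
  \<open>L2\<close>, as \<open>\<Sum>\<^sub>i (e\<^sub>i / e\<^sub>j) \<cdot> U S\<^sub>i\<close> with \<open>S\<^sub>i\<close> the partial isometry \<open>e\<^sub>i B\<^sup>k \<mapsto> e\<^sub>j B\<^sup>k\<close>.
  The adjoint of \<open>U\<close> is \<open>D \<circ> C = D U D\<close>, which is the claimed symmetry. Completeness of the
  \<open>e\<^sub>j B\<^sup>k\<close> rests on the identities \<open>\<beta>\<^sub>j\<^sub>-\<^sub>1 = c\<^sub>j e\<^sub>j + cnj \<lambda>\<^sub>j \<beta>\<^sub>j\<close> and
  \<open>c\<^sub>j z e\<^sub>j = \<lambda>\<^sub>j \<beta>\<^sub>j\<^sub>-\<^sub>1 - \<beta>\<^sub>j\<close> for the partial products \<open>\<beta>\<^sub>j\<close> of \<open>B\<close>, which make the closed span of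
  the \<open>e\<^sub>j B\<^sup>k\<close> contain \<open>1\<close> and be invariant under \<open>z\<close> and \<open>cnj z\<close>.
\<close>

section \<open>The circle measure\<close>

text \<open>The obstacle is the boundedness of the symbols. The bound on \<open>U\<close> controls
  multiplication by \<open>\<phi>\<^sub>j\<close> only on the \<open>j\<close>-th summand, that is
  on products of \<open>e\<^sub>j\<close> with functions of \<open>B\<close>; for degree at least 2,
  the indicator of the set where the symbol is large need not be of that kind. This is why an
  operator on the whole space is assembled. Commutation with multiplication by \<open>B\<close> has
  two sources: in case (i) both \<open>C\<close> and \<open>conj_B B\<close> exchange multiplication
  by \<open>B\<close> with multiplication by its conjugate, in case (ii) both conjugations commute
  with it. The second conjugation is \<open>conj_B B\<close> preceded by the reflection
  \<open>flip\<close>, which inverts the power of \<open>B\<close>. Reflection and projections are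
  infinite sums of orthonormal vectors, hence the need for completeness of \<open>L2\<close>.
  Functions on the disc never appear: analyticity is expressed by continuous multipliers that
  preserve the vanishing of negative Fourier coefficients, and orthogonality of the basis reduces to
  \<open>z\<close> times a Hardy function having mean zero.\<close>

lemma space_circle [simp]: "space circle = sphere 0 1"
  by (simp add: circle_def space_restrict_space)

lemma sets_circle [measurable_cong]: "sets circle = sets (restrict_space borel (sphere 0 1))"
  by (simp add: circle_def)

lemma measurable_cis_circle:
  "cis \<in> measurable (uniform_measure lborel {0..2 * pi}) (restrict_space borel (sphere 0 1))"
proof -
  have "cis \<in> borel_measurable borel"
    by (intro borel_measurable_continuous_onI continuous_intros)
  then have "cis \<in> borel_measurable (uniform_measure lborel {0..2 * pi})"
    by simp
  then show ?thesis
    by (intro measurable_restrict_space2) auto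
qed

lemma emeasure_circle: "emeasure circle (sphere 0 1) = 1"
proof -
  have "emeasure circle (sphere 0 1)
      = emeasure (uniform_measure lborel {0..2 * pi}) (cis -` sphere 0 1 \<inter> UNIV)"
    unfolding circle_def
    by (subst emeasure_distr[OF measurable_cis_circle]) (auto simp: sets_restrict_space)
  also have "cis -` sphere 0 1 \<inter> UNIV = (UNIV :: real set)"
    by auto
  also have "emeasure (uniform_measure lborel {0..2 * pi}) UNIV = 1"
    using emeasure_uniform_measure_1[of lborel "{0..2 * pi}"] by simp
  finally show ?thesis .
qed

interpretation circle: finite_measure circle
  by standard (simp add: emeasure_circle)

lemma borel_measurable_circle_continuous:
  "continuous_on (sphere 0 1) f \<Longrightarrow> f \<in> borel_measurable circle"
  using borel_measurable_continuous_on_restrict measurable_cong_sets[OF sets_circle refl] by blast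

text \<open>Passes to Lebesgue integrals over one period, where the fundamental theorem of calculus
  applies.\<close>

lemma integral_circle:
  fixes f :: "complex \<Rightarrow> complex"
  assumes "f \<in> borel_measurable circle"
  shows "(LINT z|circle. f z)
    = (1 / (2 * pi)) *\<^sub>R (LINT t|lborel. indicator {0..2 * pi} t *\<^sub>R f (cis t))"
proof -
  let ?M = "uniform_measure lborel {0..2 * pi}"
  have f: "f \<in> borel_measurable (restrict_space borel (sphere 0 1))"
    using assms measurable_cong_sets[OF sets_circle refl] by blast
  have m: "(\<lambda>t. f (cis t)) \<in> borel_measurable borel"
    using measurable_compose[OF measurable_cis_circle f] by simp
  have "(LINT z|circle. f z) = (LINT t|?M. f (cis t))"
    unfolding circle_def by (rule integral_distr[OF measurable_cis_circle f])
  also have "\<dots> = (LINT t|density lborel (\<lambda>t. ennreal (indicator {0..2 * pi} t / (2 * pi))). f (cis t))"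
  proof -
    have "indicator {0..2 * pi} t / emeasure lborel {0..2 * pi}
        = ennreal (indicator {0..2 * pi} t / (2 * pi))" for t :: real
      by (auto simp: indicator_def divide_ennreal[symmetric])
    then show ?thesis
      unfolding uniform_measure_def by simp
  qed
  also have "\<dots> = (LINT t|lborel. (indicator {0..2 * pi} t / (2 * pi)) *\<^sub>R f (cis t))"
    using m by (intro integral_density) auto
  also have "\<dots> = (LINT t|lborel. (1 / (2 * pi)) *\<^sub>R indicator {0..2 * pi} t *\<^sub>R f (cis t))"
    by (intro Bochner_Integration.integral_cong) auto
  also have "\<dots> = (1 / (2 * pi)) *\<^sub>R (LINT t|lborel. indicator {0..2 * pi} t *\<^sub>R f (cis t))"
    by (rule integral_scaleR_right) 
  finally show ?thesis .
qed

text \<open>For nonzero \<open>k\<close> the antiderivative \<open>cis (k t) / (i k)\<close> takes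
  the same value at both ends of the period.\<close>

lemma integral_circle_powi: "(LINT z|circle. z powi k) = (if k = 0 then 1 else 0)"
proof (cases "k = 0")
  case True
  then show ?thesis
    by (simp add: measure_def emeasure_circle)
next
  case False
  have c: "continuous_on (sphere 0 1) (\<lambda>z::complex. z powi k)"
    by (intro continuous_intros) auto
  have "(LINT t|lborel. indicator {0..2 * pi} t *\<^sub>R (cis t powi k))
      = cis (real_of_int k * (2 * pi)) / (\<i> * of_int k) - cis (real_of_int k * 0) / (\<i> * of_int k)"
  proof (rule integral_FTC_atLeastAtMost)
    show "continuous_on {0..2 * pi} (\<lambda>t. cis t powi k)"
      by (simp add: cis_power_int) (intro continuous_intros)
    show "((\<lambda>t. cis (real_of_int k * t) / (\<i> * of_int k)) has_vector_derivative cis x powi k)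
        (at x within {0..2 * pi})" for x
      unfolding has_vector_derivative_def cis_power_int
      using False
      by (auto intro!: derivative_eq_intros simp: scaleR_conv_of_real field_simps)
  qed simp
  moreover have "cis (real_of_int k * (2 * pi)) = 1"
    using cis_multiple_2pi[of "real_of_int k"] by (simp add: mult.commute mult.left_commute)
  ultimately show ?thesis
    using False by (subst integral_circle[OF borel_measurable_circle_continuous[OF c]]) simp
qed

section \<open>The Hilbert space structure\<close>

lemma Linf_continuous:
  assumes "continuous_on (sphere 0 1) p"
  shows "p \<in> Linf_fun"
proof -
  have "bounded (p ` sphere 0 1)"
    by (intro compact_imp_bounded compact_continuous_image assms compact_sphere)
  then obtain M where "\<forall>z\<in>sphere 0 1. cmod (p z) \<le> M"
    by (auto simp: bounded_iff)
  then show ?thesis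
    using borel_measurable_circle_continuous[OF assms]
    by (auto simp: Linf_fun_def intro!: exI[of _ M] AE_I2)
qed

lemma L2_fun_const [simp]: "(\<lambda>_. c) \<in> L2_fun"
  by (simp add: L2_fun_def)

lemma Linf_imp_L2: "p \<in> Linf_fun \<Longrightarrow> p \<in> L2_fun"
  using L2_fun_mult_Linf[OF _ L2_fun_const[of 1]] by simp

lemma Linf_mult:
  assumes "p \<in> Linf_fun" "q \<in> Linf_fun"
  shows "(\<lambda>z. p z * q z) \<in> Linf_fun"
proof -
  obtain M N where "AE z in circle. cmod (p z) \<le> M" "AE z in circle. cmod (q z) \<le> N"
    using assms by (auto simp: Linf_fun_def)
  then have "AE z in circle. cmod (p z * q z) \<le> M * N"
  proof eventually_elim
    case (elim z)
    then show ?case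
      unfolding norm_mult by (intro mult_mono) (auto intro: order_trans[OF norm_ge_zero])
  qed
  then show ?thesis
    using assms by (auto simp: Linf_fun_def)
qed

lemma Linf_cnj: "p \<in> Linf_fun \<Longrightarrow> (\<lambda>z. cnj (p z)) \<in> Linf_fun"
  using Linf_imp_L2[THEN L2_fun_cnj] by (auto simp: Linf_fun_def L2_fun_def)

lemma L2_fun_measurable: "f \<in> L2_fun \<Longrightarrow> f \<in> borel_measurable circle"
  by (simp add: L2_fun_def)

lemma L2_fun_diff: "f \<in> L2_fun \<Longrightarrow> g \<in> L2_fun \<Longrightarrow> (\<lambda>z. f z - g z) \<in> L2_fun"
  using L2_fun_add[of f "\<lambda>z. -1 * g z"] L2_fun_scale[of g "-1"] by simp

lemma L2_of_eq_iff:
  "f \<in> L2_fun \<Longrightarrow> g \<in> L2_fun \<Longrightarrow> L2_of f = L2_of g \<longleftrightarrow> (AE z in circle. f z = g z)"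
  by transfer (simp add: L2_eq_def)

text \<open>Lets an identity be checked on a square-integrable representative, where
  \<open>L2_of\<close> and \<open>mult_op\<close> are given by plain formulas.\<close>

lemma L2_cases:
  obtains f where "f \<in> L2_fun" "F = L2_of f"
proof -
  have "L2_eq (rep_L2 F) (rep_L2 F)"
    by (metis Quotient_L2 Quotient_rep_reflp)
  then have "rep_L2 F \<in> L2_fun"
    by (simp add: L2_eq_def)
  moreover from this have "L2_of (rep_L2 F) = abs_L2 (rep_L2 F)"
    by (simp add: L2_of_def)
  then have "F = L2_of (rep_L2 F)"
    by (simp add: Quotient_abs_rep[OF Quotient_L2])
  ultimately show ?thesis
    using that by blast
qed

lemma L2_of_add: "f \<in> L2_fun \<Longrightarrow> g \<in> L2_fun \<Longrightarrow> L2_of f + L2_of g = L2_of (\<lambda>z. f z + g z)"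
  by transfer (auto simp: L2_eq_def L2_fun_add)

lemma L2_of_scale: "f \<in> L2_fun \<Longrightarrow> scaleC c (L2_of f) = L2_of (\<lambda>z. c * f z)"
  by transfer (auto simp: L2_eq_def L2_fun_scale)

lemma L2_of_cnj: "f \<in> L2_fun \<Longrightarrow> cnj_L2 (L2_of f) = L2_of (\<lambda>z. cnj (f z))"
  by transfer (auto simp: L2_eq_def L2_fun_cnj)

lemma L2_of_mult:
  "p \<in> Linf_fun \<Longrightarrow> f \<in> L2_fun \<Longrightarrow> mult_op p (L2_of f) = L2_of (\<lambda>z. p z * f z)"
  by transfer (auto simp: L2_eq_def L2_fun_mult_Linf)

lemma L2_of_zero: "L2_of (\<lambda>_. 0) = 0"
  by transfer (auto simp: L2_eq_def)

lemma L2_of_minus: "f \<in> L2_fun \<Longrightarrow> - L2_of f = L2_of (\<lambda>z. - f z)"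
  using L2_fun_scale[of f "-1"] by transfer (auto simp: L2_eq_def)

lemma L2_of_diff: "f \<in> L2_fun \<Longrightarrow> g \<in> L2_fun \<Longrightarrow> L2_of f - L2_of g = L2_of (\<lambda>z. f z - g z)"
  using L2_fun_scale[of g "-1"] by (simp add: minus_L2_def L2_of_minus L2_of_add)

lemma cinner_L2_of:
  "f \<in> L2_fun \<Longrightarrow> g \<in> L2_fun \<Longrightarrow> cinner (L2_of f) (L2_of g) = (LINT z|circle. f z * cnj (g z))"
  by transfer simp

lemma norm_L2_of: "f \<in> L2_fun \<Longrightarrow> (norm (L2_of f))\<^sup>2 = (LINT z|circle. (cmod (f z))\<^sup>2)"
proof -
  assume f: "f \<in> L2_fun"
  have "(norm (L2_of f))\<^sup>2 = Re (LINT z|circle. f z * cnj (f z))"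
    using f cinner_self(1)[of "L2_of f"] by (simp add: norm_L2_def cinner_L2_of)
  also have "\<dots> = (LINT z|circle. (cmod (f z))\<^sup>2)"
    using L2_fun_integrable[OF f f]
    by (subst integral_Re [symmetric]) (auto simp: cmod_power2 simp flip: power2_eq_square)
  finally show ?thesis .
qed

lemma cinner_self_norm: "cinner f f = complex_of_real ((norm f)\<^sup>2)"
proof (rule complex_eqI)
  show "Re (cinner f f) = Re (complex_of_real ((norm f)\<^sup>2))"
    by (simp add: norm_L2_def cinner_self)
  have "Im (cinner f f) = Im (cnj (cinner f f))"
    by (subst cinner_commute) simp
  then show "Im (cinner f f) = Im (complex_of_real ((norm f)\<^sup>2))"
    by simp
qed

lemma cinner_add_right: "cinner h (f + g) = cinner h f + cinner h g"
  by (subst (1 2 3) cinner_commute) (simp add: cinner_add_left)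

lemma cinner_scaleC_right: "cinner f (scaleC c g) = cnj c * cinner f g"
  by (subst (1 2) cinner_commute) (simp add: cinner_scaleC_left)

lemma scaleC_minus1: "scaleC (-1) f = - f"
  by (simp add: L2.scale_minus_left)

lemma cinner_uminus_left: "cinner (- f) g = - cinner f g"
  using cinner_scaleC_left[of "-1" f g] by (simp add: scaleC_minus1)

lemma cinner_diff_left: "cinner (f - g) h = cinner f h - cinner g h"
  using cinner_add_left[of f "- g" h] by (simp add: cinner_uminus_left)

lemma cinner_zero_left [simp]: "cinner 0 f = 0"
  using cinner_scaleC_left[of 0 0 f] by simp

lemma cinner_zero_right [simp]: "cinner f 0 = 0"
  by (subst cinner_commute) simp

lemma cinner_sum_left: "cinner (\<Sum>i\<in>A. f i) g = (\<Sum>i\<in>A. cinner (f i) g)"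
  by (induction A rule: infinite_finite_induct) (auto simp: cinner_add_left)

lemma cinner_sum_right: "cinner g (\<Sum>i\<in>A. f i) = (\<Sum>i\<in>A. cinner g (f i))"
  by (induction A rule: infinite_finite_induct) (auto simp: cinner_add_right)

lemma norm_scaleC: "norm (scaleC c f) = cmod c * norm f"
proof -
  have "complex_of_real ((norm (scaleC c f))\<^sup>2) = (c * cnj c) * complex_of_real ((norm f)\<^sup>2)"
    by (simp only: cinner_self_norm[symmetric] cinner_scaleC_left cinner_scaleC_right) simp
  also have "\<dots> = complex_of_real ((cmod c * norm f)\<^sup>2)"
    by (simp add: complex_norm_square[symmetric] power_mult_distrib)
  finally have "(norm (scaleC c f))\<^sup>2 = (cmod c * norm f)\<^sup>2"
    using of_real_eq_iff by blast
  then show ?thesis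
    by (rule power2_eq_imp_eq) auto
qed

text \<open>Multiplying \<open>f\<close> by a phase makes the complex inner product real and
  nonnegative, which reduces the claim to the inequality of the real inner product.\<close>

lemma cinner_Cauchy_Schwarz: "cmod (cinner f g) \<le> norm f * norm g"
proof -
  define c where "c = cnj (sgn (cinner f g))"
  have "c * cinner f g = complex_of_real (cmod (cinner f g))"
    unfolding c_def by (simp add: complex_sgn_def scaleR_conv_of_real
      mult.commute[of "cnj _"] complex_norm_square[symmetric] power2_eq_square divide_simps
      flip: of_real_power)
  then have "cmod (cinner f g) = inner (scaleC c f) g"
    by (simp add: inner_L2_def cinner_scaleC_left)
  also have "\<dots> \<le> norm (scaleC c f) * norm g"
    by (rule norm_cauchy_schwarz)
  also have "\<dots> \<le> norm f * norm g"
  proof (intro mult_right_mono)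
    \<comment> \<open>Since \<open>sgn 0 = 0\<close>, the modulus of \<open>c\<close> is 1 or 0; the
      inequality covers both cases.\<close>
    have "cmod c \<le> 1"
      by (simp add: c_def norm_sgn)
    then show "norm (scaleC c f) \<le> norm f"
      by (simp add: norm_scaleC mult_left_le_one_le)
  qed simp
  finally show ?thesis .
qed

lemma bounded_linear_cinner_left: "bounded_linear (\<lambda>f. cinner f g)"
  by (rule bounded_linear_intro[where K = "norm g"])
    (auto simp: cinner_add_left scaleR_L2_def cinner_scaleC_left scaleR_conv_of_real
      cinner_Cauchy_Schwarz)

lemma bounded_linear_scaleC: "bounded_linear (scaleC c)"
  by (rule bounded_linear_intro[where K = "cmod c"])
    (auto simp: L2.scale_right_distrib scaleR_L2_def norm_scaleC mult.commute)

lemma cinner_eqI: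
  assumes "\<And>h. cinner f h = cinner g h"
  shows "f = g"
proof -
  have "cinner (f - g) (f - g) = 0"
    using assms by (simp add: cinner_diff_left)
  then show ?thesis
    using cinner_self(2)[of "f - g"] by simp
qed

subsection \<open>Multiplication operators\<close>

lemma mult_op_add: "mult_op p (f + g) = mult_op p f + mult_op p g"
  by transfer (auto simp: L2_eq_def L2_fun_add L2_fun_mult_Linf distrib_left)

lemma mult_op_scaleC: "mult_op p (scaleC c f) = scaleC c (mult_op p f)"
  by transfer (auto simp: L2_eq_def L2_fun_scale L2_fun_mult_Linf)

lemma mult_op_mult:
  assumes "p \<in> Linf_fun" "q \<in> Linf_fun"
  shows "mult_op p (mult_op q f) = mult_op (\<lambda>z. p z * q z) f"
  by (rule L2_cases[of f]) (simp add: assms Linf_mult L2_of_mult L2_fun_mult_Linf mult.assoc)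

lemma mult_op_cong_AE:
  assumes "p \<in> Linf_fun" "q \<in> Linf_fun" "AE z in circle. p z = q z"
  shows "mult_op p = mult_op q"
proof
  fix F
  show "mult_op p F = mult_op q F"
  proof (rule L2_cases[of F])
    fix f assume f: "f \<in> L2_fun" "F = L2_of f"
    have "AE z in circle. p z * f z = q z * f z"
      using assms(3) by eventually_elim simp
    then show "mult_op p F = mult_op q F"
      using assms f by (simp add: L2_of_mult L2_of_eq_iff L2_fun_mult_Linf)
  qed
qed

lemma mult_op_cong:
  assumes "q \<in> Linf_fun" "\<And>z. cmod z = 1 \<Longrightarrow> p z = q z"
  shows "mult_op p = mult_op q"
proof -
  have "p \<in> borel_measurable circle \<longleftrightarrow> q \<in> borel_measurable circle"
    using assms(2) by (intro measurable_cong) simp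
  moreover have "AE z in circle. p z = q z"
    using assms(2) by (intro AE_I2) simp
  moreover from this have "\<exists>M. AE z in circle. cmod (p z) \<le> M"
  proof -
    obtain M where "AE z in circle. cmod (q z) \<le> M"
      using assms(1) by (auto simp: Linf_fun_def)
    with \<open>AE z in circle. p z = q z\<close> have "AE z in circle. cmod (p z) \<le> M"
      by eventually_elim simp
    then show ?thesis ..
  qed
  ultimately show ?thesis
    using assms(1) by (intro mult_op_cong_AE) (auto simp: Linf_fun_def)
qed

lemma mult_op_one [simp]: "mult_op (\<lambda>_. 1) f = f"
  by (rule L2_cases[of f]) (simp add: L2_of_mult Linf_continuous)

lemma cinner_mult_op:
  assumes "p \<in> Linf_fun"
  shows "cinner (mult_op p f) g = cinner f (mult_op (\<lambda>z. cnj (p z)) g)"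
  by (rule L2_cases[of f], rule L2_cases[of g])
    (simp add: assms L2_of_mult Linf_cnj cinner_L2_of L2_fun_mult_Linf,
      simp add: mult.commute mult.left_commute)

lemma norm_mult_op_le:
  assumes "p \<in> Linf_fun" "AE z in circle. cmod (p z) \<le> M" "0 \<le> M"
  shows "norm (mult_op p F) \<le> M * norm F"
proof (rule L2_cases[of F])
  fix f assume f: "f \<in> L2_fun" "F = L2_of f"
  have "(norm (mult_op p F))\<^sup>2 = (LINT z|circle. (cmod (p z * f z))\<^sup>2)"
    using f assms by (simp add: L2_of_mult norm_L2_of L2_fun_mult_Linf)
  also have "\<dots> \<le> (LINT z|circle. M\<^sup>2 * (cmod (f z))\<^sup>2)"
  proof (rule integral_mono_AE)
    show "integrable circle (\<lambda>z. (cmod (p z * f z))\<^sup>2)"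
      using L2_fun_mult_Linf[OF assms(1) f(1)] by (simp add: L2_fun_def)
    show "integrable circle (\<lambda>z. M\<^sup>2 * (cmod (f z))\<^sup>2)"
      using f by (simp add: L2_fun_def)
    show "AE z in circle. (cmod (p z * f z))\<^sup>2 \<le> M\<^sup>2 * (cmod (f z))\<^sup>2"
      using assms(2)
      by eventually_elim (auto simp: norm_mult power_mult_distrib intro!: mult_right_mono power_mono)
  qed
  also have "\<dots> = (M * norm F)\<^sup>2"
    using f by (simp add: norm_L2_of power_mult_distrib)
  finally show ?thesis
    by (rule power2_le_imp_le) (simp add: assms(3))
qed

lemma bounded_linear_mult_op: "p \<in> Linf_fun \<Longrightarrow> bounded_linear (mult_op p)"
proof -
  assume p: "p \<in> Linf_fun"
  then obtain M where M: "AE z in circle. cmod (p z) \<le> M"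
    by (auto simp: Linf_fun_def)
  \<comment> \<open>The bound taken from \<open>Linf_fun\<close> carries no sign condition, but
    \<open>norm_mult_op_le\<close> asks for one.\<close>
  then have "AE z in circle. cmod (p z) \<le> max 0 M"
    by eventually_elim auto
  then have "norm (mult_op p f) \<le> norm f * max 0 M" for f
    using norm_mult_op_le[OF p, of "max 0 M" f] by (simp add: mult.commute)
  then show ?thesis
    by (intro bounded_linear_intro) (auto simp: mult_op_add scaleR_L2_def mult_op_scaleC)
qed

lemma norm_mult_op_unimodular:
  assumes "p \<in> Linf_fun" "AE z in circle. cmod (p z) = 1"
  shows "norm (mult_op p F) = norm F"
proof -
  have "cinner (mult_op p F) (mult_op p F) = cinner F F"
  proof -
    have "AE z in circle. cnj (p z) * p z = 1"
      using assms(2)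
      by eventually_elim (simp add: mult.commute[of "cnj _"] complex_norm_square[symmetric])
    then have "mult_op (\<lambda>z. cnj (p z) * p z) = mult_op (\<lambda>_. 1)"
      using assms(1) by (intro mult_op_cong_AE Linf_mult Linf_cnj) (auto intro: Linf_continuous)
    then show ?thesis
      using assms(1) by (simp add: cinner_mult_op mult_op_mult Linf_cnj)
  qed
  then show ?thesis
    by (simp add: norm_L2_def)
qed

section \<open>Completeness\<close>

lemma norm_L2_of_one: "norm (L2_of (\<lambda>_. 1)) = 1"
proof -
  have "(norm (L2_of (\<lambda>_. 1)))\<^sup>2 = 1\<^sup>2"
    by (subst norm_L2_of) (auto simp: measure_def emeasure_circle)
  then show ?thesis
    by (rule power2_eq_imp_eq) auto
qed

lemma L2_fun_norm: "h \<in> L2_fun \<Longrightarrow> (\<lambda>z. complex_of_real (cmod (h z))) \<in> L2_fun"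
  by (auto simp: L2_fun_def)

lemma L2_fun_integrable_1:
  assumes "h \<in> L2_fun"
  shows "integrable circle h"
  using L2_fun_integrable[OF assms L2_fun_const[of 1]] by simp

text \<open>Cauchy-Schwarz against the constant 1, which has norm 1 because \<open>circle\<close>
  has total mass 1.\<close>

lemma L1_le_L2:
  assumes "h \<in> L2_fun"
  shows "(LINT z|circle. cmod (h z)) \<le> norm (L2_of h)"
proof -
  let ?a = "L2_of (\<lambda>z. complex_of_real (cmod (h z)))"
  have "(norm ?a)\<^sup>2 = (norm (L2_of h))\<^sup>2"
    using assms by (simp add: norm_L2_of L2_fun_norm)
  then have n: "norm ?a = norm (L2_of h)"
    by (rule power2_eq_imp_eq) auto
  have "cinner ?a (L2_of (\<lambda>_. 1)) = complex_of_real (LINT z|circle. cmod (h z))"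
    using assms by (simp add: cinner_L2_of L2_fun_norm)
  then have "(LINT z|circle. cmod (h z)) \<le> cmod (cinner ?a (L2_of (\<lambda>_. 1)))"
    by simp
  also have "\<dots> \<le> norm ?a * norm (L2_of (\<lambda>_. 1))"
    by (rule cinner_Cauchy_Schwarz)
  finally show ?thesis
    using n by (simp add: norm_L2_of_one)
qed

lemma nn_integral_L2:
  assumes "h \<in> L2_fun"
  shows "(\<integral>\<^sup>+z. ennreal ((cmod (h z))\<^sup>2) \<partial>circle) = ennreal ((norm (L2_of h))\<^sup>2)"
  unfolding norm_L2_of[OF assms] using assms
  by (intro nn_integral_eq_integral) (auto simp: L2_fun_def)

lemma L2_funI_nn_integral:
  assumes "h \<in> borel_measurable circle" "(\<integral>\<^sup>+z. ennreal ((cmod (h z))\<^sup>2) \<partial>circle) \<le> ennreal e"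
  shows "h \<in> L2_fun"
  unfolding L2_fun_def
proof (safe intro!: integrableI_bounded assms(1))
  show "(\<integral>\<^sup>+ x. ennreal (norm ((cmod (h x))\<^sup>2)) \<partial>circle) < \<infinity>"
    using assms(2) by (auto simp: less_top top_unique intro: le_less_trans)
qed (use assms(1) in measurable)

text \<open>The sum of the absolute values has finite integral, because L1 norms are dominated by L2
  norms; hence it is finite almost everywhere.\<close>

lemma AE_summable_of_summable_norm:
  assumes "\<And>k. h k \<in> L2_fun" "summable (\<lambda>k. norm (L2_of (h k)))"
  shows "AE z in circle. summable (\<lambda>k. h k z)"
proof -
  have i: "integrable circle (h k)" for k
    using L2_fun_integrable_1 assms by blast
  have [measurable]: "h k \<in> borel_measurable circle" for k
    using assms by (simp add: L2_fun_measurable)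
  have "(\<integral>\<^sup>+z. (\<Sum>k. ennreal (cmod (h k z))) \<partial>circle) = (\<Sum>k. \<integral>\<^sup>+z. ennreal (cmod (h k z)) \<partial>circle)"
    by (intro nn_integral_suminf) auto
  also have "\<dots> \<le> (\<Sum>k. ennreal (norm (L2_of (h k))))"
  proof (intro suminf_le)
    fix k
    have "(\<integral>\<^sup>+z. ennreal (cmod (h k z)) \<partial>circle) = ennreal (LINT z|circle. cmod (h k z))"
      by (intro nn_integral_eq_integral integrable_norm i) auto
    also have "\<dots> \<le> ennreal (norm (L2_of (h k)))"
      by (intro ennreal_leI L1_le_L2 assms)
    finally show "(\<integral>\<^sup>+z. ennreal (cmod (h k z)) \<partial>circle) \<le> ennreal (norm (L2_of (h k)))" .
  qed auto
  also have "\<dots> < \<infinity>"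
    using assms(2) by (simp add: suminf_ennreal2)
  finally have "AE z in circle. (\<Sum>k. ennreal (cmod (h k z))) \<noteq> \<infinity>"
    by (intro nn_integral_PInf_AE) auto
  then show ?thesis
  proof eventually_elim
    case (elim z)
    then have "summable (\<lambda>k. cmod (h k z))"
      by (intro summable_suminf_not_top) (auto simp: top.not_eq_extremum)
    then show ?case
      by (rule summable_norm_cancel)
  qed
qed

text \<open>The Riesz-Fischer argument: geometric increments give a pointwise limit almost
  everywhere by telescoping, and Fatou's lemma shows that it is also the limit in norm.\<close>

lemma Cauchy_L2_subsequence:
  assumes "\<And>k. f k \<in> L2_fun" "\<And>k. norm (L2_of (f (Suc k)) - L2_of (f k)) \<le> (1/2) ^ k"
    and "Cauchy (\<lambda>k. L2_of (f k))"
  shows "convergent (\<lambda>k. L2_of (f k))"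
proof -
  have [measurable]: "f k \<in> borel_measurable circle" for k
    using assms by (simp add: L2_fun_measurable)
  have "AE z in circle. summable (\<lambda>k. f (Suc k) z - f k z)"
  proof (rule AE_summable_of_summable_norm)
    show "summable (\<lambda>k. norm (L2_of (\<lambda>z. f (Suc k) z - f k z)))"
    proof (rule summable_comparison_test')
      show "summable (\<lambda>k. (1/2::real) ^ k)"
        by simp
      show "norm (norm (L2_of (\<lambda>z. f (Suc k) z - f k z))) \<le> (1/2) ^ k" for k
        using assms(2)[of k] by (simp add: L2_of_diff assms(1))
    qed
  qed (simp add: L2_fun_diff assms)
  then have conv: "AE z in circle. (\<lambda>k. f k z) \<longlonglongrightarrow> lim (\<lambda>k. f k z)"
  proof eventually_elim
    case (elim z)
    then have "convergent (\<lambda>n. f n z - f 0 z)"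
      by (simp add: summable_iff_convergent sum_lessThan_telescope[of "\<lambda>k. f k z"])
    then show ?case
      by (simp add: convergent_diff_const_right_iff flip: convergent_LIMSEQ_iff)
  qed
  define g where "g z = lim (\<lambda>k. f k z)" for z
  have [measurable]: "g \<in> borel_measurable circle"
    unfolding g_def by (rule borel_measurable_lim_metric) simp
  \<comment> \<open>Fatou's lemma in the index \<open>m\<close> carries a bound on all later
    differences over to the pointwise limit.\<close>
  have *: "(\<lambda>z. g z - f k z) \<in> L2_fun \<and> norm (L2_of (\<lambda>z. g z - f k z)) \<le> e"
    if "e \<ge> 0" "\<And>m. m \<ge> k \<Longrightarrow> norm (L2_of (f m) - L2_of (f k)) \<le> e" for k e
  proof -
    have "(\<integral>\<^sup>+z. ennreal ((cmod (g z - f k z))\<^sup>2) \<partial>circle)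
        = (\<integral>\<^sup>+z. liminf (\<lambda>m. ennreal ((cmod (f m z - f k z))\<^sup>2)) \<partial>circle)"
    proof (rule nn_integral_cong_AE, use conv in eventually_elim)
      fix z assume "(\<lambda>k. f k z) \<longlonglongrightarrow> lim (\<lambda>k. f k z)"
      then have "(\<lambda>m. ennreal ((cmod (f m z - f k z))\<^sup>2)) \<longlonglongrightarrow> ennreal ((cmod (g z - f k z))\<^sup>2)"
        unfolding g_def by (intro tendsto_intros)
      then show "ennreal ((cmod (g z - f k z))\<^sup>2) = liminf (\<lambda>m. ennreal ((cmod (f m z - f k z))\<^sup>2))"
        by (intro lim_imp_Liminf[symmetric] sequentially_bot)
    qed
    also have "\<dots> \<le> liminf (\<lambda>m. \<integral>\<^sup>+z. ennreal ((cmod (f m z - f k z))\<^sup>2) \<partial>circle)"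
      by (rule nn_integral_liminf) measurable
    also have "\<dots> \<le> ennreal (e\<^sup>2)"
    proof (rule Liminf_le)
      show "\<forall>\<^sub>F m in sequentially. (\<integral>\<^sup>+z. ennreal ((cmod (f m z - f k z))\<^sup>2) \<partial>circle) \<le> ennreal (e\<^sup>2)"
        using eventually_ge_at_top[of k]
      proof eventually_elim
        case (elim m)
        have "(\<integral>\<^sup>+z. ennreal ((cmod (f m z - f k z))\<^sup>2) \<partial>circle)
            = ennreal ((norm (L2_of (f m) - L2_of (f k)))\<^sup>2)"
          by (simp add: nn_integral_L2 L2_fun_diff assms(1) L2_of_diff)
        also have "\<dots> \<le> ennreal (e\<^sup>2)"
          by (intro ennreal_leI power_mono that elim) simp
        finally show ?case .
      qed
    qed simp
    finally have le: "(\<integral>\<^sup>+z. ennreal ((cmod (g z - f k z))\<^sup>2) \<partial>circle) \<le> ennreal (e\<^sup>2)" .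
    then have L2: "(\<lambda>z. g z - f k z) \<in> L2_fun"
      by (intro L2_funI_nn_integral) auto
    moreover have "(norm (L2_of (\<lambda>z. g z - f k z)))\<^sup>2 \<le> e\<^sup>2"
      using le by (simp add: nn_integral_L2[OF L2] ennreal_le_iff)
    ultimately show ?thesis
      using that(1) power2_le_imp_le by blast
  qed
  have C: "\<exists>K. \<forall>k\<ge>K. \<forall>m\<ge>k. norm (L2_of (f m) - L2_of (f k)) \<le> e" if "e > 0" for e
  proof -
    from assms(3) that obtain K where "\<forall>m\<ge>K. \<forall>k\<ge>K. norm (L2_of (f m) - L2_of (f k)) < e"
      unfolding Cauchy_iff by blast
    then show ?thesis
      by (intro exI[of _ K]) (auto intro: less_imp_le)
  qed
  \<comment> \<open>A single index with a finite bound suffices to place \<open>g\<close> itself in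
    L2.\<close>
  obtain K where "\<forall>k\<ge>K. \<forall>m\<ge>k. norm (L2_of (f m) - L2_of (f k)) \<le> 1"
    using C[of 1] by auto
  with *[of 1 K] have "(\<lambda>z. g z - f K z) \<in> L2_fun"
    by simp
  from L2_fun_add[OF this assms(1)[of K]] have g: "g \<in> L2_fun"
    by simp
  have "(\<lambda>k. L2_of (f k)) \<longlonglongrightarrow> L2_of g"
    unfolding LIMSEQ_iff
  proof safe
    fix e :: real assume e: "e > 0"
    obtain K where K: "\<forall>k\<ge>K. \<forall>m\<ge>k. norm (L2_of (f m) - L2_of (f k)) \<le> e / 2"
      using C[of "e/2"] e by auto
    show "\<exists>K. \<forall>k\<ge>K. norm (L2_of (f k) - L2_of g) < e"
    proof (intro exI[of _ K] allI impI)
      fix k assume "k \<ge> K"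
      then have "norm (L2_of (\<lambda>z. g z - f k z)) \<le> e / 2"
        using *[of "e/2" k] K e by simp
      then show "norm (L2_of (f k) - L2_of g) < e"
        using e by (simp add: L2_of_diff[OF g assms(1), symmetric] norm_minus_commute)
    qed
  qed
  then show ?thesis
    by (auto simp: convergent_def)
qed

instance L2 :: complete_space
proof
  fix X :: "nat \<Rightarrow> L2" assume X: "Cauchy X"
  have "\<exists>M. \<forall>m\<ge>M. \<forall>n\<ge>M. norm (X m - X n) < (1/2) ^ k" for k
    using X unfolding Cauchy_iff by simp
  then obtain M where M: "\<And>k m n. m \<ge> M k \<Longrightarrow> n \<ge> M k \<Longrightarrow> norm (X m - X n) < (1/2) ^ k"
    by metis
  \<comment> \<open>The sum dominates each \<open>M k\<close>, and the summand \<open>k\<close>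
    makes the sequence strictly increasing.\<close>
  define r where "r k = k + (\<Sum>i\<le>k. M i)" for k
  have r: "strict_mono r"
    by (auto simp: strict_mono_Suc_iff r_def)
  have rM: "r k \<ge> M k" for k
    unfolding r_def by (rule trans_le_add2) (auto intro: member_le_sum)
  have "\<exists>f. f \<in> L2_fun \<and> X (r k) = L2_of f" for k
    by (rule L2_cases[of "X (r k)"]) auto
  then obtain f where f: "\<And>k. f k \<in> L2_fun" "\<And>k. X (r k) = L2_of (f k)"
    by metis
  have "convergent (\<lambda>k. L2_of (f k))"
  proof (rule Cauchy_L2_subsequence)
    show "norm (L2_of (f (Suc k)) - L2_of (f k)) \<le> (1/2) ^ k" for k
    proof -
      have "r (Suc k) \<ge> r k"
        using r by (simp add: strict_mono_leD)
      then show ?thesis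
        using M[of k "r (Suc k)" "r k"] rM[of k] by (simp add: f(2))
    qed
    show "Cauchy (\<lambda>k. L2_of (f k))"
      using Cauchy_subseq_Cauchy[OF X r] by (simp add: comp_def f(2))
  qed (fact f)
  then obtain l where "(X \<circ> r) \<longlonglongrightarrow> l"
    by (auto simp: convergent_def comp_def f(2))
  then show "convergent X"
    using Cauchy_converges_subseq[OF X r] by (auto simp: convergent_def)
qed

instance L2 :: banach ..

text \<open>Dominated convergence in L2; it later brings indicators and measurable functions into a
  closed subspace.\<close>

lemma L2_of_tendsto:
  assumes "\<And>m. f m \<in> borel_measurable circle" "g \<in> L2_fun" "w \<in> L2_fun"
    and "\<And>z. cmod z = 1 \<Longrightarrow> (\<lambda>m. f m z) \<longlonglongrightarrow> g z"
    and "\<And>m z. cmod z = 1 \<Longrightarrow> cmod (f m z) \<le> cmod (w z)"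
  shows "\<And>m. f m \<in> L2_fun" "(\<lambda>m. L2_of (f m)) \<longlonglongrightarrow> L2_of g"
proof -
  have [measurable]: "f m \<in> borel_measurable circle" "g \<in> borel_measurable circle" "w \<in> borel_measurable circle" for m
    using assms by (auto simp: L2_fun_measurable)
  have gw: "cmod (g z) \<le> cmod (w z)" if "cmod z = 1" for z
    using assms(5)[OF that] tendsto_norm[OF assms(4)[OF that]] by (intro Lim_bounded) auto
  show f: "f m \<in> L2_fun" for m
  proof -
    have "integrable circle (\<lambda>z. (cmod (w z))\<^sup>2)"
      using assms(3) by (simp add: L2_fun_def)
    then have "integrable circle (\<lambda>z. (cmod (f m z))\<^sup>2)"
    proof (rule Bochner_Integration.integrable_bound)
      show "AE z in circle. norm ((cmod (f m z))\<^sup>2) \<le> norm ((cmod (w z))\<^sup>2)"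
        using assms(5) by (intro AE_I2) (simp add: power_mono)
    qed measurable
    then show ?thesis
      using assms(1) by (simp add: L2_fun_def)
  qed
  have "(\<lambda>m. LINT z|circle. (cmod (f m z - g z))\<^sup>2) \<longlonglongrightarrow> (LINT z|circle. 0)"
  \<comment> \<open>Both \<open>f m\<close> and \<open>g\<close> are dominated by \<open>w\<close>,
    so the difference is at most \<open>2 * cmod (w z)\<close>; squaring gives the 4.\<close>
  proof (rule integral_dominated_convergence[where w = "\<lambda>z. 4 * (cmod (w z))\<^sup>2"])
    show "integrable circle (\<lambda>z. 4 * (cmod (w z))\<^sup>2)"
      using assms(3) by (auto simp: L2_fun_def)
    show "AE z in circle. (\<lambda>m. (cmod (f m z - g z))\<^sup>2) \<longlonglongrightarrow> 0"
    proof (intro AE_I2)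
      fix z assume "z \<in> space circle"
      then have "(\<lambda>m. (cmod (f m z - g z))\<^sup>2) \<longlonglongrightarrow> (cmod (g z - g z))\<^sup>2"
        using assms(4) by (intro tendsto_intros) auto
      then show "(\<lambda>m. (cmod (f m z - g z))\<^sup>2) \<longlonglongrightarrow> 0"
        by simp
    qed
    show "AE z in circle. norm ((cmod (f m z - g z))\<^sup>2) \<le> 4 * (cmod (w z))\<^sup>2" for m
    proof (intro AE_I2)
      fix z assume "z \<in> space circle"
      then have "cmod (f m z - g z) \<le> 2 * cmod (w z)"
        using gw[of z] assms(5)[of z m] norm_triangle_ineq4[of "f m z" "g z"] by simp
      then have "(cmod (f m z - g z))\<^sup>2 \<le> (2 * cmod (w z))\<^sup>2"
        by (intro power_mono) auto
      then show "norm ((cmod (f m z - g z))\<^sup>2) \<le> 4 * (cmod (w z))\<^sup>2"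
        by (simp add: power_mult_distrib)
    qed
  qed measurable
  then have "(\<lambda>m. (norm (L2_of (f m) - L2_of g))\<^sup>2) \<longlonglongrightarrow> 0"
    by (simp add: L2_of_diff f assms(2) norm_L2_of L2_fun_diff)
  from tendsto_real_sqrt[OF this] have "(\<lambda>m. norm (L2_of (f m) - L2_of g)) \<longlonglongrightarrow> 0"
    by simp
  then show "(\<lambda>m. L2_of (f m)) \<longlonglongrightarrow> L2_of g"
    using Lim_null tendsto_norm_zero_iff by blast
qed

section \<open>Closed subspaces and orthonormal families\<close>

lemma subspace_closure_L2:
  assumes "L2.subspace S"
  shows "L2.subspace (closure S)"
  unfolding L2.subspace_def
proof (intro conjI ballI allI)
  show "0 \<in> closure S"
    using L2.subspace_0[OF assms] closure_subset by blast
  show "x + y \<in> closure S" if "x \<in> closure S" "y \<in> closure S" for x y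
  proof -
    from that obtain a b where "\<And>n. a n \<in> S" "a \<longlonglongrightarrow> x" "\<And>n. b n \<in> S" "b \<longlonglongrightarrow> y"
      unfolding closure_sequential by blast
    then show ?thesis
      unfolding closure_sequential using L2.subspace_add[OF assms]
      by (intro exI[of _ "\<lambda>n. a n + b n"]) (auto intro: tendsto_add)
  qed
  show "scaleC c x \<in> closure S" if "x \<in> closure S" for c x
  proof -
    from that obtain a where "\<And>n. a n \<in> S" "a \<longlonglongrightarrow> x"
      unfolding closure_sequential by blast
    then show ?thesis
      unfolding closure_sequential using L2.subspace_scale[OF assms]
      by (intro exI[of _ "\<lambda>n. scaleC c (a n)"])
        (auto intro: bounded_linear.tendsto[OF bounded_linear_scaleC])
  qed
qed

lemma closure_span_minimal:
  assumes "S \<subseteq> W" "L2.subspace W" "closed W"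
  shows "closure (L2.span S) \<subseteq> W"
  using assms by (intro closure_minimal L2.span_minimal)

text \<open>Together with \<open>closure_span_minimal\<close> this reduces invariance of a closed
  span under an operator to its generators.\<close>

lemma subspace_vimage:
  assumes "L2.subspace W" "\<And>f g. T (f + g) = T f + T g" "\<And>c f. T (scaleC c f) = scaleC c (T f)"
  shows "L2.subspace (T -` W)"
proof -
  have "T 0 = 0"
    using assms(3)[of 0 0] by simp
  then show ?thesis
    using assms by (auto simp: L2.subspace_def)
qed

section \<open>Orthonormal families: Bessel's inequality, best approximation, summability\<close>

definition orthonormal_fam :: "'i set \<Rightarrow> ('i \<Rightarrow> L2) \<Rightarrow> bool" where
  "orthonormal_fam I b \<longleftrightarrow> (\<forall>i\<in>I. \<forall>j\<in>I. cinner (b i) (b j) = (if i = j then 1 else 0))"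

lemma orthonormal_famD:
  "orthonormal_fam I b \<Longrightarrow> i \<in> I \<Longrightarrow> j \<in> I \<Longrightarrow> cinner (b i) (b j) = (if i = j then 1 else 0)"
  by (simp add: orthonormal_fam_def)

lemma orthonormal_fam_reindex:
  assumes "orthonormal_fam I b" "inj_on p J" "p ` J \<subseteq> I"
  shows "orthonormal_fam J (\<lambda>i. b (p i))"
  using assms by (auto simp: orthonormal_fam_def inj_on_eq_iff image_subset_iff)

lemma cinner_sum_orthonormal:
  assumes "orthonormal_fam I b" "finite F" "F \<subseteq> I" "l \<in> I"
  shows "cinner (\<Sum>i\<in>F. scaleC (c i) (b i)) (b l) = (if l \<in> F then c l else 0)"
proof -
  have "cinner (\<Sum>i\<in>F. scaleC (c i) (b i)) (b l) = (\<Sum>i\<in>F. if i = l then c i else 0)"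
    unfolding cinner_sum_left using assms
    by (intro sum.cong) (auto simp: cinner_scaleC_left orthonormal_famD)
  then show ?thesis
    using assms(2) by simp
qed

lemma norm_sum_orthonormal:
  assumes "orthonormal_fam I b" "finite F" "F \<subseteq> I"
  shows "(norm (\<Sum>i\<in>F. scaleC (c i) (b i)))\<^sup>2 = (\<Sum>i\<in>F. (cmod (c i))\<^sup>2)"
proof -
  let ?s = "\<Sum>i\<in>F. scaleC (c i) (b i)"
  have "cinner ?s ?s = (\<Sum>i\<in>F. cnj (c i) * cinner ?s (b i))"
    unfolding cinner_sum_right[of ?s] by (simp add: cinner_scaleC_right)
  also have "\<dots> = (\<Sum>i\<in>F. complex_of_real ((cmod (c i))\<^sup>2))"
    using assms by (intro sum.cong refl)
      (auto simp: cinner_sum_orthonormal[OF assms] subset_iff complex_norm_square mult.commute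
        simp del: of_real_power)
  also have "\<dots> = complex_of_real (\<Sum>i\<in>F. (cmod (c i))\<^sup>2)"
    by simp
  finally show ?thesis
    unfolding cinner_self_norm of_real_eq_iff .
qed

lemma norm_add_orthogonal:
  assumes "cinner f g = 0"
  shows "(norm (f + g))\<^sup>2 = (norm f)\<^sup>2 + (norm g)\<^sup>2"
proof -
  have "cinner g f = 0"
    using assms by (subst cinner_commute) simp
  then have "complex_of_real ((norm (f + g))\<^sup>2) = complex_of_real ((norm f)\<^sup>2 + (norm g)\<^sup>2)"
    unfolding of_real_add cinner_self_norm[symmetric]
    using assms by (simp add: cinner_add_left cinner_add_right)
  then show ?thesis
    using of_real_eq_iff by blast
qed

text \<open>The one orthogonality from which \<open>bessel\<close> and
  \<open>best_approximation\<close> both follow by Pythagoras.\<close>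

lemma orthogonal_residual:
  assumes "orthonormal_fam I b" "finite F" "F \<subseteq> I"
  shows "cinner (f - (\<Sum>i\<in>F. scaleC (cinner f (b i)) (b i))) (\<Sum>i\<in>F. scaleC (c i) (b i)) = 0"
  unfolding cinner_sum_right
proof (intro sum.neutral ballI)
  fix l assume "l \<in> F"
  then show "cinner (f - (\<Sum>i\<in>F. scaleC (cinner f (b i)) (b i))) (scaleC (c l) (b l)) = 0"
    using assms(3) by (auto simp: cinner_scaleC_right cinner_diff_left cinner_sum_orthonormal[OF assms])
qed

lemma bessel:
  assumes "orthonormal_fam I b" "finite F" "F \<subseteq> I"
  shows "(\<Sum>i\<in>F. (cmod (cinner f (b i)))\<^sup>2) \<le> (norm f)\<^sup>2"
  using norm_add_orthogonal[OF orthogonal_residual[OF assms, of f "\<lambda>i. cinner f (b i)"]]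
    norm_sum_orthonormal[OF assms, of "\<lambda>i. cinner f (b i)"] by simp

lemma best_approximation:
  assumes "orthonormal_fam I b" "finite F" "F \<subseteq> I"
  shows "norm (f - (\<Sum>i\<in>F. scaleC (cinner f (b i)) (b i))) \<le> norm (f - (\<Sum>i\<in>F. scaleC (c i) (b i)))"
proof -
  let ?r = "f - (\<Sum>i\<in>F. scaleC (cinner f (b i)) (b i))"
  let ?d = "\<Sum>i\<in>F. scaleC (cinner f (b i) - c i) (b i)"
  have eq: "?r + ?d = f - (\<Sum>i\<in>F. scaleC (c i) (b i))"
    by (simp only: L2.scale_left_diff_distrib sum_subtractf) simp
  have "(norm (?r + ?d))\<^sup>2 = (norm ?r)\<^sup>2 + (norm ?d)\<^sup>2"
    by (intro norm_add_orthogonal orthogonal_residual[OF assms])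
  then have "(norm ?r)\<^sup>2 \<le> (norm (f - (\<Sum>i\<in>F. scaleC (c i) (b i))))\<^sup>2"
    unfolding eq using zero_le_power2[of "norm ?d"] by linarith
  then show ?thesis
    by (rule power2_le_imp_le) simp
qed

lemma in_span_image_finite:
  assumes "h \<in> L2.span (b ` I)"
  shows "\<exists>F c. finite F \<and> F \<subseteq> I \<and> h = (\<Sum>i\<in>F. scaleC (c i) (b i))"
  using assms
proof (induction rule: L2.span_induct_alt)
  case base
  show ?case
    by (intro exI[of _ "{}"]) simp
next
  case (step a x h)
  then obtain F c i where F: "finite F" "F \<subseteq> I" "h = (\<Sum>i\<in>F. scaleC (c i) (b i))" "i \<in> I" "x = b i"
    by auto
  \<comment> \<open>The index \<open>i\<close> may already belong to \<open>F\<close>, in which case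
    the two coefficients add up.\<close>
  define c' where "c' j = (if j = i then a else 0) + (if j \<in> F then c j else 0)" for j
  have "(\<Sum>j\<in>insert i F. scaleC (c' j) (b j)) =
      (\<Sum>j\<in>insert i F. if j = i then scaleC a (b j) else 0) +
      (\<Sum>j\<in>insert i F. if j \<in> F then scaleC (c j) (b j) else 0)"
    unfolding sum.distrib[symmetric]
    by (intro sum.cong) (auto simp: c'_def L2.scale_left_distrib)
  also have "(\<Sum>j\<in>insert i F. if j = i then scaleC a (b j) else 0) = scaleC a x"
    using F by simp
  also have "(\<Sum>j\<in>insert i F. if j \<in> F then scaleC (c j) (b j) else 0) = h"
    unfolding F(3) using F(1) by (intro sum.mono_neutral_cong_right) auto
  finally show ?case
    using F by (intro exI[of _ "insert i F"] exI[of _ c']) auto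
qed

lemma has_sum_metric_iff:
  fixes f :: "'i \<Rightarrow> 'a :: {comm_monoid_add, metric_space}"
  shows "(f has_sum s) I \<longleftrightarrow> (\<forall>e>0. \<exists>X. finite X \<and> X \<subseteq> I \<and>
    (\<forall>Y. finite Y \<and> X \<subseteq> Y \<and> Y \<subseteq> I \<longrightarrow> dist (\<Sum>i\<in>Y. f i) s < e))"
  by (simp add: has_sum_def tendsto_iff eventually_finite_subsets_at_top)

text \<open>Membership in the closure gives one good finite combination \<open>h\<close>; by best
  approximation every partial sum over a larger index set is at least as close to \<open>f\<close>,
  which is unconditional convergence.\<close>

lemma has_sum_expansion:
  assumes "orthonormal_fam I b" "f \<in> closure (L2.span (b ` I))"
  shows "((\<lambda>i. scaleC (cinner f (b i)) (b i)) has_sum f) I"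
  unfolding has_sum_metric_iff
proof safe
  fix e :: real assume "e > 0"
  then obtain h where h: "h \<in> L2.span (b ` I)" "dist h f < e"
    using assms(2) closure_approachable by blast
  then obtain F c where F: "finite F" "F \<subseteq> I" "h = (\<Sum>i\<in>F. scaleC (c i) (b i))"
    using in_span_image_finite by blast
  show "\<exists>X. finite X \<and> X \<subseteq> I \<and> (\<forall>Y. finite Y \<and> X \<subseteq> Y \<and> Y \<subseteq> I \<longrightarrow>
      dist (\<Sum>i\<in>Y. scaleC (cinner f (b i)) (b i)) f < e)"
  proof (intro exI[of _ F] conjI allI impI F)
    fix Y assume Y: "finite Y \<and> F \<subseteq> Y \<and> Y \<subseteq> I"
    have "h = (\<Sum>i\<in>Y. scaleC (if i \<in> F then c i else 0) (b i))"
      unfolding F(3) using Y by (intro sum.mono_neutral_cong_left) auto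
    then have "norm (f - (\<Sum>i\<in>Y. scaleC (cinner f (b i)) (b i))) \<le> norm (f - h)"
      using best_approximation[OF assms(1), of Y f] Y by simp
    then show "dist (\<Sum>i\<in>Y. scaleC (cinner f (b i)) (b i)) f < e"
      using h(2) by (simp add: dist_norm norm_minus_commute)
  qed
qed

text \<open>By Pythagoras the squared norm of a block is the corresponding block of a convergent
  numerical sum, so the net of partial sums is Cauchy; completeness of \<open>L2\<close> supplies
  the limit.\<close>

lemma summable_on_orthonormal:
  assumes b: "orthonormal_fam J b"
    and c: "\<And>F. finite F \<Longrightarrow> F \<subseteq> J \<Longrightarrow> (\<Sum>i\<in>F. (cmod (c i))\<^sup>2) \<le> M"
  shows "(\<lambda>i. scaleC (c i) (b i)) summable_on J"
proof -
  have "(\<lambda>i. (cmod (c i))\<^sup>2) summable_on J"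
    using c by (intro nonneg_bdd_above_summable_on) (auto intro!: bdd_aboveI2[where M = M])
  then obtain s where s: "((\<lambda>i. (cmod (c i))\<^sup>2) has_sum s) J"
    by (auto simp: summable_on_def)
  let ?S = "\<lambda>F. \<Sum>i\<in>F. scaleC (c i) (b i)"
  have "cauchy_filter (filtermap ?S (finite_subsets_at_top J))"
    unfolding cauchy_filter_metric_filtermap
  proof safe
    fix e :: real assume e: "e > 0"
    \<comment> \<open>Two partial sums within \<open>(e/2)\<^sup>2 / 2\<close> of \<open>s\<close>
      differ by less than \<open>(e/2)\<^sup>2\<close>, so each vector sum is within
      \<open>e/2\<close> of the one over \<open>X\<close>, and any two are within
      \<open>e\<close>.\<close>
    then obtain X where X: "finite X" "X \<subseteq> J"
      "\<And>Y. finite Y \<Longrightarrow> X \<subseteq> Y \<Longrightarrow> Y \<subseteq> J \<Longrightarrow> dist (\<Sum>i\<in>Y. (cmod (c i))\<^sup>2) s < (e/2)\<^sup>2 / 2"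
      using s unfolding has_sum_metric_iff by (metis half_gt_zero zero_less_power)
    have *: "dist (?S Y) (?S X) < e / 2" if Y: "finite Y" "X \<subseteq> Y" "Y \<subseteq> J" for Y
    proof -
      have "?S Y - ?S X = ?S (Y - X)"
        using Y by (simp add: sum_diff)
      then have "(dist (?S Y) (?S X))\<^sup>2 = (\<Sum>i\<in>Y - X. (cmod (c i))\<^sup>2)"
        using norm_sum_orthonormal[OF b, of "Y - X" c] Y by (auto simp: dist_norm)
      also have "\<dots> = (\<Sum>i\<in>Y. (cmod (c i))\<^sup>2) - (\<Sum>i\<in>X. (cmod (c i))\<^sup>2)"
        using Y by (simp add: sum_diff)
      also have "\<dots> < (e/2)\<^sup>2"
        using X(3)[OF Y] X(3)[of X] X(1,2) unfolding dist_real_def abs_less_iff by auto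
      finally show ?thesis
        by (rule power2_less_imp_less) (use e in simp)
    qed
    show "\<exists>P. eventually P (finite_subsets_at_top J) \<and>
        (\<forall>x y. P x \<and> P y \<longrightarrow> dist (?S x) (?S y) < e)"
    proof (intro exI[of _ "\<lambda>Y. finite Y \<and> X \<subseteq> Y \<and> Y \<subseteq> J"] conjI allI impI)
      show "eventually (\<lambda>Y. finite Y \<and> X \<subseteq> Y \<and> Y \<subseteq> J) (finite_subsets_at_top J)"
        using X by (auto simp: eventually_finite_subsets_at_top)
      fix Y Z assume "(finite Y \<and> X \<subseteq> Y \<and> Y \<subseteq> J) \<and> (finite Z \<and> X \<subseteq> Z \<and> Z \<subseteq> J)"
      then show "dist (?S Y) (?S Z) < e"
        using *[of Y] *[of Z] dist_triangle_half_l[of "?S Y" "?S X" e "?S Z"]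
        by simp
    qed
  qed
  then have "convergent_filter (filtermap ?S (finite_subsets_at_top J))"
    using convergent_filter_iff_cauchy by blast
  then show ?thesis
    by (auto simp: convergent_filter.simps summable_on_def has_sum_def filterlim_def)
qed

text \<open>With \<open>p = id\<close> this is the orthogonal projection onto the closed span of \<open>b ` J\<close>.\<close>

definition transport :: "('i \<Rightarrow> L2) \<Rightarrow> 'i set \<Rightarrow> ('i \<Rightarrow> 'i) \<Rightarrow> L2 \<Rightarrow> L2" where
  "transport b J p f = (\<Sum>\<^sub>\<infinity>i\<in>J. scaleC (cinner f (b i)) (b (p i)))"

context
  fixes I :: "'i set" and b J p
  assumes b: "orthonormal_fam I b" and J: "J \<subseteq> I" "inj_on p J" "p ` J \<subseteq> I"
begin

lemma transport_has_sum:
  "((\<lambda>i. scaleC (cinner f (b i)) (b (p i))) has_sum transport b J p f) J"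
  unfolding transport_def
proof (rule has_sum_infsum, rule summable_on_orthonormal[where M = "(norm f)\<^sup>2"])
  show "orthonormal_fam J (\<lambda>i. b (p i))"
    by (rule orthonormal_fam_reindex[OF b J(2,3)])
qed (use bessel[OF b, of _ f] J in auto)

text \<open>Injectivity of \<open>p\<close> on \<open>J\<close> leaves a single nonzero
  term.\<close>

lemma cinner_transport:
  assumes "i \<in> J"
  shows "cinner (transport b J p f) (b (p i)) = cinner f (b i)"
proof -
  have "((\<lambda>l. cinner (scaleC (cinner f (b l)) (b (p l))) (b (p i))) has_sum
      cinner (transport b J p f) (b (p i))) J"
    by (rule has_sum_bounded_linear[OF bounded_linear_cinner_left transport_has_sum])
  moreover have "((\<lambda>l. cinner (scaleC (cinner f (b l)) (b (p l))) (b (p i))) has_sum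
      cinner f (b i)) J \<longleftrightarrow> ((\<lambda>l. if l = i then cinner f (b i) else 0) has_sum cinner f (b i)) J"
    using assms J by (intro has_sum_cong)
      (auto simp: cinner_scaleC_left orthonormal_famD[OF b] image_subset_iff inj_on_eq_iff)
  moreover have "((\<lambda>l. if l = i then cinner f (b i) else 0) has_sum cinner f (b i)) J"
    using assms by (intro has_sum_finite_neutralI[of "{i}"]) auto
  ultimately show ?thesis
    using has_sum_unique by blast
qed

lemma cinner_transport_other:
  assumes "l \<in> I" "l \<notin> p ` J"
  shows "cinner (transport b J p f) (b l) = 0"
proof -
  have "((\<lambda>i. cinner (scaleC (cinner f (b i)) (b (p i))) (b l)) has_sum
      cinner (transport b J p f) (b l)) J"
    by (rule has_sum_bounded_linear[OF bounded_linear_cinner_left transport_has_sum])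
  moreover have "((\<lambda>i. cinner (scaleC (cinner f (b i)) (b (p i))) (b l)) has_sum 0) J"
    using assms J by (intro has_sum_0)
      (auto simp: cinner_scaleC_left orthonormal_famD[OF b] image_subset_iff)
  ultimately show ?thesis
    using has_sum_unique by blast
qed

text \<open>Each finite partial sum obeys the bound by Bessel's inequality, and the bound survives
  the limit.\<close>

lemma norm_transport_le: "norm (transport b J p f) \<le> norm f"
proof -
  have "((\<lambda>F. norm (\<Sum>i\<in>F. scaleC (cinner f (b i)) (b (p i)))) \<longlongrightarrow> norm (transport b J p f))
      (finite_subsets_at_top J)"
    using transport_has_sum[of f] unfolding has_sum_def by (rule tendsto_norm)
  moreover have "eventually (\<lambda>F. norm (\<Sum>i\<in>F. scaleC (cinner f (b i)) (b (p i))) \<le> norm f)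
      (finite_subsets_at_top J)"
  proof (rule eventually_finite_subsets_at_top_weakI)
    fix F assume F: "finite F" "F \<subseteq> J"
    have "(norm (\<Sum>i\<in>F. scaleC (cinner f (b i)) (b (p i))))\<^sup>2 = (\<Sum>i\<in>F. (cmod (cinner f (b i)))\<^sup>2)"
      using F by (intro norm_sum_orthonormal[OF orthonormal_fam_reindex[OF b J(2,3)]])
    also have "\<dots> \<le> (norm f)\<^sup>2"
      using F J by (intro bessel[OF b]) auto
    finally show "norm (\<Sum>i\<in>F. scaleC (cinner f (b i)) (b (p i))) \<le> norm f"
      by (rule power2_le_imp_le) simp
  qed
  ultimately show ?thesis
    by (rule tendsto_upperbound) simp
qed

lemma transport_add: "transport b J p (f + g) = transport b J p f + transport b J p g"
proof -
  have "((\<lambda>i. scaleC (cinner (f + g) (b i)) (b (p i))) has_sum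
      transport b J p f + transport b J p g) J"
    unfolding cinner_add_left L2.scale_left_distrib by (intro has_sum_add transport_has_sum)
  then show ?thesis
    using has_sum_unique transport_has_sum by blast
qed

lemma transport_scaleC: "transport b J p (scaleC c f) = scaleC c (transport b J p f)"
proof -
  have "((\<lambda>i. scaleC (cinner (scaleC c f) (b i)) (b (p i))) has_sum
      scaleC c (transport b J p f)) J"
    unfolding cinner_scaleC_left L2.scale_scale[symmetric]
    by (intro has_sum_bounded_linear[OF bounded_linear_scaleC] transport_has_sum)
  then show ?thesis
    using has_sum_unique transport_has_sum by blast
qed

end

section \<open>Orthonormal bases: expansion, equality by coefficients, Parseval\<close>

definition orthonormal_basis :: "'i set \<Rightarrow> ('i \<Rightarrow> L2) \<Rightarrow> bool" where
  "orthonormal_basis I b \<longleftrightarrow> orthonormal_fam I b \<and> closure (L2.span (b ` I)) = UNIV"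

lemma orthonormal_basis_expansion:
  "orthonormal_basis I b \<Longrightarrow> ((\<lambda>i. scaleC (cinner f (b i)) (b i)) has_sum f) I"
  using has_sum_expansion[of I b f] by (simp add: orthonormal_basis_def)

lemma orthonormal_basis_eqI:
  assumes "orthonormal_basis I b" "\<And>i. i \<in> I \<Longrightarrow> cinner f (b i) = cinner g (b i)"
  shows "f = g"
proof -
  have "((\<lambda>i. scaleC (cinner f (b i)) (b i)) has_sum g) I
      \<longleftrightarrow> ((\<lambda>i. scaleC (cinner g (b i)) (b i)) has_sum g) I"
    by (intro has_sum_cong) (simp add: assms)
  then show ?thesis
    using orthonormal_basis_expansion[OF assms(1)] has_sum_unique by blast
qed

lemma parseval:
  assumes "orthonormal_basis I b"
  shows "((\<lambda>i. cinner f (b i) * cnj (cinner g (b i))) has_sum cinner f g) I"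
proof -
  have "((\<lambda>i. cinner (scaleC (cinner f (b i)) (b i)) g) has_sum cinner f g) I"
    by (intro has_sum_bounded_linear[OF bounded_linear_cinner_left]
        orthonormal_basis_expansion[OF assms])
  then show ?thesis
    by (simp add: cinner_scaleC_left cinner_commute[of g])
qed

section \<open>Density of trigonometric polynomials\<close>

abbreviation one_L2 :: L2 where "one_L2 \<equiv> L2_of (\<lambda>_. 1)"

lemma L2_of_cong:
  assumes "\<And>z. cmod z = 1 \<Longrightarrow> f z = g z"
  shows "L2_of f = L2_of g"
proof -
  have "f \<in> borel_measurable circle \<longleftrightarrow> g \<in> borel_measurable circle"
    using assms by (intro measurable_cong) simp
  moreover have "integrable circle (\<lambda>z. (cmod (f z))\<^sup>2) \<longleftrightarrow> integrable circle (\<lambda>z. (cmod (g z))\<^sup>2)"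
    using assms by (intro Bochner_Integration.integrable_cong) auto
  ultimately have iff: "f \<in> L2_fun \<longleftrightarrow> g \<in> L2_fun"
    by (simp add: L2_fun_def)
  show ?thesis
  proof (cases "f \<in> L2_fun")
    case True
    then show ?thesis
      using iff assms by (auto simp: L2_of_eq_iff intro!: AE_I2)
  next
    case False
    then show ?thesis
      using iff unfolding L2_of_def by simp
  qed
qed

lemma mult_op_one_L2: "p \<in> Linf_fun \<Longrightarrow> mult_op p one_L2 = L2_of p"
  by (simp add: L2_of_mult)

lemma L2_continuous: "continuous_on (sphere 0 1) p \<Longrightarrow> p \<in> L2_fun"
  by (intro Linf_imp_L2 Linf_continuous)

lemma mult_op_plus:
  assumes "p \<in> Linf_fun" "q \<in> Linf_fun" "(\<lambda>z. p z + q z) \<in> Linf_fun"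
  shows "mult_op (\<lambda>z. p z + q z) f = mult_op p f + mult_op q f"
  by (rule L2_cases[of f]) (simp add: assms L2_of_mult L2_of_add L2_fun_mult_Linf distrib_right)

lemma Linf_scale: "p \<in> Linf_fun \<Longrightarrow> (\<lambda>z. c * p z) \<in> Linf_fun"
  using Linf_mult[of "\<lambda>_. c" p] by (simp add: Linf_continuous)

lemma mult_op_times:
  assumes "p \<in> Linf_fun"
  shows "mult_op (\<lambda>z. c * p z) f = scaleC c (mult_op p f)"
  by (rule L2_cases[of f])
    (simp add: assms L2_of_mult L2_of_scale Linf_scale L2_fun_mult_Linf mult.assoc)

lemma indicator_L2_fun:
  assumes [measurable]: "A \<in> sets borel"
  shows "(\<lambda>z. complex_of_real (indicator A z)) \<in> L2_fun"
proof -
  have "(\<lambda>z. complex_of_real (indicator A z)) \<in> borel_measurable circle"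
    by (subst measurable_cong_sets[OF sets_circle refl], rule measurable_restrict_space1) measurable
  moreover have "AE z in circle. cmod (complex_of_real (indicator A z)) \<le> 1"
    by (intro AE_I2) (simp add: indicator_def)
  ultimately show ?thesis
    by (intro Linf_imp_L2) (auto simp: Linf_fun_def)
qed

section \<open>Closed subspaces containing 1 and invariant under \<open>z\<close> and
  \<open>cnj z\<close>\<close>

context
  fixes W
  assumes W: "L2.subspace W" "closed W" and one_W: "one_L2 \<in> W"
    and z_W: "\<And>f. f \<in> W \<Longrightarrow> mult_op (\<lambda>z. z) f \<in> W"
    and cnj_W: "\<And>f. f \<in> W \<Longrightarrow> mult_op cnj f \<in> W"
begin

text \<open>The real coordinates of \<open>z\<close> are combinations of \<open>z\<close> and
  \<open>cnj z\<close>, so invariance passes to all polynomials in them. Stating it for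
  multiplication on all of \<open>W\<close> lets the product case be a composition.\<close>

lemma invariant_real_polynomial:
  assumes "real_polynomial_function g"
  shows "continuous_on (sphere 0 1) g \<and> (\<forall>f\<in>W. mult_op (\<lambda>z. complex_of_real (g z)) f \<in> W)"
  using assms
proof (induction rule: real_polynomial_function.induct)
  case (linear g)
  \<comment> \<open>A real-linear functional on the plane is \<open>a * z + b * cnj z\<close>; its
    values at 1 and \<open>\<i>\<close> determine \<open>a\<close> and \<open>b\<close>.\<close>
  define a where "a = (g 1 - \<i> * g \<i>) / 2"
  define b where "b = (g 1 + \<i> * g \<i>) / 2"
  have eq: "complex_of_real (g z) = a * z + b * cnj z" for z
  proof -
    have "g z = g (Re z *\<^sub>R 1 + Im z *\<^sub>R \<i>)"
      by (rule arg_cong[where f = g]) (simp add: complex_eq_iff)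
    also have "\<dots> = Re z * g 1 + Im z * g \<i>"
      using linear by (simp add: linear_simps)
    finally show ?thesis
      by (simp add: a_def b_def complex_eq_iff field_simps)
  qed
  have c: "continuous_on (sphere 0 1) (\<lambda>z. a * z + b * cnj z)"
    "continuous_on (sphere 0 1) (\<lambda>z. a * z)" "continuous_on (sphere 0 1) (\<lambda>z. b * cnj z)"
    by (intro continuous_intros)+
  have "mult_op (\<lambda>z. a * z + b * cnj z) f \<in> W" if "f \<in> W" for f
  proof -
    have "mult_op (\<lambda>z. a * z + b * cnj z) f = scaleC a (mult_op (\<lambda>z. z) f) + scaleC b (mult_op cnj f)"
      using c by (subst mult_op_plus) (auto simp: mult_op_times Linf_continuous continuous_intros)
    then show ?thesis
      using that z_W cnj_W L2.subspace_add[OF W(1)] L2.subspace_scale[OF W(1)] by simp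
  qed
  then show ?case
    using linear by (simp add: eq linear_continuous_on)
next
  case (const c)
  have "mult_op (\<lambda>z. complex_of_real c) f = scaleC (complex_of_real c) f" for f
    using mult_op_times[of "\<lambda>_. 1" "complex_of_real c" f] by (simp add: Linf_continuous)
  then show ?case
    using L2.subspace_scale[OF W(1)] by simp
next
  case (add g h)
  then have "(\<lambda>z. complex_of_real (g z)) \<in> Linf_fun" "(\<lambda>z. complex_of_real (h z)) \<in> Linf_fun"
    "(\<lambda>z. complex_of_real (g z) + complex_of_real (h z)) \<in> Linf_fun"
    by (auto intro!: Linf_continuous continuous_intros)
  then show ?case
    using add.IH L2.subspace_add[OF W(1)] by (auto simp: mult_op_plus intro!: continuous_intros)
next
  case (mult g h)
  then have "(\<lambda>z. complex_of_real (g z)) \<in> Linf_fun" "(\<lambda>z. complex_of_real (h z)) \<in> Linf_fun"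
    by (auto intro!: Linf_continuous continuous_intros)
  then show ?case
    using mult.IH by (auto simp: mult_op_mult[symmetric] intro!: continuous_intros)
qed

text \<open>Stone-Weierstrass approximates \<open>g\<close> uniformly, and on a space of mass 1 the
  uniform distance dominates the L2 distance.\<close>

lemma invariant_continuous:
  fixes g :: "complex \<Rightarrow> real"
  assumes g: "continuous_on (sphere 0 1) g"
  shows "L2_of (\<lambda>z. complex_of_real (g z)) \<in> W"
proof -
  let ?c = "\<lambda>g z. complex_of_real (g z)"
  have "\<exists>y\<in>W. dist y (L2_of (?c g)) < e" if e: "e > 0" for e
  proof -
    obtain h where h: "real_polynomial_function h" "\<And>x. x \<in> sphere 0 1 \<Longrightarrow> \<bar>g x - h x\<bar> < e/2"
      using Stone_Weierstrass_real_polynomial_function[OF compact_sphere g, of "e/2"] e by auto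
    have hc: "continuous_on (sphere 0 1) h"
      and hW: "mult_op (?c h) one_L2 \<in> W"
      using invariant_real_polynomial[OF h(1)] one_W by auto
    have L: "?c h \<in> Linf_fun" "?c g \<in> Linf_fun" "(\<lambda>z. ?c h z - ?c g z) \<in> Linf_fun"
      by (auto intro!: Linf_continuous continuous_intros hc g)
    then have "mult_op (?c h) one_L2 - L2_of (?c g) = mult_op (\<lambda>z. ?c h z - ?c g z) one_L2"
      by (simp add: L2_of_diff Linf_imp_L2 L2_of_mult)
    moreover have "norm (mult_op (\<lambda>z. ?c h z - ?c g z) one_L2) \<le> (e/2) * norm one_L2"
    proof (rule norm_mult_op_le[OF L(3)])
      show "AE z in circle. cmod (?c h z - ?c g z) \<le> e / 2"
      proof (intro AE_I2)
        fix z assume "z \<in> space circle"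
        then have "\<bar>g z - h z\<bar> < e / 2"
          using h(2) by simp
        then show "cmod (?c h z - ?c g z) \<le> e / 2"
          by (simp add: norm_of_real abs_minus_commute flip: of_real_diff)
      qed
    qed (use e in simp)
    ultimately show ?thesis
      using hW e by (intro bexI[of _ "mult_op (?c h) one_L2"]) (auto simp: dist_norm norm_L2_of_one)
  qed
  then show ?thesis
    using closed_approachable[OF W(2)] by blast
qed

text \<open>The cut-off functions \<open>g m\<close>, built from the distance to \<open>A\<close>,
  are continuous and decrease to the indicator.\<close>

lemma invariant_closed_indicator:
  assumes "closed (A :: complex set)"
  shows "L2_of (\<lambda>z. complex_of_real (indicator A z)) \<in> W"
proof (cases "A = {}")
  \<comment> \<open>By convention \<open>infdist z {} = 0\<close>, so the cut-offs used below would
    be constantly 1 for the empty set.\<close>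
  case True
  then show ?thesis
    using L2.subspace_0[OF W(1)] by (simp add: L2_of_zero)
next
  case False
  define g where "g m z = max 0 (1 - real m * infdist z A)" for m z
  have gc: "continuous_on UNIV (g m)" for m
    unfolding g_def by (intro continuous_intros)
  have [measurable]: "A \<in> sets borel"
    using assms by simp
  have lim: "(\<lambda>m. L2_of (\<lambda>z. complex_of_real (g m z))) \<longlonglongrightarrow> L2_of (\<lambda>z. complex_of_real (indicator A z))"
  proof (rule L2_of_tendsto(2)[where w = "\<lambda>_. 1"])
    show "(\<lambda>z. complex_of_real (g m z)) \<in> borel_measurable circle" for m
      by (intro borel_measurable_circle_continuous continuous_on_of_real)
        (rule continuous_on_subset[OF gc], simp)
    show "(\<lambda>z. complex_of_real (indicator A z)) \<in> L2_fun"
      by (rule indicator_L2_fun) measurable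
    show "(\<lambda>m. complex_of_real (g m z)) \<longlonglongrightarrow> complex_of_real (indicator A z)" for z
    proof (cases "z \<in> A")
      case True
      then show ?thesis
        by (simp add: g_def)
    next
      case False
      then have "infdist z A > 0"
        using assms \<open>A \<noteq> {}\<close> by (metis in_closed_iff_infdist_zero infdist_nonneg less_eq_real_def)
      then obtain N :: nat where N: "1 < real N * infdist z A"
        using reals_Archimedean3 by blast
      have "eventually (\<lambda>m. complex_of_real (g m z) = complex_of_real (indicator A z)) sequentially"
        using eventually_ge_at_top[of N]
      proof eventually_elim
        case (elim m)
        then have "real N * infdist z A \<le> real m * infdist z A"
          by (intro mult_right_mono) (auto simp: infdist_nonneg)
        then show ?case
          using N False by (simp add: g_def)
      qed
      then show ?thesis
        by (rule tendsto_eventually)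
    qed
    show "cmod (complex_of_real (g m z)) \<le> cmod 1" for m z
      by (simp add: g_def infdist_nonneg)
  qed simp
  have mem: "L2_of (\<lambda>z. complex_of_real (g m z)) \<in> W" for m
    by (rule invariant_continuous) (rule continuous_on_subset[OF gc], simp)
  show ?thesis
    by (rule closed_sequentially[OF W(2) mem lim])
qed

text \<open>Dynkin's pi-lambda argument: closed sets are stable under intersection and generate the
  Borel sets, and membership in \<open>W\<close> passes to complements and disjoint countable
  unions.\<close>

lemma invariant_indicator:
  assumes "A \<in> sets borel"
  shows "L2_of (\<lambda>z. complex_of_real (indicator A z)) \<in> W"
proof -
  have borel: "sets (borel :: complex measure) = sigma_sets UNIV (Collect closed)"
    by (simp add: borel_eq_closed)
  have "Int_stable (Collect closed :: complex set set)"
    by (auto simp: Int_stable_def)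
  moreover have "Collect closed \<subseteq> Pow (UNIV :: complex set)"
    by simp
  moreover have "A \<in> sigma_sets UNIV (Collect closed)"
    using assms borel by simp
  ultimately show ?thesis
  proof (induction rule: sigma_sets_induct_disjoint[where \<Omega> = UNIV])
    case (basic A)
    then show ?case
      using invariant_closed_indicator by simp
  next
    case empty
    then show ?case
      using L2.subspace_0[OF W(1)] by (simp add: L2_of_zero)
  next
    case (compl A)
    have A: "A \<in> sets borel"
      using compl borel by simp
    have "L2_of (\<lambda>z. complex_of_real (indicator (UNIV - A) z))
        = one_L2 - L2_of (\<lambda>z. complex_of_real (indicator A z))"
      by (subst L2_of_diff) (auto simp: indicator_L2_fun[OF A] split: split_indicator intro!: L2_of_cong)
    then show ?case
      using compl one_W L2.subspace_diff[OF W(1)] by simp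
  next
    case (union A)
    have A: "A i \<in> sets borel" for i
      using union borel by auto
    have mem: "L2_of (\<lambda>z. complex_of_real (indicator (\<Union>i<m. A i) z)) \<in> W" for m
    proof (induction m)
      case 0
      show ?case
        using L2.subspace_0[OF W(1)] by (simp add: L2_of_zero)
    next
      case (Suc m)
      \<comment> \<open>Disjointness makes the indicator of a finite union the sum of the
        indicators.\<close>
      have "z \<notin> A i" if "z \<in> A m" "i < m" for z i
        using disjoint_family_onD[OF union(1), of m i] that by auto
      then have "indicator (\<Union>i<Suc m. A i) z = (indicator (\<Union>i<m. A i) z + indicator (A m) z :: real)" for z
        by (cases "z \<in> A m") (auto simp: indicator_def less_Suc_eq)
      moreover have "(\<Union>i<m. A i) \<in> sets borel"
        using A by auto
      ultimately have "L2_of (\<lambda>z. complex_of_real (indicator (\<Union>i<Suc m. A i) z))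
        = L2_of (\<lambda>z. complex_of_real (indicator (\<Union>i<m. A i) z)) + L2_of (\<lambda>z. complex_of_real (indicator (A m) z))"
        using A by (simp only: L2_of_add indicator_L2_fun of_real_add)
      then show ?case
        using Suc.IH union L2.subspace_add[OF W(1)] by simp
    qed
    have lim: "(\<lambda>m. L2_of (\<lambda>z. complex_of_real (indicator (\<Union>i<m. A i) z)))
        \<longlonglongrightarrow> L2_of (\<lambda>z. complex_of_real (indicator (\<Union>i. A i) z))"
    proof (rule L2_of_tendsto(2)[where w = "\<lambda>_. 1"])
      show "(\<lambda>z. complex_of_real (indicator (\<Union>i<m. A i) z)) \<in> borel_measurable circle" for m
        using A by (intro L2_fun_measurable indicator_L2_fun) auto
      show "(\<lambda>z. complex_of_real (indicator (\<Union>i. A i) z)) \<in> L2_fun"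
        using A by (intro indicator_L2_fun) auto
      show "(\<lambda>m. complex_of_real (indicator (\<Union>i<m. A i) z)) \<longlonglongrightarrow> complex_of_real (indicator (\<Union>i. A i) z)" for z
        by (intro tendsto_of_real LIMSEQ_indicator_UN)
    qed (auto simp: indicator_def)
    show ?case
      by (rule closed_sequentially[OF W(2) mem lim])
  qed
qed

lemma invariant_simple:
  assumes "finite Y" "\<And>y. y \<in> Y \<Longrightarrow> A y \<in> sets borel"
  shows "(\<lambda>z. \<Sum>y\<in>Y. y * complex_of_real (indicator (A y) z)) \<in> L2_fun \<and>
    L2_of (\<lambda>z. \<Sum>y\<in>Y. y * complex_of_real (indicator (A y) z)) \<in> W"
  using assms
proof (induction Y rule: finite_induct)
  case empty
  show ?case
    using L2.subspace_0[OF W(1)] by (simp add: L2_of_zero)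
next
  case (insert y Y)
  then have y: "(\<lambda>z. y * complex_of_real (indicator (A y) z)) \<in> L2_fun"
    "L2_of (\<lambda>z. y * complex_of_real (indicator (A y) z)) \<in> W"
    using invariant_indicator[of "A y"] L2.subspace_scale[OF W(1)]
    by (auto simp: L2_fun_scale indicator_L2_fun simp flip: L2_of_scale)
  moreover from insert have "(\<lambda>z. \<Sum>y\<in>Y. y * complex_of_real (indicator (A y) z)) \<in> L2_fun"
    "L2_of (\<lambda>z. \<Sum>y\<in>Y. y * complex_of_real (indicator (A y) z)) \<in> W"
    by auto
  ultimately show ?case
    using insert.hyps L2.subspace_add[OF W(1)] by (simp add: L2_fun_add flip: L2_of_add)
qed

text \<open>A square-integrable \<open>f\<close> is the pointwise limit of simple functions bounded
  by \<open>2 * cmod (f z)\<close>; dominated convergence puts it in the closed subspace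
  \<open>W\<close>.\<close>

lemma invariant_subspace_UNIV: "W = UNIV"
proof -
  have "L2_of f \<in> W" if f: "f \<in> L2_fun" for f
  proof -
    obtain s where s: "\<And>i. simple_function circle (s i)"
      "\<And>z. z \<in> space circle \<Longrightarrow> (\<lambda>i. s i z) \<longlonglongrightarrow> f z"
      "\<And>i z. z \<in> space circle \<Longrightarrow> dist (s i z) 0 \<le> 2 * dist (f z) 0"
      using borel_measurable_implies_sequence_metric[OF L2_fun_measurable[OF f], of 0] by metis
    have mem: "L2_of (s i) \<in> W" for i
    proof -
      let ?Y = "s i ` sphere 0 1"
      \<comment> \<open>Measurable sets of \<open>circle\<close> are traces on the sphere; Borel
        sets of the whole plane are chosen because the indicator lemmas are stated for
        those.\<close>
      have "\<exists>A'. A' \<in> sets borel \<and> s i -` {y} \<inter> sphere 0 1 = sphere 0 1 \<inter> A'" for y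
        using simple_functionD(2)[OF s(1)[of i], of "{y}"]
        by (auto simp: sets_circle sets_restrict_space)
      then obtain A where A: "\<And>y. A y \<in> sets borel" "\<And>y. s i -` {y} \<inter> sphere 0 1 = sphere 0 1 \<inter> A y"
        by metis
      have fin: "finite ?Y"
        using simple_functionD(1)[OF s(1)[of i]] by simp
      have "s i z = (\<Sum>y\<in>?Y. y * complex_of_real (indicator (A y) z))" if "cmod z = 1" for z
      proof -
        have "z \<in> s i -` {y} \<inter> sphere 0 1 \<longleftrightarrow> z \<in> sphere 0 1 \<inter> A y" for y
          by (simp only: A(2))
        then have "y * complex_of_real (indicator (A y) z) = (if y = s i z then y else 0)" for y
          using that by (simp add: indicator_def eq_commute[of y])
        then show ?thesis
          using fin that by (simp add: sum.delta)
      qed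
      then have "L2_of (s i) = L2_of (\<lambda>z. \<Sum>y\<in>?Y. y * complex_of_real (indicator (A y) z))"
        by (rule L2_of_cong)
      then show ?thesis
        using invariant_simple[OF fin, of A] A(1) by simp
    qed
    have lim: "(\<lambda>i. L2_of (s i)) \<longlonglongrightarrow> L2_of f"
    proof (rule L2_of_tendsto(2)[where w = "\<lambda>z. 2 * f z"])
      show "s i \<in> borel_measurable circle" for i
        using s(1) by (rule borel_measurable_simple_function)
    qed (use s f in \<open>auto simp: norm_mult L2_fun_scale\<close>)
    show ?thesis
      by (rule closed_sequentially[OF W(2) mem lim])
  qed
  then have "F \<in> W" for F
    by - (rule L2_cases[of F], simp)
  then show ?thesis
    by blast
qed

end

section \<open>Multipliers of the Hardy space\<close>

abbreviation szego :: "complex \<Rightarrow> complex \<Rightarrow> complex" where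
  "szego a \<equiv> (\<lambda>z. 1 / (1 - cnj a * z))"

lemma szego_denom_nonzero:
  assumes "cmod a < 1" "cmod z = 1"
  shows "1 - cnj a * z \<noteq> 0"
proof
  assume "1 - cnj a * z = 0"
  then have "cmod (cnj a * z) = cmod 1"
    by simp
  then show False
    using assms by (simp add: norm_mult)
qed

lemma continuous_szego: "cmod a < 1 \<Longrightarrow> continuous_on (sphere 0 1) (szego a)"
  using szego_denom_nonzero by (intro continuous_intros) auto

lemma continuous_powi_circle: "continuous_on (sphere 0 1) (\<lambda>z::complex. z powi k)"
  by (intro continuous_intros) auto

lemma norm_L2_of_unimodular:
  assumes "continuous_on (sphere 0 1) p" "\<And>z. cmod z = 1 \<Longrightarrow> cmod (p z) = 1"
  shows "norm (L2_of p) = 1"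
proof -
  have "norm (mult_op p one_L2) = norm one_L2"
    using assms by (intro norm_mult_op_unimodular Linf_continuous AE_I2) auto
  then show ?thesis
    using assms by (simp add: mult_op_one_L2 Linf_continuous norm_L2_of_one)
qed

lemma norm_fourier_coeff_le: "cmod (fourier_coeff f k) \<le> norm f"
proof -
  have "norm (L2_of (\<lambda>z. z powi k)) = 1"
    by (rule norm_L2_of_unimodular[OF continuous_powi_circle]) (simp add: norm_power_int)
  then show ?thesis
    using cinner_Cauchy_Schwarz[of f "L2_of (\<lambda>z. z powi k)"] by (simp add: fourier_coeff_def)
qed

lemma fourier_coeff_add: "fourier_coeff (f + g) k = fourier_coeff f k + fourier_coeff g k"
  by (simp add: fourier_coeff_def cinner_add_left)

lemma fourier_coeff_scaleC: "fourier_coeff (scaleC c f) k = c * fourier_coeff f k"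
  by (simp add: fourier_coeff_def cinner_scaleC_left)

lemma fourier_coeff_shift: "fourier_coeff (mult_op (\<lambda>z. z) f) k = fourier_coeff f (k - 1)"
proof -
  have "mult_op cnj (L2_of (\<lambda>z. z powi k)) = L2_of (\<lambda>z. cnj z * z powi k)"
    by (intro L2_of_mult Linf_continuous L2_continuous continuous_powi_circle continuous_intros)
  also have "\<dots> = L2_of (\<lambda>z. z powi (k - 1))"
  proof (rule L2_of_cong)
    fix z :: complex assume z: "cmod z = 1"
    then have "z \<noteq> 0" "cnj z * z = 1"
      by (auto simp: mult.commute[of "cnj z"] complex_norm_square[symmetric])
    then show "cnj z * z powi k = z powi (k - 1)"
      using power_int_add_1'[of z "k - 1"] by (simp add: mult.assoc[symmetric])
  qed
  finally show ?thesis
    by (simp add: fourier_coeff_def cinner_mult_op Linf_continuous)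
qed

lemma hardy_add: "f \<in> hardy \<Longrightarrow> g \<in> hardy \<Longrightarrow> f + g \<in> hardy"
  by (simp add: hardy_def fourier_coeff_add)

lemma hardy_scaleC: "f \<in> hardy \<Longrightarrow> scaleC c f \<in> hardy"
  by (simp add: hardy_def fourier_coeff_scaleC)

lemma fourier_coeff_powi: "fourier_coeff (L2_of (\<lambda>z. z powi l)) k = (if k = l then 1 else 0)"
proof -
  have "fourier_coeff (L2_of (\<lambda>z. z powi l)) k = (LINT z|circle. z powi l * cnj (z powi k))"
    unfolding fourier_coeff_def
    by (intro cinner_L2_of L2_continuous continuous_powi_circle)
  also have "\<dots> = (LINT z|circle. z powi (l - k))"
  proof (intro Bochner_Integration.integral_cong refl)
    fix z assume "z \<in> space circle"
    then have z: "z \<noteq> 0" "cmod z = 1"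
      by auto
    then have "cnj (z powi k) * z powi k = 1"
      by (simp add: mult.commute[of "cnj _"] complex_norm_square[symmetric] norm_power_int
        del: complex_cnj_power_int)
    then have "cnj (z powi k) = inverse (z powi k)"
      by (metis inverse_unique mult.commute)
    then show "z powi l * cnj (z powi k) = z powi (l - k)"
      using z by (simp add: power_int_diff divide_inverse)
  qed
  also have "\<dots> = (if k = l then 1 else 0)"
    by (simp add: integral_circle_powi)
  finally show ?thesis .
qed

lemma powi_hardy: "0 \<le> l \<Longrightarrow> L2_of (\<lambda>z. z powi l) \<in> hardy"
  by (auto simp: hardy_def fourier_coeff_powi)

lemma one_hardy: "one_L2 \<in> hardy"
  using powi_hardy[of 0] by simp

text \<open>Substitute for functions analytic on the disc and continuous up to the circle: the
  condition is stable under sums and products, and applied to the constant 1 it places the symbol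
  itself in the Hardy space.\<close>

definition hardy_mult :: "(complex \<Rightarrow> complex) \<Rightarrow> bool" where
  "hardy_mult p \<longleftrightarrow> continuous_on (sphere 0 1) p \<and> (\<forall>f\<in>hardy. mult_op p f \<in> hardy)"

lemma hardy_mult_Linf: "hardy_mult p \<Longrightarrow> p \<in> Linf_fun"
  by (simp add: hardy_mult_def Linf_continuous)

lemma hardy_mult_hardy: "hardy_mult p \<Longrightarrow> f \<in> hardy \<Longrightarrow> mult_op p f \<in> hardy"
  by (simp add: hardy_mult_def)

lemma hardy_mult_ident: "hardy_mult (\<lambda>z. z)"
  by (auto simp: hardy_mult_def hardy_def fourier_coeff_shift)

lemma hardy_mult_const: "hardy_mult (\<lambda>_. c)"
  using mult_op_times[of "\<lambda>_. 1" c] by (auto simp: hardy_mult_def Linf_continuous hardy_scaleC)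

lemma hardy_mult_mult: "hardy_mult p \<Longrightarrow> hardy_mult q \<Longrightarrow> hardy_mult (\<lambda>z. p z * q z)"
  unfolding hardy_mult_def by (auto simp: mult_op_mult[symmetric] Linf_continuous intro: continuous_intros)

lemma hardy_mult_add: "hardy_mult p \<Longrightarrow> hardy_mult q \<Longrightarrow> hardy_mult (\<lambda>z. p z + q z)"
  unfolding hardy_mult_def
  by (auto simp: mult_op_plus[OF Linf_continuous Linf_continuous Linf_continuous] hardy_add
      continuous_on_add)

lemma hardy_mult_prod: "(\<And>i. i \<in> A \<Longrightarrow> hardy_mult (p i)) \<Longrightarrow> hardy_mult (\<lambda>z. \<Prod>i\<in>A. p i z)"
  by (induction A rule: infinite_finite_induct) (auto intro: hardy_mult_const hardy_mult_mult)

lemma hardy_mult_power: "hardy_mult p \<Longrightarrow> hardy_mult (\<lambda>z. p z ^ k)"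
  by (induction k) (auto intro: hardy_mult_const hardy_mult_mult)

text \<open>With \<open>g = szego a \<cdot> f\<close> we have \<open>g = f + cnj a \<cdot> z g\<close>, so at negative indices the Fourier
  coefficients of \<open>g\<close> satisfy \<open>g(k) = (cnj a) ^ m * g(k - m)\<close> for all \<open>m\<close>; they are bounded,
  hence vanish.\<close>

lemma hardy_mult_szego:
  assumes a: "cmod a < 1"
  shows "hardy_mult (szego a)"
  unfolding hardy_mult_def
proof (intro conjI ballI continuous_szego a)
  fix f assume f: "f \<in> hardy"
  define g where "g = mult_op (szego a) f"
  have s: "szego a \<in> Linf_fun"
    by (intro Linf_continuous continuous_szego a)
  have q: "(\<lambda>z. z * szego a z) \<in> Linf_fun"
    by (intro Linf_mult s) (simp add: Linf_continuous)
  have "f + scaleC (cnj a) (mult_op (\<lambda>z. z) g)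
      = mult_op (\<lambda>_. 1) f + mult_op (\<lambda>z. cnj a * (z * szego a z)) f"
    unfolding g_def mult_op_times[OF q] by (subst mult_op_mult) (auto simp: s Linf_continuous)
  also have "\<dots> = mult_op (\<lambda>z. 1 + cnj a * (z * szego a z)) f"
  proof (rule mult_op_plus[symmetric])
    show "(\<lambda>z. 1 + cnj a * (z * szego a z)) \<in> Linf_fun"
      by (intro Linf_continuous continuous_intros) (use szego_denom_nonzero[OF a] in auto)
  qed (simp_all only: Linf_scale[OF q] Linf_continuous continuous_on_const)
  also have "mult_op (\<lambda>z. 1 + cnj a * (z * szego a z)) = mult_op (szego a)"
    using szego_denom_nonzero[OF a] by (intro mult_op_cong[OF s]) (simp add: field_simps)
  finally have eq: "g = f + scaleC (cnj a) (mult_op (\<lambda>z. z) g)"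
    by (simp add: g_def)
  have rec: "fourier_coeff g k = cnj a * fourier_coeff g (k - 1)" if "k < 0" for k
  proof -
    have "fourier_coeff g k = fourier_coeff (f + scaleC (cnj a) (mult_op (\<lambda>z. z) g)) k"
      by (rule arg_cong[OF eq])
    also have "\<dots> = cnj a * fourier_coeff g (k - 1)"
      using f that by (simp add: fourier_coeff_add fourier_coeff_scaleC fourier_coeff_shift hardy_def)
    finally show ?thesis .
  qed
  show "mult_op (szego a) f \<in> hardy"
    unfolding g_def[symmetric] hardy_def mem_Collect_eq
  proof (intro allI impI)
    fix k :: int assume k: "k < 0"
    have it: "fourier_coeff g k = cnj a ^ m * fourier_coeff g (k - int m)" for m
    proof (induction m)
      case (Suc m)
      then show ?case
        using rec[of "k - int m"] k by (simp add: algebra_simps)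
    qed simp
    have "cmod (fourier_coeff g k) \<le> cmod a ^ m * norm g" for m
    proof -
      have "cmod (fourier_coeff g k) = cmod a ^ m * cmod (fourier_coeff g (k - int m))"
        by (subst it[of m]) (simp add: norm_mult norm_power)
      also have "\<dots> \<le> cmod a ^ m * norm g"
        by (intro mult_left_mono norm_fourier_coeff_le) simp
      finally show ?thesis .
    qed
    moreover have "(\<lambda>m. cmod a ^ m * norm g) \<longlonglongrightarrow> 0 * norm g"
      by (intro tendsto_intros LIMSEQ_realpow_zero a) simp
    ultimately have "cmod (fourier_coeff g k) \<le> 0 * norm g"
      by (intro LIMSEQ_le_const) auto
    then show "fourier_coeff g k = 0"
      by simp
  qed
qed

text \<open>Multiplication by \<open>z\<close> shifts Fourier coefficients, so the mean of
  \<open>z * p z\<close> is the coefficient of \<open>p\<close> at -1.\<close>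

lemma cinner_z_hardy_mult:
  assumes "hardy_mult p"
  shows "cinner (L2_of (\<lambda>z. z * p z)) one_L2 = 0"
proof -
  have "L2_of (\<lambda>z. z * p z) = mult_op (\<lambda>z. z) (mult_op p one_L2)"
    using hardy_mult_Linf[OF assms] hardy_mult_Linf[OF hardy_mult_ident]
    by (simp add: mult_op_one_L2 L2_of_mult Linf_imp_L2)
  then have "cinner (L2_of (\<lambda>z. z * p z)) one_L2 = fourier_coeff (mult_op (\<lambda>z. z) (mult_op p one_L2)) 0"
    by (simp add: fourier_coeff_def)
  also have "\<dots> = fourier_coeff (mult_op p one_L2) (- 1)"
    by (simp add: fourier_coeff_shift)
  also have "\<dots> = 0"
    using hardy_mult_hardy[OF assms one_hardy] by (simp add: hardy_def)
  finally show ?thesis .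
qed

section \<open>The orthonormal basis attached to a finite Blaschke product\<close>

text \<open>On the circle the denominator is \<open>- z\<close> times the conjugate of the
  numerator.\<close>

lemma norm_blaschke_factor:
  assumes "cmod a < 1" "cmod z = 1"
  shows "cmod (blaschke_factor a z) = 1"
proof -
  have z: "cnj z * z = 1" "z \<noteq> 0"
    using assms by (auto simp: mult.commute[of "cnj z"] complex_norm_square[symmetric])
  have "1 - cnj a * z = - (z * cnj (a - z))"
    using z by (simp add: algebra_simps)
  then have "cmod (1 - cnj a * z) = cmod (a - z)"
    using assms by (simp add: norm_mult del: complex_cnj_diff)
  then show ?thesis
    using szego_denom_nonzero[OF assms] assms by (auto simp: blaschke_factor_def norm_divide)
qed

lemma continuous_blaschke_factor:
  "cmod a < 1 \<Longrightarrow> continuous_on (sphere 0 1) (blaschke_factor a)"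
  unfolding blaschke_factor_def using szego_denom_nonzero by (intro continuous_intros) auto

lemma hardy_mult_blaschke_factor:
  assumes "cmod a < 1"
  shows "hardy_mult (blaschke_factor a)"
proof -
  have "blaschke_factor a = (\<lambda>z. (a + (-1) * z) * szego a z)"
    by (auto simp: blaschke_factor_def)
  then show ?thesis
    using hardy_mult_mult[OF hardy_mult_add[OF hardy_mult_const[of a]
        hardy_mult_mult[OF hardy_mult_const[of "-1"] hardy_mult_ident]] hardy_mult_szego[OF assms]]
    by simp
qed

text \<open>Cancels the conjugate kernel against a Blaschke factor with the same zero; the factor
  \<open>z\<close> left over is what later forces means to vanish.\<close>

lemma cnj_szego_times_blaschke_factor:
  assumes "cmod a < 1" "cmod z = 1"
  shows "cnj (szego a z) * blaschke_factor a z = - (z * szego a z)"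
proof -
  have z: "cnj z * z = 1"
    using assms by (simp add: mult.commute[of "cnj z"] complex_norm_square[symmetric])
  have "z * cnj (1 - cnj a * z) = z - a * (cnj z * z)"
    by (simp add: algebra_simps)
  then have "z * cnj (1 - cnj a * z) = - (a - z)"
    using z by simp
  moreover have "1 - cnj a * z \<noteq> 0" "cnj (1 - cnj a * z) \<noteq> 0"
    using szego_denom_nonzero[OF assms] by (auto simp del: complex_cnj_diff)
  ultimately show ?thesis
    unfolding blaschke_factor_def complex_cnj_divide complex_cnj_one
    by (simp add: divide_simps del: complex_cnj_diff)
qed

text \<open>If \<open>x - P \<cdot> V x\<close> lies in a closed subspace invariant under the isometry \<open>V\<close>, then so does
  \<open>x - P ^ m \<cdot> V ^ m x\<close>, which tends to \<open>x\<close> when \<open>P\<close> is a strict contraction.\<close>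

lemma closed_subspace_contraction:
  assumes W: "L2.subspace W" "closed W"
    and V: "\<And>f. f \<in> W \<Longrightarrow> V f \<in> W" "\<And>f g. V (f - g) = V f - V g" "\<And>c f. V (scaleC c f) = scaleC c (V f)"
      "\<And>f. norm (V f) = norm f"
    and P: "cmod P < 1" "x - scaleC P (V x) \<in> W"
  shows "x \<in> W"
proof -
  have mem: "x - scaleC (P ^ m) ((V ^^ m) x) \<in> W" for m
  proof (induction m)
    case 0
    show ?case
      using L2.subspace_0[OF W(1)] by simp
  next
    case (Suc m)
    have *: "(V ^^ m) (x - scaleC P (V x)) = (V ^^ m) x - scaleC P ((V ^^ Suc m) x)"
      by (induction m) (simp_all add: V)
    have "(V ^^ m) (x - scaleC P (V x)) \<in> W"
      by (induction m) (simp_all add: V P)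
    then have "scaleC (P ^ m) ((V ^^ m) x - scaleC P ((V ^^ Suc m) x)) \<in> W"
      unfolding * by (rule L2.subspace_scale[OF W(1)])
    from L2.subspace_add[OF W(1) Suc this] show ?case
      by (simp add: L2.scale_right_diff_distrib mult.commute)
  qed
  have n: "norm ((V ^^ m) x) = norm x" for m
    by (induction m) (simp_all add: V)
  have "(\<lambda>m. cmod P ^ m * norm x) \<longlonglongrightarrow> 0 * norm x"
    by (intro tendsto_intros LIMSEQ_realpow_zero P) simp
  then have "(\<lambda>m. norm (scaleC (P ^ m) ((V ^^ m) x))) \<longlonglongrightarrow> 0"
    by (simp add: norm_scaleC norm_power n)
  then have "(\<lambda>m. scaleC (P ^ m) ((V ^^ m) x)) \<longlonglongrightarrow> 0"
    by (rule tendsto_norm_zero_cancel)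
  then have lim: "(\<lambda>m. x - scaleC (P ^ m) ((V ^^ m) x)) \<longlonglongrightarrow> x - 0"
    by (intro tendsto_intros)
  show ?thesis
    using closed_sequentially[OF W(2) mem lim] by simp
qed

section \<open>The functions \<open>e\<^sub>j B\<^sup>k\<close>: pointwise identities and
  orthonormality\<close>

locale blaschke_product =
  fixes lam :: "nat \<Rightarrow> complex" and n :: nat
  assumes n_pos: "n \<ge> 1" and lam: "\<And>k. k \<in> {1..n} \<Longrightarrow> cmod (lam k) < 1"
begin

abbreviation B :: "complex \<Rightarrow> complex" where "B \<equiv> blaschke lam n"

definition weight :: "nat \<Rightarrow> complex" where
  "weight j = complex_of_real (sqrt (1 - (cmod (lam j))\<^sup>2))"

definition basis :: "nat \<times> int \<Rightarrow> L2" where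
  "basis = (\<lambda>(j, k). L2_of (\<lambda>z. blaschke_basis lam j z * B z powi k))"

abbreviation indices :: "(nat \<times> int) set" where "indices \<equiv> {1..n} \<times> UNIV"

text \<open>On the circle \<open>cnj (e\<^sub>i) \<cdot> b\<^sub>1 \<cdots> b\<^sub>m = z \<cdot> dual i m\<close>.\<close>

definition dual :: "nat \<Rightarrow> nat \<Rightarrow> complex \<Rightarrow> complex" where
  "dual i m z = - weight i * szego (lam i) z * (\<Prod>k=Suc i..m. blaschke_factor (lam k) z)"

lemma weight_square: "j \<in> {1..n} \<Longrightarrow> weight j * weight j = 1 - lam j * cnj (lam j)"
proof -
  assume "j \<in> {1..n}"
  then have "(cmod (lam j))\<^sup>2 \<le> 1"
    using lam[of j] by (simp add: power_le_one)
  then have "weight j * weight j = complex_of_real (1 - (cmod (lam j))\<^sup>2)"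
    unfolding weight_def by (simp flip: of_real_mult)
  then show ?thesis
    unfolding of_real_diff complex_norm_square by simp
qed

lemma weight_nonzero: "j \<in> {1..n} \<Longrightarrow> weight j \<noteq> 0"
proof -
  assume "j \<in> {1..n}"
  then have "(cmod (lam j))\<^sup>2 < 1"
    using lam[of j] by (simp add: power_less_one_iff)
  then show ?thesis
    by (simp add: weight_def)
qed

lemma cnj_weight [simp]: "cnj (weight j) = weight j"
  by (simp add: weight_def)

lemma norm_blaschke: "j \<le> n \<Longrightarrow> cmod z = 1 \<Longrightarrow> cmod (blaschke lam j z) = 1"
  unfolding blaschke_def prod_norm[symmetric]
  by (intro prod.neutral ballI norm_blaschke_factor lam) auto

lemma blaschke_nonzero: "j \<le> n \<Longrightarrow> cmod z = 1 \<Longrightarrow> blaschke lam j z \<noteq> 0"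
  using norm_blaschke[of j z] by auto

lemma cnj_blaschke: "j \<le> n \<Longrightarrow> cmod z = 1 \<Longrightarrow> cnj (blaschke lam j z) * blaschke lam j z = 1"
  using norm_blaschke[of j z] by (simp add: mult.commute[of "cnj _"] complex_norm_square[symmetric])

lemma continuous_blaschke: "j \<le> n \<Longrightarrow> continuous_on (sphere 0 1) (blaschke lam j)"
  unfolding blaschke_def
  by (intro continuous_intros continuous_blaschke_factor lam) auto

lemma continuous_B_powi: "continuous_on (sphere 0 1) (\<lambda>z. B z powi k)"
  by (intro continuous_intros continuous_blaschke) (auto simp: blaschke_nonzero)

lemma blaschke_0 [simp]: "blaschke lam 0 = (\<lambda>_. 1)"
  by (auto simp: blaschke_def)

lemma blaschke_step: "blaschke lam (Suc j) z = blaschke lam j z * blaschke_factor (lam (Suc j)) z"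
  by (simp add: blaschke_def)

lemma blaschke_basis_Suc:
  "blaschke_basis lam (Suc j) z = blaschke lam j z * (weight (Suc j) * szego (lam (Suc j)) z)"
proof -
  have "{1..<Suc j} = {1..j}"
    by auto
  then show ?thesis
    by (simp add: blaschke_basis_def blaschke_def weight_def)
qed

lemma continuous_blaschke_basis:
  assumes "j \<in> {1..n}"
  shows "continuous_on (sphere 0 1) (blaschke_basis lam j)"
proof -
  obtain i where i: "j = Suc i"
    using assms by (cases j) auto
  have "continuous_on (sphere 0 1) (\<lambda>z. blaschke lam i z * (weight (Suc i) * szego (lam (Suc i)) z))"
    using assms i lam[of j] by (intro continuous_on_mult continuous_blaschke continuous_szego
        continuous_on_const) auto
  then show ?thesis
    by (simp add: i blaschke_basis_Suc[abs_def])
qed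

lemma hardy_mult_blaschke: "j \<le> n \<Longrightarrow> hardy_mult (blaschke lam j)"
  unfolding blaschke_def
  by (intro hardy_mult_prod hardy_mult_blaschke_factor lam) auto

lemma hardy_mult_blaschke_basis:
  assumes "j \<in> {1..n}"
  shows "hardy_mult (blaschke_basis lam j)"
proof -
  obtain i where i: "j = Suc i"
    using assms by (cases j) auto
  have "hardy_mult (\<lambda>z. blaschke lam i z * (weight (Suc i) * szego (lam (Suc i)) z))"
    using assms i lam[of j] by (intro hardy_mult_mult hardy_mult_blaschke hardy_mult_szego
        hardy_mult_const) auto
  then show ?thesis
    by (simp add: i blaschke_basis_Suc[abs_def])
qed

lemma hardy_mult_dual:
  assumes "i \<in> {1..n}" "m \<le> n"
  shows "hardy_mult (dual i m)"
  unfolding dual_def using assms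
  by (intro hardy_mult_mult hardy_mult_const hardy_mult_szego hardy_mult_prod
      hardy_mult_blaschke_factor lam) auto

text \<open>The factors before \<open>i\<close> cancel because they are unimodular, the
  \<open>i\<close>-th combines with the conjugate kernel, and the factors from \<open>Suc i\<close>
  to \<open>m\<close> survive in \<open>dual i m\<close>.\<close>

lemma cnj_blaschke_basis:
  assumes "i \<in> {1..n}" "i \<le> m" "m \<le> n" "cmod z = 1"
  shows "cnj (blaschke_basis lam i z) * blaschke lam m z = z * dual i m z"
proof -
  obtain j where j: "i = Suc j"
    using assms by (cases i) auto
  have "{1..m} = {1..i} \<union> {Suc i..m}"
    using assms by auto
  then have prod: "blaschke lam m z = blaschke lam i z * (\<Prod>k=Suc i..m. blaschke_factor (lam k) z)"
    unfolding blaschke_def by (simp only:) (rule prod.union_disjoint, auto)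
  have "cnj (blaschke_basis lam i z) * blaschke lam m z
      = (cnj (blaschke lam j z) * blaschke lam j z) * weight i
        * (cnj (szego (lam i) z) * blaschke_factor (lam i) z)
        * (\<Prod>k=Suc i..m. blaschke_factor (lam k) z)"
    unfolding prod unfolding j blaschke_basis_Suc blaschke_step complex_cnj_mult cnj_weight
    by (simp only: mult_ac)
  also have "\<dots> = 1 * weight i * - (z * szego (lam i) z) * (\<Prod>k=Suc i..m. blaschke_factor (lam k) z)"
    using assms j
    by (subst cnj_blaschke, simp, simp, subst cnj_szego_times_blaschke_factor)
      (auto intro: lam simp del: complex_cnj_divide)
  also have "\<dots> = z * dual i m z"
    unfolding dual_def by simp
  finally show ?thesis .
qed

text \<open>With \<open>a = lam (Suc j)\<close> this is \<open>(1 - a * cnj a) * szego a z = 1 - cnj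
  a * blaschke_factor a z\<close>, multiplied by the preceding partial product.\<close>

lemma blaschke_basis_identity:
  assumes "Suc j \<le> n" "cmod z = 1"
  shows "weight (Suc j) * blaschke_basis lam (Suc j) z
    = blaschke lam j z - cnj (lam (Suc j)) * blaschke lam (Suc j) z"
proof -
  let ?a = "lam (Suc j)"
  have "(1 - ?a * cnj ?a) * szego ?a z = 1 - cnj ?a * blaschke_factor ?a z"
    using szego_denom_nonzero[OF lam[of "Suc j"] assms(2)] assms(1)
    by (simp add: blaschke_factor_def field_simps)
  then have "weight (Suc j) * (weight (Suc j) * szego ?a z) = 1 - cnj ?a * blaschke_factor ?a z"
    using weight_square[of "Suc j"] assms(1) by (simp only: mult.assoc[symmetric]) simp
  then have "blaschke lam j z * (weight (Suc j) * (weight (Suc j) * szego ?a z))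
      = blaschke lam j z * (1 - cnj ?a * blaschke_factor ?a z)"
    by simp
  then show ?thesis
    by (simp add: blaschke_basis_Suc blaschke_step algebra_simps)
qed

lemma z_blaschke_basis_identity:
  assumes "Suc j \<le> n" "cmod z = 1"
  shows "z * (weight (Suc j) * blaschke_basis lam (Suc j) z)
    = lam (Suc j) * blaschke lam j z - blaschke lam (Suc j) z"
proof -
  let ?a = "lam (Suc j)"
  have "(1 - ?a * cnj ?a) * (z * szego ?a z) = ?a - blaschke_factor ?a z"
    using szego_denom_nonzero[OF lam[of "Suc j"] assms(2)] assms(1)
    by (simp add: blaschke_factor_def field_simps)
  then have "weight (Suc j) * (weight (Suc j) * (z * szego ?a z)) = ?a - blaschke_factor ?a z"
    using weight_square[of "Suc j"] assms(1) by (simp only: mult.assoc[symmetric]) simp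
  then have "blaschke lam j z * (weight (Suc j) * (weight (Suc j) * (z * szego ?a z)))
      = blaschke lam j z * (?a - blaschke_factor ?a z)"
    by simp
  then show ?thesis
    by (simp add: blaschke_basis_Suc blaschke_step algebra_simps)
qed

lemma continuous_basis:
  "j \<in> {1..n} \<Longrightarrow> continuous_on (sphere 0 1) (\<lambda>z. blaschke_basis lam j z * B z powi k)"
  by (intro continuous_on_mult continuous_blaschke_basis continuous_B_powi)

text \<open>Writes an inner product as the mean of one function, the form to which
  \<open>cinner_z_hardy_mult\<close> applies.\<close>

lemma cinner_L2_of_eq_mean:
  assumes "continuous_on (sphere 0 1) f" "continuous_on (sphere 0 1) g"
    "\<And>z. cmod z = 1 \<Longrightarrow> f z * cnj (g z) = h z"
  shows "cinner (L2_of f) (L2_of g) = cinner (L2_of h) one_L2"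
proof -
  have c: "continuous_on (sphere 0 1) (\<lambda>z. f z * cnj (g z))"
    using assms by (intro continuous_intros)
  have "cinner (L2_of (\<lambda>z. f z * cnj (g z))) one_L2 = (LINT z|circle. f z * cnj (g z))"
    using c by (subst cinner_L2_of) (auto simp: L2_continuous)
  also have "\<dots> = cinner (L2_of f) (L2_of g)"
    using assms(1,2) by (simp add: cinner_L2_of L2_continuous)
  finally show ?thesis
    using L2_of_cong[of "\<lambda>z. f z * cnj (g z)" h] assms(3) by simp
qed

text \<open>Pairs are compared by the power of \<open>B\<close> first. With the larger pair on the
  left, the integrand is \<open>z\<close> times a Hardy multiplier and has mean zero; the opposite
  order follows by conjugation.\<close>

lemma cinner_basis_zero:
  assumes "i \<in> {1..n}" "j \<in> {1..n}" "l < k \<or> (l = k \<and> j < i)"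
  shows "cinner (basis (i, k)) (basis (j, l)) = 0"
proof -
  \<comment> \<open>If \<open>l < k\<close>, one factor \<open>B\<close> absorbs the conjugate of
    \<open>e\<^sub>j\<close> and \<open>k - l - 1\<close> factors remain. If \<open>l = k\<close>,
    the partial product contained in \<open>e\<^sub>i\<close> absorbs it, since
    \<open>j < i\<close>.\<close>
  define p where "p = (if l < k then (\<lambda>z. dual j n z * (blaschke_basis lam i z * B z ^ nat (k - l - 1)))
    else (\<lambda>z. dual j (i - 1) z * (weight i * szego (lam i) z)))"
  have p: "hardy_mult p"
  proof (cases "l < k")
    case True
    then show ?thesis
      unfolding p_def if_P[OF True] using assms
      by (intro hardy_mult_mult hardy_mult_dual hardy_mult_blaschke_basis hardy_mult_power
          hardy_mult_blaschke) auto
  next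
    case False
    then show ?thesis
      unfolding p_def if_not_P[OF False] using assms
      by (intro hardy_mult_mult hardy_mult_dual hardy_mult_const hardy_mult_szego lam) auto
  qed
  have "cinner (basis (i, k)) (basis (j, l)) = cinner (L2_of (\<lambda>z. z * p z)) one_L2"
    unfolding basis_def case_prod_conv
  proof (rule cinner_L2_of_eq_mean)
    fix z :: complex assume z: "cmod z = 1"
    have B: "B z \<noteq> 0" "cnj (B z) = inverse (B z)"
      using z blaschke_nonzero[of n z] cnj_blaschke[of n z] by (auto simp: field_simps)
    show "blaschke_basis lam i z * B z powi k * cnj (blaschke_basis lam j z * B z powi l) = z * p z"
    proof (cases "l < k")
      case True
      have "B z powi k * inverse (B z) powi l = B z powi (k - l)"
        using B by (simp add: power_int_diff power_int_inverse divide_inverse)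
      also have "\<dots> = B z * B z ^ nat (k - l - 1)"
        using True B power_int_add_1'[of "B z" "k - l - 1"] by (simp add: power_int_def)
      finally have pow: "B z powi k * cnj (B z powi l) = B z * B z ^ nat (k - l - 1)"
        using B by simp
      have "blaschke_basis lam i z * B z powi k * cnj (blaschke_basis lam j z * B z powi l)
        = blaschke_basis lam i z * (B z powi k * cnj (B z powi l)) * cnj (blaschke_basis lam j z)"
        by (simp add: mult_ac)
      also have "\<dots> = (cnj (blaschke_basis lam j z) * B z) * (blaschke_basis lam i z * B z ^ nat (k - l - 1))"
        unfolding pow by (simp add: mult_ac)
      also have "\<dots> = z * p z"
        using True assms z by (simp add: cnj_blaschke_basis p_def)
      finally show ?thesis .
    next
      case False
      then have lk: "l = k" "j < i"
        using assms by auto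
      then obtain i' where i': "i = Suc i'"
        by (cases i) auto
      have "B z powi k * cnj (B z powi l) = 1"
        using B lk by (simp add: power_int_inverse)
      then have "blaschke_basis lam i z * B z powi k * cnj (blaschke_basis lam j z * B z powi l)
        = blaschke_basis lam i z * cnj (blaschke_basis lam j z)"
        by (simp add: mult_ac del: complex_cnj_power_int)
      also have "\<dots> = (cnj (blaschke_basis lam j z) * blaschke lam i' z) * (weight i * szego (lam i) z)"
        by (simp add: i' blaschke_basis_Suc)
      also have "\<dots> = z * p z"
        using lk i' assms z False cnj_blaschke_basis[of j i' z] by (simp add: p_def)
      finally show ?thesis .
    qed
  qed (use assms in \<open>auto intro: continuous_basis\<close>)
  then show ?thesis
    using cinner_z_hardy_mult[OF p] by simp
qed

text \<open>The kernel is 1 plus \<open>z\<close> times a Hardy multiplier.\<close>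

lemma mean_szego:
  assumes "cmod a < 1"
  shows "cinner (L2_of (szego a)) one_L2 = 1"
proof -
  have "hardy_mult (\<lambda>z. cnj a * szego a z)"
    by (intro hardy_mult_mult hardy_mult_const hardy_mult_szego assms)
  then have "cinner (L2_of (\<lambda>z. z * (cnj a * szego a z))) one_L2 = 0"
    by (rule cinner_z_hardy_mult)
  moreover have "L2_of (szego a) = one_L2 + L2_of (\<lambda>z. z * (cnj a * szego a z))"
  proof (subst L2_of_add)
    show "(\<lambda>z. z * (cnj a * szego a z)) \<in> L2_fun"
      by (intro L2_continuous continuous_on_mult continuous_szego continuous_on_const continuous_on_id assms)
    show "L2_of (szego a) = L2_of (\<lambda>z. 1 + z * (cnj a * szego a z))"
      using szego_denom_nonzero[OF assms] by (intro L2_of_cong) (simp add: field_simps)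
  qed simp
  moreover have "cinner one_L2 one_L2 = 1"
    by (simp add: cinner_self_norm norm_L2_of_one)
  ultimately show ?thesis
    by (simp add: cinner_add_left)
qed

text \<open>The squared modulus of the basis function is the Poisson kernel, which equals the Szego
  kernel plus its conjugate minus 1 and so has mean \<open>1 + 1 - 1\<close>.\<close>

lemma cinner_basis_self:
  assumes "j \<in> {1..n}"
  shows "cinner (basis (j, k)) (basis (j, k)) = 1"
proof -
  let ?a = "lam j"
  obtain i where i: "j = Suc i"
    using assms by (cases j) auto
  have a: "cmod ?a < 1"
    using lam assms by simp
  have cz: "continuous_on (sphere 0 1) (szego ?a)" "continuous_on (sphere 0 1) (\<lambda>z. cnj (szego ?a z))"
    by (intro continuous_on_cnj continuous_szego a)+
  have "cinner (basis (j, k)) (basis (j, k)) = cinner (L2_of (\<lambda>z. (szego ?a z + cnj (szego ?a z)) - 1)) one_L2"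
    unfolding basis_def case_prod_conv
  proof (rule cinner_L2_of_eq_mean)
    fix z :: complex assume z: "cmod z = 1"
    let ?s = "szego ?a z"
    have nz: "1 - cnj ?a * z \<noteq> 0" "cnj (1 - cnj ?a * z) \<noteq> 0"
      using szego_denom_nonzero[OF a z] by (auto simp del: complex_cnj_diff)
    have "cnj z * z = 1"
      using z by (simp add: mult.commute[of "cnj z"] complex_norm_square[symmetric])
    then have "cnj ?a * z * (?a * cnj z) = ?a * cnj ?a"
      by (simp add: mult_ac)
    \<comment> \<open>With \<open>u = 1 - cnj a * z\<close> this says
      \<open>1 - cmod (1 - u) ^ 2 = u + cnj u - u * cnj u\<close>, using that \<open>z\<close> is
      unimodular.\<close>
    then have eq: "1 - ?a * cnj ?a = (1 - cnj ?a * z) + cnj (1 - cnj ?a * z) - (1 - cnj ?a * z) * cnj (1 - cnj ?a * z)"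
      by (simp add: algebra_simps)
    have "(1 - ?a * cnj ?a) * (?s * cnj ?s) = ?s + cnj ?s - 1"
      unfolding eq complex_cnj_divide complex_cnj_one using nz by (simp add: field_simps del: complex_cnj_diff)
    moreover have "B z powi k * cnj (B z powi k) = 1"
      using norm_blaschke[of n z] z by (simp add: complex_norm_square[symmetric] norm_power_int
          del: complex_cnj_power_int)
    moreover have "blaschke lam i z * cnj (blaschke lam i z) = 1"
      using cnj_blaschke[of i z] assms i z by (simp add: mult.commute)
    moreover have "blaschke_basis lam j z * B z powi k * cnj (blaschke_basis lam j z * B z powi k)
      = (blaschke lam i z * cnj (blaschke lam i z)) * (weight j * weight j) * (?s * cnj ?s)
         * (B z powi k * cnj (B z powi k))"
      by (simp add: i blaschke_basis_Suc del: complex_cnj_power_int)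
    ultimately show "blaschke_basis lam j z * B z powi k * cnj (blaschke_basis lam j z * B z powi k)
        = ?s + cnj ?s - 1"
      by (simp only: weight_square[OF assms]) simp
  qed (use assms in \<open>auto intro: continuous_basis\<close>)
  also have "L2_of (\<lambda>z. (szego ?a z + cnj (szego ?a z)) - 1)
      = L2_of (szego ?a) + cnj_L2 (L2_of (szego ?a)) - one_L2"
    using cz by (simp only: L2_of_cnj L2_of_add L2_of_diff L2_continuous L2_fun_const L2_fun_add)
  also have "cinner \<dots> one_L2 = 1"
  proof -
    have "cinner (cnj_L2 (L2_of (szego ?a))) one_L2 = cnj (cinner (L2_of (szego ?a)) one_L2)"
      using cz by (simp add: L2_of_cnj cinner_L2_of L2_continuous
          del: complex_cnj_divide complex_cnj_diff complex_cnj_mult)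
    then show ?thesis
      using mean_szego[OF a] by (simp add: cinner_add_left cinner_diff_left cinner_self_norm norm_L2_of_one)
  qed
  finally show ?thesis .
qed

lemma orthonormal_fam_basis: "orthonormal_fam indices basis"
  unfolding orthonormal_fam_def
proof (intro ballI)
  fix x y :: "nat \<times> int" assume xy: "x \<in> indices" "y \<in> indices"
  obtain i k j l where *: "x = (i, k)" "y = (j, l)"
    by (metis surj_pair)
  consider "x = y" | "l < k \<or> (l = k \<and> j < i)" | "k < l \<or> (k = l \<and> i < j)"
    using * by fastforce
  then show "cinner (basis x) (basis y) = (if x = y then 1 else 0)"
  proof cases
    case 1
    then show ?thesis
      using cinner_basis_self xy * by auto
  next
    case 2
    then show ?thesis
      using cinner_basis_zero[of i j l k] xy * by auto
  next
    case 3
    then have "cinner (basis y) (basis x) = 0"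
      using cinner_basis_zero[of j i k l] xy * by auto
    then show ?thesis
      using 3 * by (subst cinner_commute) auto
  qed
qed

section \<open>Completeness of the orthonormal family\<close>

abbreviation basis_space :: "L2 set" where "basis_space \<equiv> closure (L2.span (basis ` indices))"

lemma basis_space: "L2.subspace basis_space" "closed basis_space"
  by (simp_all add: subspace_closure_L2)

lemma basis_in_space: "x \<in> indices \<Longrightarrow> basis x \<in> basis_space"
  by (intro subsetD[OF closure_subset] L2.span_base imageI)

lemma mult_op_L2_of_continuous:
  assumes "continuous_on (sphere 0 1) p" "continuous_on (sphere 0 1) q"
    "\<And>z. cmod z = 1 \<Longrightarrow> p z * q z = r z"
  shows "mult_op p (L2_of q) = L2_of r"
proof -
  have "mult_op p (L2_of q) = L2_of (\<lambda>z. p z * q z)"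
    using assms by (intro L2_of_mult Linf_continuous L2_continuous)
  also have "\<dots> = L2_of r"
    using assms(3) by (rule L2_of_cong)
  finally show ?thesis .
qed

lemma mult_op_B_powi_basis:
  assumes "j \<in> {1..n}"
  shows "mult_op (\<lambda>z. B z powi m) (basis (j, k)) = basis (j, k + m)"
  unfolding basis_def case_prod_conv
  by (rule mult_op_L2_of_continuous[OF continuous_B_powi continuous_basis[OF assms]])
    (simp add: power_int_add blaschke_nonzero)

lemma B_powi_basis_space:
  assumes "f \<in> basis_space"
  shows "mult_op (\<lambda>z. B z powi m) f \<in> basis_space"
proof -
  let ?V = "mult_op (\<lambda>z. B z powi m)"
  have "basis_space \<subseteq> ?V -` basis_space"
  proof (rule closure_span_minimal)
    show "basis ` indices \<subseteq> ?V -` basis_space"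
      using basis_in_space by (auto simp: mult_op_B_powi_basis)
    show "L2.subspace (?V -` basis_space)"
      by (intro subspace_vimage basis_space mult_op_add mult_op_scaleC)
    show "closed (?V -` basis_space)"
      by (intro closed_vimage basis_space continuous_on_subset[OF linear_continuous_on]
          bounded_linear_mult_op Linf_continuous continuous_B_powi) auto
  qed
  then show ?thesis
    using assms by blast
qed

lemma L2_of_lin:
  assumes "continuous_on (sphere 0 1) p" "continuous_on (sphere 0 1) q"
    "\<And>z. cmod z = 1 \<Longrightarrow> c * r z = a * p z - b * q z"
    "continuous_on (sphere 0 1) r"
  shows "scaleC c (L2_of r) = scaleC a (L2_of p) - scaleC b (L2_of q)"
proof -
  have "scaleC c (L2_of r) = L2_of (\<lambda>z. c * r z)"
    using assms by (intro L2_of_scale L2_continuous)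
  also have "\<dots> = L2_of (\<lambda>z. a * p z - b * q z)"
    using assms(3) by (rule L2_of_cong)
  also have "\<dots> = scaleC a (L2_of p) - scaleC b (L2_of q)"
    using assms(1,2) by (simp add: L2_of_scale L2_of_diff L2_continuous L2_fun_scale)
  finally show ?thesis .
qed

lemma mult_op_diff: "mult_op p (f - g) = mult_op p f - mult_op p g"
  using mult_op_add[of p f "- g"] mult_op_scaleC[of p "-1" g] by (simp add: scaleC_minus1)

text \<open>Serves both \<open>lam\<close> and its conjugate. One factor of modulus below 1 is
  enough, and \<open>n_pos\<close> provides it; the empty product would be 1.\<close>

lemma norm_prod_lam:
  assumes "\<And>j. cmod (c j) = cmod (lam j)"
  shows "cmod (\<Prod>j=1..n. c j) < 1"
proof -
  have "{1..n} = insert 1 {2..n}"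
    using n_pos by auto
  then have "cmod (\<Prod>j=1..n. c j) = cmod (lam 1) * (\<Prod>j=2..n. cmod (lam j))"
    by (simp add: norm_mult assms prod_norm[symmetric])
  also have "\<dots> \<le> cmod (lam 1) * 1"
    using lam by (intro mult_left_mono prod_le_1) (auto intro: less_imp_le)
  also have "\<dots> < 1"
    using lam[of 1] n_pos by simp
  finally show ?thesis .
qed

lemma norm_mult_op_B_powi: "norm (mult_op (\<lambda>z. B z powi k) f) = norm f"
  by (intro norm_mult_op_unimodular Linf_continuous continuous_B_powi AE_I2)
    (auto simp: norm_power_int norm_blaschke)

lemma mult_op_B_powi_blaschke_L2:
  "mult_op (\<lambda>z. B z powi 1) one_L2 = L2_of B"
  by (rule mult_op_L2_of_continuous[OF continuous_B_powi]) auto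

text \<open>Telescoping the first identity puts \<open>1 - P * B\<close> into the span, where
  \<open>P\<close> is the product of the conjugated zeros. The contraction argument for
  multiplication by \<open>B\<close> extracts 1, hence \<open>B\<close>, and the partial products
  follow.\<close>

lemma blaschke_in_basis_space:
  assumes "j \<le> n"
  shows "L2_of (blaschke lam j) \<in> basis_space"
proof -
  let ?x = "\<lambda>j. L2_of (blaschke lam j)"
  let ?P = "\<lambda>j. \<Prod>l=1..j. cnj (lam l)"
  have step: "?x j - scaleC (cnj (lam (Suc j))) (?x (Suc j)) \<in> basis_space" if j: "Suc j \<le> n" for j
  proof -
    have "scaleC (weight (Suc j)) (basis (Suc j, 0)) \<in> basis_space"
      using basis_in_space[of "(Suc j, 0)"] j L2.subspace_scale[OF basis_space(1)] by auto
    moreover have "scaleC (weight (Suc j)) (basis (Suc j, 0))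
        = scaleC 1 (?x j) - scaleC (cnj (lam (Suc j))) (?x (Suc j))"
      unfolding basis_def case_prod_conv using j
      by (intro L2_of_lin continuous_blaschke continuous_basis)
        (auto simp: blaschke_basis_identity)
    ultimately show ?thesis
      by simp
  qed
  have "?x 0 - scaleC (?P j) (?x j) \<in> basis_space" if "j \<le> n" for j
    using that
  proof (induction j)
    case 0
    show ?case
      using L2.subspace_0[OF basis_space(1)] by simp
  next
    case (Suc j)
    have "scaleC (?P j) (?x j - scaleC (cnj (lam (Suc j))) (?x (Suc j))) \<in> basis_space"
      using step Suc.prems L2.subspace_scale[OF basis_space(1)] by blast
    with Suc have "(?x 0 - scaleC (?P j) (?x j)) + scaleC (?P j) (?x j - scaleC (cnj (lam (Suc j))) (?x (Suc j)))
        \<in> basis_space"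
      by (intro L2.subspace_add[OF basis_space(1)]) auto
    then show ?case
      by (simp add: L2.scale_right_diff_distrib)
  qed
  from this[of n] have "one_L2 - scaleC (?P n) (mult_op (\<lambda>z. B z powi 1) one_L2) \<in> basis_space"
    unfolding mult_op_B_powi_blaschke_L2 by simp
  note x0 = this
  have one: "one_L2 \<in> basis_space"
    by (rule closed_subspace_contraction[where W = basis_space and V = "mult_op (\<lambda>z. B z powi 1)"
          and P = "?P n", OF basis_space _ _ _ _ _ x0])
      (rule B_powi_basis_space mult_op_diff mult_op_scaleC norm_mult_op_B_powi norm_prod_lam
          complex_mod_cnj | assumption)+
  have "?x n \<in> basis_space"
    using B_powi_basis_space[OF one, of 1] unfolding mult_op_B_powi_blaschke_L2 .
  \<comment> \<open>Downward induction from \<open>n\<close>, because \<open>step\<close> recovers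
    the product at \<open>j\<close> from the one at \<open>Suc j\<close>.\<close>
  with assms show ?thesis
  proof (induction rule: inc_induct)
    case (step j)
    have "(?x j - scaleC (cnj (lam (Suc j))) (?x (Suc j))) + scaleC (cnj (lam (Suc j))) (?x (Suc j))
        \<in> basis_space"
      using step \<open>\<And>j. Suc j \<le> n \<Longrightarrow> ?x j - scaleC (cnj (lam (Suc j))) (?x (Suc j)) \<in> basis_space\<close>
      by (intro L2.subspace_add[OF basis_space(1)] L2.subspace_scale[OF basis_space(1)]) auto
    then show ?case
      by simp
  qed
qed

text \<open>The second identity, multiplied by \<open>cnj z\<close>, runs upwards, so the telescoped
  relation is first divided by \<open>B\<close>; the contraction argument then uses multiplication
  by the inverse of \<open>B\<close> and starts from \<open>cnj z\<close>.\<close>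

lemma cnj_blaschke_in_basis_space:
  assumes "j \<le> n"
  shows "L2_of (\<lambda>z. cnj z * blaschke lam j z) \<in> basis_space"
proof -
  let ?y = "\<lambda>j. L2_of (\<lambda>z. cnj z * blaschke lam j z)"
  let ?P = "\<lambda>j. \<Prod>l=1..j. lam l"
  let ?V = "mult_op (\<lambda>z. B z powi (- 1))"
  have c: "continuous_on (sphere 0 1) (\<lambda>z. cnj z * blaschke lam j z)" if "j \<le> n" for j
    using that by (intro continuous_intros continuous_blaschke)
  have step: "scaleC (lam (Suc j)) (?y j) - ?y (Suc j) \<in> basis_space" if j: "Suc j \<le> n" for j
  proof -
    have "scaleC (weight (Suc j)) (basis (Suc j, 0)) \<in> basis_space"
      using basis_in_space[of "(Suc j, 0)"] j L2.subspace_scale[OF basis_space(1)] by auto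
    moreover have "scaleC (weight (Suc j)) (basis (Suc j, 0))
        = scaleC (lam (Suc j)) (?y j) - scaleC 1 (?y (Suc j))"
      unfolding basis_def case_prod_conv
    proof (rule L2_of_lin)
      fix z :: complex assume z: "cmod z = 1"
      have "weight (Suc j) * blaschke_basis lam (Suc j) z
          = cnj z * (z * (weight (Suc j) * blaschke_basis lam (Suc j) z))"
        using z by (simp add: mult.assoc[symmetric] mult.commute[of "cnj z"] complex_norm_square[symmetric])
      then show "weight (Suc j) * (blaschke_basis lam (Suc j) z * B z powi 0)
          = lam (Suc j) * (cnj z * blaschke lam j z) - 1 * (cnj z * blaschke lam (Suc j) z)"
        unfolding z_blaschke_basis_identity[OF j z] by (simp add: algebra_simps)
    qed (use j in \<open>auto intro!: c continuous_basis[of "Suc j" 0, simplified]\<close>)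
    ultimately show ?thesis
      by simp
  qed
  have y_step: "?y (Suc j) - scaleC (lam (Suc j)) (?y j) \<in> basis_space" if "Suc j \<le> n" for j
    using L2.subspace_neg[OF basis_space(1) step[OF that]] by simp
  have "?y j - scaleC (?P j) (?y 0) \<in> basis_space" if "j \<le> n" for j
    using that
  proof (induction j)
    case 0
    show ?case
      using L2.subspace_0[OF basis_space(1)] by simp
  next
    case (Suc j)
    have "scaleC (lam (Suc j)) (?y j - scaleC (?P j) (?y 0)) \<in> basis_space"
      using Suc L2.subspace_scale[OF basis_space(1)] by simp
    with y_step[OF Suc.prems] have "(?y (Suc j) - scaleC (lam (Suc j)) (?y j))
        + scaleC (lam (Suc j)) (?y j - scaleC (?P j) (?y 0)) \<in> basis_space"
      by (intro L2.subspace_add[OF basis_space(1)])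
    then show ?case
      by (simp add: L2.scale_right_diff_distrib mult.commute)
  qed
  \<comment> \<open>Since \<open>?y n\<close> is \<open>B\<close> times \<open>?y 0\<close>,
    applying \<open>?V\<close> turns the relation into the shape required by
    \<open>closed_subspace_contraction\<close>.\<close>
  then have "?V (?y n - scaleC (?P n) (?y 0)) \<in> basis_space"
    by (intro B_powi_basis_space) simp
  moreover have "?V (?y n) = ?y 0"
    using c[of n] blaschke_nonzero[of n]
    by (intro mult_op_L2_of_continuous[OF continuous_B_powi]) (auto simp: power_int_minus field_simps)
  ultimately have "?y 0 - scaleC (?P n) (?V (?y 0)) \<in> basis_space"
    by (simp only: mult_op_diff mult_op_scaleC)
  note y0 = this
  have 0: "?y 0 \<in> basis_space"
    by (rule closed_subspace_contraction[where W = basis_space and V = ?V and P = "?P n", OF basis_space _ _ _ _ _ y0])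
      (rule B_powi_basis_space mult_op_diff mult_op_scaleC norm_mult_op_B_powi norm_prod_lam refl
        | assumption)+
  show ?thesis
    using assms
  proof (induction j)
    case (Suc j)
    have "(?y (Suc j) - scaleC (lam (Suc j)) (?y j)) + scaleC (lam (Suc j)) (?y j) \<in> basis_space"
      using Suc y_step by (intro L2.subspace_add[OF basis_space(1)] L2.subspace_scale[OF basis_space(1)]) auto
    then show ?case
      by simp
  qed (rule 0)
qed

text \<open>Multiplication by \<open>p\<close> commutes with powers of \<open>B\<close>, so only the
  \<open>e\<^sub>j\<close> need testing. The factor \<open>weight j\<close> is kept because the
  identities produce it; it is divided out inside.\<close>

lemma basis_space_invariant:
  assumes p: "continuous_on (sphere 0 1) p"
    and e: "\<And>j. j \<in> {1..n} \<Longrightarrow> L2_of (\<lambda>z. p z * (weight j * blaschke_basis lam j z)) \<in> basis_space"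
    and f: "f \<in> basis_space"
  shows "mult_op p f \<in> basis_space"
proof -
  have "basis_space \<subseteq> mult_op p -` basis_space"
  proof (rule closure_span_minimal)
    show "basis ` indices \<subseteq> mult_op p -` basis_space"
    proof safe
      fix j k assume j: "j \<in> {1..n}"
      have c: "continuous_on (sphere 0 1) (\<lambda>z. p z * (weight j * blaschke_basis lam j z))"
        using j by (intro continuous_intros continuous_blaschke_basis p)
      have "scaleC (1 / weight j) (mult_op (\<lambda>z. B z powi k) (L2_of (\<lambda>z. p z * (weight j * blaschke_basis lam j z))))
          \<in> basis_space"
        using e[OF j] by (intro L2.subspace_scale[OF basis_space(1)] B_powi_basis_space)
      also have "mult_op (\<lambda>z. B z powi k) (L2_of (\<lambda>z. p z * (weight j * blaschke_basis lam j z)))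
          = L2_of (\<lambda>z. weight j * (p z * (blaschke_basis lam j z * B z powi k)))"
        using c by (intro mult_op_L2_of_continuous[OF continuous_B_powi]) (auto simp: mult_ac)
      also have "\<dots> = scaleC (weight j) (L2_of (\<lambda>z. p z * (blaschke_basis lam j z * B z powi k)))"
        using j by (intro L2_of_scale[symmetric] L2_continuous continuous_intros p continuous_basis[of j k])
      also have "L2_of (\<lambda>z. p z * (blaschke_basis lam j z * B z powi k)) = mult_op p (basis (j, k))"
        unfolding basis_def case_prod_conv
        by (rule mult_op_L2_of_continuous[OF p continuous_basis[OF j], symmetric]) simp
      finally show "basis (j, k) \<in> mult_op p -` basis_space"
        using weight_nonzero[OF j] by simp
    qed
    show "L2.subspace (mult_op p -` basis_space)"
      by (intro subspace_vimage basis_space mult_op_add mult_op_scaleC)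
    show "closed (mult_op p -` basis_space)"
      by (intro closed_vimage basis_space continuous_on_subset[OF linear_continuous_on]
          bounded_linear_mult_op Linf_continuous p) auto
  qed
  then show ?thesis
    using f by blast
qed

lemma basis_space_UNIV: "basis_space = UNIV"
proof (rule invariant_subspace_UNIV)
  show "one_L2 \<in> basis_space"
    using blaschke_in_basis_space[of 0] by simp
  show "mult_op (\<lambda>z. z) f \<in> basis_space" if "f \<in> basis_space" for f
  proof (rule basis_space_invariant[OF _ _ that])
    fix j assume "j \<in> {1..n}"
    then obtain i where i: "j = Suc i" "Suc i \<le> n"
      by (cases j) auto
    have "L2_of (\<lambda>z. z * (weight j * blaschke_basis lam j z))
        = L2_of (\<lambda>z. lam j * blaschke lam i z - blaschke lam j z)"
      using i z_blaschke_basis_identity by (intro L2_of_cong) auto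
    also have "\<dots> = scaleC (lam j) (L2_of (blaschke lam i)) - L2_of (blaschke lam j)"
      using i continuous_blaschke by (simp add: L2_of_scale L2_of_diff L2_fun_scale L2_continuous)
    also have "\<dots> \<in> basis_space"
      using i blaschke_in_basis_space
      by (intro L2.subspace_diff[OF basis_space(1)] L2.subspace_scale[OF basis_space(1)]) auto
    finally show "L2_of (\<lambda>z. z * (weight j * blaschke_basis lam j z)) \<in> basis_space" .
  qed (intro continuous_intros)
  show "mult_op cnj f \<in> basis_space" if "f \<in> basis_space" for f
  proof (rule basis_space_invariant[OF _ _ that])
    fix j assume "j \<in> {1..n}"
    then obtain i where i: "j = Suc i" "Suc i \<le> n"
      by (cases j) auto
    have c: "(\<lambda>z. cnj z * blaschke lam m z) \<in> L2_fun" if "m \<le> n" for m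
      using that by (intro L2_continuous continuous_intros continuous_blaschke)
    have "L2_of (\<lambda>z. cnj z * (weight j * blaschke_basis lam j z))
        = L2_of (\<lambda>z. (cnj z * blaschke lam i z) - cnj (lam j) * (cnj z * blaschke lam j z))"
      using i blaschke_basis_identity[of i]
      by (intro L2_of_cong) (simp add: right_diff_distrib mult.left_commute)
    also have "\<dots> = L2_of (\<lambda>z. cnj z * blaschke lam i z) - scaleC (cnj (lam j)) (L2_of (\<lambda>z. cnj z * blaschke lam j z))"
      using i c[of i] c[of j] by (simp add: L2_of_scale L2_of_diff L2_fun_scale)
    also have "\<dots> \<in> basis_space"
      using i cnj_blaschke_in_basis_space
      by (intro L2.subspace_diff[OF basis_space(1)] L2.subspace_scale[OF basis_space(1)]) auto
    finally show "L2_of (\<lambda>z. cnj z * (weight j * blaschke_basis lam j z)) \<in> basis_space" .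
  qed (intro continuous_intros)
qed (fact basis_space)+

lemma orthonormal_basis: "orthonormal_basis indices basis"
  using orthonormal_fam_basis basis_space_UNIV by (simp add: orthonormal_basis_def)

end

section \<open>Conjugations\<close>

lemma conjugationD:
  assumes "conjugation C"
  shows "C (f + g) = C f + C g" "C (scaleC a f) = scaleC (cnj a) (C f)" "C (C f) = f"
    "cinner (C f) (C g) = cinner g f"
  using assms by (auto simp: conjugation_def fun_eq_iff)

lemma conjugation_norm: "conjugation C \<Longrightarrow> norm (C f) = norm f"
  by (simp add: norm_L2_def conjugationD)

text \<open>Follows by writing \<open>g\<close> as \<open>C (C g)\<close>; it plays the part of
  self-adjointness for an antilinear map.\<close>

lemma conjugation_cinner: "conjugation C \<Longrightarrow> cinner (C f) g = cinner (C g) f"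
  using conjugationD(3,4) by metis

text \<open>\<open>bounded_linear\<close> means real linearity, which an antilinear map has; it
  allows conjugations to be applied term by term to infinite sums.\<close>

lemma bounded_linear_conjugation: "conjugation C \<Longrightarrow> bounded_linear C"
  by (rule bounded_linear_intro[where K = 1])
    (simp_all add: conjugationD conjugation_norm scaleR_L2_def)

lemma cnj_L2_add: "cnj_L2 (f + g) = cnj_L2 f + cnj_L2 g"
  by transfer (auto simp: L2_eq_def L2_fun_add L2_fun_cnj)

lemma cnj_L2_scaleC: "cnj_L2 (scaleC c f) = scaleC (cnj c) (cnj_L2 f)"
  by transfer (auto simp: L2_eq_def L2_fun_scale L2_fun_cnj)

lemma cnj_L2_cnj_L2 [simp]: "cnj_L2 (cnj_L2 f) = f"
  by transfer (auto simp: L2_eq_def)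

lemma cnj_L2_mult_op:
  assumes "p \<in> Linf_fun"
  shows "cnj_L2 (mult_op p f) = mult_op (\<lambda>z. cnj (p z)) (cnj_L2 f)"
  by (rule L2_cases[of f])
    (simp add: assms L2_of_mult L2_of_cnj Linf_cnj L2_fun_cnj L2_fun_mult_Linf)

lemma cinner_cnj_L2: "cinner (cnj_L2 f) (cnj_L2 g) = cinner g f"
  by (rule L2_cases[of f], rule L2_cases[of g])
    (simp add: L2_of_cnj cinner_L2_of L2_fun_cnj mult.commute)

lemma conj_B_eq:
  assumes "p \<in> Linf_fun"
  shows "conj_B p f = mult_op (\<lambda>z. p z * cnj z) (cnj_L2 f)"
  unfolding conj_B_def using assms
  by (simp add: cnj_L2_mult_op mult_op_mult Linf_continuous Linf_cnj continuous_on_cnj)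

lemma conjugation_conj_B:
  assumes p: "p \<in> Linf_fun" "\<And>z. cmod z = 1 \<Longrightarrow> cmod (p z) = 1"
  shows "conjugation (conj_B p)"
proof -
  define q where "q z = p z * cnj z" for z
  have q: "q \<in> Linf_fun"
    unfolding q_def by (intro Linf_mult p Linf_continuous continuous_intros)
  have "mult_op (\<lambda>z. q z * cnj (q z)) = mult_op (\<lambda>_. 1)"
    using p(2) by (intro mult_op_cong)
      (auto simp: Linf_continuous q_def norm_mult simp flip: complex_norm_square
        simp del: complex_cnj_mult)
  then have qq: "mult_op q (mult_op (\<lambda>z. cnj (q z)) f) = f" "mult_op (\<lambda>z. cnj (q z)) (mult_op q f) = f" for f
    using q by (simp_all add: mult_op_mult Linf_cnj mult.commute)
  have eq: "conj_B p f = mult_op q (cnj_L2 f)" for f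
    using conj_B_eq[OF p(1)] by (simp add: q_def[abs_def])
  show ?thesis
    unfolding conjugation_def
    by (simp add: eq fun_eq_iff cnj_L2_add mult_op_add cnj_L2_scaleC mult_op_scaleC
        cnj_L2_mult_op q qq cinner_mult_op cinner_cnj_L2)
qed

lemma conj_B_mult_op:
  assumes "p \<in> Linf_fun" "q \<in> Linf_fun"
  shows "conj_B p (mult_op q f) = mult_op (\<lambda>z. cnj (q z)) (conj_B p f)"
proof -
  have "(\<lambda>z. p z * cnj z) \<in> Linf_fun"
    using assms by (intro Linf_mult Linf_continuous[of cnj] continuous_intros)
  then show ?thesis
    using assms by (simp add: conj_B_eq cnj_L2_mult_op mult_op_mult Linf_cnj mult_ac)
qed

text \<open>As \<open>bounded_linear\<close> only gives real linearity, the passage of agreement to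
  complex multiples is a separate hypothesis.\<close>

lemma bounded_linear_eq_on_basis:
  assumes "orthonormal_basis I b" "bounded_linear S" "bounded_linear T"
    and "\<And>c f. S f = T f \<Longrightarrow> S (scaleC c f) = T (scaleC c f)"
    and "\<And>i. i \<in> I \<Longrightarrow> S (b i) = T (b i)"
  shows "S f = T f"
proof -
  let ?e = "\<lambda>i. scaleC (cinner f (b i)) (b i)"
  have "((\<lambda>i. S (?e i)) has_sum S f) I" "((\<lambda>i. T (?e i)) has_sum T f) I"
    using has_sum_bounded_linear orthonormal_basis_expansion[OF assms(1), of f] assms(2,3) by blast+
  moreover have "((\<lambda>i. S (?e i)) has_sum S f) I \<longleftrightarrow> ((\<lambda>i. T (?e i)) has_sum S f) I"
    by (intro has_sum_cong assms)
  ultimately show ?thesis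
    using has_sum_unique by blast
qed

lemma has_sum_in_closed_subspace:
  assumes "L2.subspace W" "closed W" "\<And>i. i \<in> I \<Longrightarrow> f i \<in> W" "(f has_sum s) I"
  shows "s \<in> W"
proof (rule Lim_in_closed_set[OF assms(2)])
  show "((\<lambda>F. \<Sum>i\<in>F. f i) \<longlongrightarrow> s) (finite_subsets_at_top I)"
    using assms(4) by (simp add: has_sum_def)
  show "\<forall>\<^sub>F F in finite_subsets_at_top I. (\<Sum>i\<in>F. f i) \<in> W"
    using assms(3) by (intro eventually_finite_subsets_at_top_weakI L2.subspace_sum[OF assms(1)]) auto
qed simp

lemma orthogonal_closed_span:
  assumes "\<And>x. x \<in> S \<Longrightarrow> cinner x g = 0" "f \<in> closure (L2.span S)"
  shows "cinner f g = 0"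
proof -
  have "closure (L2.span S) \<subseteq> {f. cinner f g = 0}"
  proof (rule closure_span_minimal)
    show "L2.subspace {f. cinner f g = 0}"
      by (auto simp: L2.subspace_def cinner_add_left cinner_scaleC_left)
    show "closed {f. cinner f g = 0}"
      by (intro closed_Collect_eq linear_continuous_on bounded_linear_cinner_left continuous_on_const)
  qed (use assms in auto)
  then show ?thesis
    using assms by blast
qed

text \<open>Groups the expansion over pairs \<open>(j, k)\<close> into finite blocks, one for each
  power of \<open>B\<close>.\<close>

lemma has_sum_sum_first:
  fixes h :: "'a \<times> 'b \<Rightarrow> 'c :: {topological_comm_monoid_add, t3_space}"
  assumes "(h has_sum s) (A \<times> UNIV)" "finite A"
  shows "((\<lambda>k. \<Sum>j\<in>A. h (j, k)) has_sum s) UNIV"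
proof (rule has_sum_SigmaD)
  show "((\<lambda>(x, y). h (y, x)) has_sum s) (UNIV \<times> A)"
    using assms(1) by (simp add: has_sum_swap[of h])
  show "((\<lambda>y. (\<lambda>(x, y). h (y, x)) (k, y)) has_sum (\<Sum>j\<in>A. h (j, k))) A" for k
    using assms(2) by (simp add: has_sum_finite)
qed

section \<open>Multiplication by powers of \<open>B\<close> in terms of the basis\<close>

context blaschke_product
begin

lemma B_Linf: "B \<in> Linf_fun" "(\<lambda>z. B z powi k) \<in> Linf_fun"
  by (auto intro: Linf_continuous continuous_blaschke continuous_B_powi)

lemma mult_op_B_powi_mult: "mult_op (\<lambda>z. B z powi k) (mult_op (\<lambda>z. B z powi l) f) = mult_op (\<lambda>z. B z powi (k + l)) f"
proof -
  have "mult_op (\<lambda>z. B z powi k * B z powi l) = mult_op (\<lambda>z. B z powi (k + l))"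
    by (intro mult_op_cong B_Linf) (simp add: power_int_add blaschke_nonzero)
  then show ?thesis
    by (simp add: mult_op_mult B_Linf)
qed

lemma mult_op_cnj_B_powi: "mult_op (\<lambda>z. cnj (B z powi k)) = mult_op (\<lambda>z. B z powi (- k))"
proof (intro mult_op_cong B_Linf)
  fix z :: complex assume z: "cmod z = 1"
  have "cnj (B z powi k) * B z powi k = 1"
    using norm_blaschke[of n z] z by (simp add: mult.commute[of "cnj _"] norm_power_int
        del: complex_cnj_power_int flip: complex_norm_square)
  then show "cnj (B z powi k) = B z powi (- k)"
    using blaschke_nonzero[of n z] z by (simp add: power_int_minus field_simps del: complex_cnj_power_int)
qed

lemma cinner_B_powi: "cinner (mult_op (\<lambda>z. B z powi k) f) g = cinner f (mult_op (\<lambda>z. B z powi (- k)) g)"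
  by (simp add: cinner_mult_op B_Linf mult_op_cnj_B_powi del: complex_cnj_power_int)

lemma basis_shift: "j \<in> {1..n} \<Longrightarrow> basis (j, k) = mult_op (\<lambda>z. B z powi k) (basis (j, 0))"
  by (simp add: mult_op_B_powi_basis del: power_int_0_right)

lemma cinner_basis:
  "i \<in> {1..n} \<Longrightarrow> j \<in> {1..n} \<Longrightarrow>
    cinner (basis (i, k)) (basis (j, l)) = (if i = j \<and> k = l then 1 else 0)"
  using orthonormal_famD[OF orthonormal_fam_basis, of "(i, k)" "(j, l)"] by simp

lemma basis_eqI:
  assumes "\<And>j k. j \<in> {1..n} \<Longrightarrow> cinner f (basis (j, k)) = cinner g (basis (j, k))"
  shows "f = g"
  using assms by (intro orthonormal_basis_eqI[OF orthonormal_basis]) auto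

lemma basis_hardy:
  assumes "j \<in> {1..n}" "0 \<le> k"
  shows "basis (j, k) \<in> hardy"
proof -
  have "hardy_mult (\<lambda>z. blaschke_basis lam j z * B z ^ nat k)"
    using assms by (intro hardy_mult_mult hardy_mult_blaschke_basis hardy_mult_power
        hardy_mult_blaschke) auto
  from hardy_mult_hardy[OF this one_hardy] hardy_mult_Linf[OF this]
  show ?thesis
    using assms by (simp add: basis_def mult_op_one_L2 power_int_def)
qed

lemma B_powi_hardy:
  assumes "f \<in> hardy" "0 \<le> k"
  shows "mult_op (\<lambda>z. B z powi k) f \<in> hardy"
proof -
  have "hardy_mult (\<lambda>z. B z ^ nat k)"
    by (intro hardy_mult_power hardy_mult_blaschke) auto
  from hardy_mult_hardy[OF this assms(1)] show ?thesis
    using assms(2) by (simp add: power_int_def)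
qed

lemma cinner_z_hardy:
  assumes "g \<in> hardy"
  shows "cinner (mult_op (\<lambda>z. z) g) one_L2 = 0"
proof -
  have "cinner (mult_op (\<lambda>z. z) g) one_L2 = fourier_coeff (mult_op (\<lambda>z. z) g) 0"
    by (simp add: fourier_coeff_def)
  also have "\<dots> = fourier_coeff g (- 1)"
    by (simp add: fourier_coeff_shift)
  finally show ?thesis
    using assms by (simp add: hardy_def)
qed

lemma cinner_L2_of_right: "p \<in> Linf_fun \<Longrightarrow> cinner f (L2_of p) = cinner (mult_op (\<lambda>z. cnj (p z)) f) one_L2"
  using cinner_mult_op[OF Linf_cnj, of p f one_L2] by (simp add: mult_op_one_L2)

subsection \<open>The model space\<close>

lemma basis_0: "basis (j, 0) = L2_of (blaschke_basis lam j)"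
  by (simp add: basis_def)

text \<open>Pairing \<open>B h\<close> with \<open>e\<^sub>j\<close> gives the mean of
  \<open>z * dual j n z * h z\<close>, which vanishes for Hardy \<open>h\<close>.\<close>

lemma basis_0_model:
  assumes j: "j \<in> {1..n}"
  shows "basis (j, 0) \<in> model_space B"
  unfolding model_space_def
proof (safe intro!: basis_hardy j)
  fix h assume h: "h \<in> hardy"
  have d: "hardy_mult (dual j n)"
    using j by (intro hardy_mult_dual) auto
  have e: "blaschke_basis lam j \<in> Linf_fun"
    by (intro Linf_continuous continuous_blaschke_basis j)
  have "mult_op (\<lambda>z. cnj (blaschke_basis lam j z)) (mult_op B h)
      = mult_op (\<lambda>z. cnj (blaschke_basis lam j z) * B z) h"
    by (intro mult_op_mult Linf_cnj e B_Linf)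
  also have "mult_op (\<lambda>z. cnj (blaschke_basis lam j z) * B z) = mult_op (\<lambda>z. z * dual j n z)"
    using j by (intro mult_op_cong Linf_mult hardy_mult_Linf d hardy_mult_ident)
      (auto intro: cnj_blaschke_basis)
  also have "mult_op (\<lambda>z. z * dual j n z) h = mult_op (\<lambda>z. z) (mult_op (dual j n) h)"
    by (intro mult_op_mult[symmetric] hardy_mult_Linf d hardy_mult_ident)
  finally have "cinner (mult_op B h) (basis (j, 0)) = 0"
    unfolding basis_0 cinner_L2_of_right[OF e]
    by (simp add: cinner_z_hardy hardy_mult_hardy[OF d h])
  then show "cinner (basis (j, 0)) (mult_op B h) = 0"
    by (subst cinner_commute) simp
qed

lemma model_space_subspace: "L2.subspace (model_space p)"
proof -
  have "0 \<in> hardy"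
    using hardy_scaleC[OF one_hardy, of 0] by simp
  then show ?thesis
    by (auto simp: L2.subspace_def model_space_def hardy_add hardy_scaleC cinner_add_left
        cinner_scaleC_left)
qed

text \<open>For \<open>k > 0\<close> the basis vector is \<open>B\<close> times a Hardy function.
  For \<open>k < 0\<close> the power moves to \<open>f\<close>, and \<open>e\<^sub>j\<close> is
  orthogonal to \<open>B\<close> times a Hardy function.\<close>

lemma model_space_orthogonal:
  assumes f: "f \<in> model_space B" and j: "j \<in> {1..n}" and k: "k \<noteq> 0"
  shows "cinner f (basis (j, k)) = 0"
proof (cases "k > 0")
  case True
  have "basis (j, k) = mult_op (\<lambda>z. B z powi 1) (basis (j, k - 1))"
    using mult_op_B_powi_basis[OF j, of 1 "k - 1"] by simp
  then show ?thesis
    using f basis_hardy[OF j, of "k - 1"] True by (simp add: model_space_def)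
next
  case False
  have f': "f \<in> hardy"
    using f by (simp add: model_space_def)
  have "cinner (basis (j, k)) f = cinner (basis (j, 0)) (mult_op (\<lambda>z. B z powi 1) (mult_op (\<lambda>z. B z powi (- k - 1)) f))"
    unfolding mult_op_B_powi_mult by (subst basis_shift[OF j]) (simp add: cinner_B_powi)
  also have "\<dots> = 0"
    using basis_0_model[OF j] B_powi_hardy[OF f', of "- k - 1"] False k by (simp add: model_space_def)
  finally show ?thesis
    by (subst cinner_commute) simp
qed

text \<open>Identifies the model space with the span of the \<open>e\<^sub>j\<close> by comparing
  coefficients, without a dimension count.\<close>

lemma model_space_expansion:
  assumes "f \<in> model_space B"
  shows "f = (\<Sum>j=1..n. scaleC (cinner f (basis (j, 0))) (basis (j, 0)))"
proof (rule basis_eqI)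
  fix i k assume i: "i \<in> {1..n}"
  have "cinner (\<Sum>j=1..n. scaleC (cinner f (basis (j, 0))) (basis (j, 0))) (basis (i, k))
      = (\<Sum>j=1..n. if j = i then (if k = 0 then cinner f (basis (i, 0)) else 0) else 0)"
    unfolding cinner_sum_left using i by (intro sum.cong) (auto simp: cinner_scaleC_left cinner_basis)
  also have "\<dots> = (if k = 0 then cinner f (basis (i, 0)) else 0)"
    using i by simp
  finally show "cinner f (basis (i, k)) = cinner (\<Sum>j=1..n. scaleC (cinner f (basis (j, 0))) (basis (j, 0))) (basis (i, k))"
    using model_space_orthogonal[OF assms i, of k] by simp
qed

lemma conjugation_conj_B_blaschke: "conjugation (conj_B B)"
  by (intro conjugation_conj_B B_Linf) (simp add: norm_blaschke)

lemma conj_B_B_powi: "conj_B B (mult_op (\<lambda>z. B z powi k) f) = mult_op (\<lambda>z. B z powi (- k)) (conj_B B f)"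
  by (simp add: conj_B_mult_op B_Linf mult_op_cnj_B_powi del: complex_cnj_power_int)

lemma conj_B_basis:
  assumes j: "j \<in> {1..n}"
  shows "conj_B B (basis (j, 0)) = L2_of (dual j n)"
proof -
  have c: "continuous_on (sphere 0 1) (\<lambda>z. B z * cnj z)"
    by (intro continuous_intros continuous_blaschke) simp
  have "conj_B B (basis (j, 0)) = mult_op (\<lambda>z. B z * cnj z) (L2_of (\<lambda>z. cnj (blaschke_basis lam j z)))"
    using continuous_blaschke_basis[OF j] by (simp add: conj_B_eq B_Linf basis_0 L2_of_cnj L2_continuous)
  also have "\<dots> = L2_of (dual j n)"
  proof (rule mult_op_L2_of_continuous[OF c])
    show "continuous_on (sphere 0 1) (\<lambda>z. cnj (blaschke_basis lam j z))"
      by (intro continuous_intros continuous_blaschke_basis j)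
    fix z :: complex assume z: "cmod z = 1"
    have "B z * cnj z * cnj (blaschke_basis lam j z) = cnj z * (cnj (blaschke_basis lam j z) * B z)"
      by (simp add: mult_ac)
    also have "\<dots> = (cnj z * z) * dual j n z"
      using j z by (simp add: cnj_blaschke_basis)
    finally show "B z * cnj z * cnj (blaschke_basis lam j z) = dual j n z"
      using z by (simp add: mult.commute[of "cnj z"] complex_norm_square[symmetric])
  qed
  finally show ?thesis .
qed

text \<open>For the orthogonality, \<open>conj_B B\<close> is moved onto \<open>B h\<close>, where
  it yields the conjugate of \<open>z h\<close>; the pairing becomes the conjugated mean of
  \<open>z e\<^sub>j h\<close>.\<close>

lemma conj_B_basis_model:
  assumes j: "j \<in> {1..n}"
  shows "conj_B B (basis (j, 0)) \<in> model_space B"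
  unfolding model_space_def
proof safe
  have d: "hardy_mult (dual j n)"
    using j by (intro hardy_mult_dual) auto
  show "conj_B B (basis (j, 0)) \<in> hardy"
    using hardy_mult_hardy[OF d one_hardy] hardy_mult_Linf[OF d]
    by (simp only: conj_B_basis[OF j] mult_op_one_L2)
  fix h assume h: "h \<in> hardy"
  have e: "hardy_mult (blaschke_basis lam j)"
    by (intro hardy_mult_blaschke_basis j)
  note L = hardy_mult_Linf[OF e] hardy_mult_Linf[OF hardy_mult_ident]
  have "mult_op B (cnj_L2 (mult_op (\<lambda>z. z) (mult_op B h))) = cnj_L2 (mult_op (\<lambda>z. z) h)"
  proof -
    have "mult_op (\<lambda>z. B z * cnj (z * B z)) = mult_op cnj"
      using cnj_blaschke[of n] by (intro mult_op_cong Linf_continuous continuous_intros) (simp add: mult_ac)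
    then show ?thesis
      using L by (simp add: cnj_L2_mult_op mult_op_mult Linf_cnj Linf_mult B_Linf)
  qed
  then have "cinner (conj_B B (mult_op B h)) (basis (j, 0))
      = cinner (cnj_L2 (mult_op (\<lambda>z. z) h)) (cnj_L2 (cnj_L2 (L2_of (blaschke_basis lam j))))"
    by (simp add: conj_B_def basis_0)
  also have "\<dots> = cnj (cinner (mult_op (\<lambda>z. z) h) (L2_of (\<lambda>z. cnj (blaschke_basis lam j z))))"
    unfolding cinner_cnj_L2 using L by (subst cinner_commute) (simp add: L2_of_cnj Linf_imp_L2)
  also have "cinner (mult_op (\<lambda>z. z) h) (L2_of (\<lambda>z. cnj (blaschke_basis lam j z)))
      = cinner (mult_op (\<lambda>z. z) (mult_op (blaschke_basis lam j) h)) one_L2"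
    using L by (simp add: cinner_L2_of_right Linf_cnj mult_op_mult mult.commute)
  also have "\<dots> = 0"
    by (intro cinner_z_hardy hardy_mult_hardy[OF e] h)
  finally show "cinner (conj_B B (basis (j, 0))) (mult_op B h) = 0"
    using conjugation_cinner[OF conjugation_conj_B_blaschke] by simp
qed

subsection \<open>Components\<close>

definition proj :: "nat \<Rightarrow> L2 \<Rightarrow> L2" where
  "proj j = transport basis ({j} \<times> UNIV) id"

lemma cinner_proj:
  assumes "j \<in> {1..n}" "i \<in> {1..n}"
  shows "cinner (proj j f) (basis (i, k)) = (if i = j then cinner f (basis (i, k)) else 0)"
proof -
  note b = orthonormal_fam_basis
  have J: "{j} \<times> UNIV \<subseteq> indices" "inj_on id ({j} \<times> (UNIV :: int set))" "id ` ({j} \<times> UNIV) \<subseteq> indices"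
    using assms by auto
  show ?thesis
    using cinner_transport[OF b J, of "(i, k)" f] cinner_transport_other[OF b J, of "(i, k)" f] assms
    by (auto simp: proj_def)
qed

lemma H_space_eq: "H_space lam n j = closure (L2.span (basis ` ({j} \<times> UNIV)))"
proof -
  have "basis ` ({j} \<times> UNIV) = range (\<lambda>k::int. L2_of (\<lambda>z. blaschke_basis lam j z * B z powi k))"
    by (auto simp: basis_def image_iff)
  then show ?thesis
    by (simp add: H_space_def)
qed

lemma proj_in_H_space:
  assumes "j \<in> {1..n}"
  shows "proj j f \<in> H_space lam n j"
proof -
  let ?H = "H_space lam n j"
  have H: "L2.subspace ?H" "closed ?H"
    by (simp_all add: H_space_eq subspace_closure_L2)
  have "((\<lambda>x. scaleC (cinner f (basis x)) (basis (id x))) has_sum proj j f) ({j} \<times> UNIV)"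
    unfolding proj_def using assms by (intro transport_has_sum[OF orthonormal_fam_basis]) auto
  then show ?thesis
  proof (rule has_sum_in_closed_subspace[OF H, rotated])
    fix x :: "nat \<times> int" assume "x \<in> {j} \<times> UNIV"
    then have "basis x \<in> ?H"
      unfolding H_space_eq by (intro subsetD[OF closure_subset] L2.span_base imageI)
    then show "scaleC (cinner f (basis x)) (basis (id x)) \<in> ?H"
      by (simp add: L2.subspace_scale[OF H(1)])
  qed
qed

lemma H_space_orthogonal:
  assumes "h \<in> H_space lam n j" "i \<in> {1..n}" "j \<in> {1..n}" "i \<noteq> j"
  shows "cinner h (basis (i, k)) = 0"
  using assms(1) unfolding H_space_eq
  by (rule orthogonal_closed_span[rotated]) (use assms in \<open>auto simp: cinner_basis\<close>)

lemma sum_proj: "(\<Sum>j=1..n. proj j f) = f"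
proof (rule basis_eqI)
  fix i k assume i: "i \<in> {1..n}"
  have "cinner (\<Sum>j=1..n. proj j f) (basis (i, k)) = (\<Sum>j=1..n. if j = i then cinner f (basis (i, k)) else 0)"
    unfolding cinner_sum_left using i by (intro sum.cong) (auto simp: cinner_proj)
  then show "cinner (\<Sum>j=1..n. proj j f) (basis (i, k)) = cinner f (basis (i, k))"
    using i by simp
qed

text \<open>The definite description needs uniqueness: pairing an arbitrary decomposition with
  \<open>e\<^sub>j B\<^sup>k\<close> leaves only its \<open>j\<close>-th member, as the summands are
  mutually orthogonal.\<close>

lemma components_eq:
  assumes "j \<in> {1..n}"
  shows "components lam n f j = proj j f"
proof -
  have "components lam n f = (\<lambda>j. if j \<in> {1..n} then proj j f else 0)"
    unfolding components_def
  proof (rule the_equality)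
    show "(\<forall>j\<in>{1..n}. (if j \<in> {1..n} then proj j f else 0) \<in> H_space lam n j) \<and>
      (\<forall>j. j \<notin> {1..n} \<longrightarrow> (if j \<in> {1..n} then proj j f else 0) = 0) \<and>
      f = (\<Sum>j=1..n. if j \<in> {1..n} then proj j f else 0)"
      using sum_proj[of f] by (auto simp: proj_in_H_space)
  next
    fix h assume h: "(\<forall>j\<in>{1..n}. h j \<in> H_space lam n j) \<and> (\<forall>j. j \<notin> {1..n} \<longrightarrow> h j = 0) \<and>
      f = (\<Sum>j=1..n. h j)"
    have "h j = proj j f" if j: "j \<in> {1..n}" for j
    proof (rule basis_eqI)
      fix i k assume i: "i \<in> {1..n}"
      have "cinner f (basis (j, k)) = (\<Sum>l=1..n. cinner (h l) (basis (j, k)))"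
        using h cinner_sum_left by metis
      also have "\<dots> = (\<Sum>l=1..n. if l = j then cinner (h j) (basis (j, k)) else 0)"
        using h j by (intro sum.cong refl) (auto intro!: H_space_orthogonal)
      finally show "cinner (h j) (basis (i, k)) = cinner (proj j f) (basis (i, k))"
        using h i j H_space_orthogonal[of "h j" j i k] by (auto simp: cinner_proj)
    qed
    then show "h = (\<lambda>j. if j \<in> {1..n} then proj j f else 0)"
      using h by auto
  qed
  then show ?thesis
    using assms by simp
qed

subsection \<open>The conjugation \<open>conj_B_star\<close>\<close>

text \<open>Explicit candidate for \<open>B_coeffs\<close>: the part of the expansion at level
  \<open>k\<close>, with the power of \<open>B\<close> stripped off.\<close>

definition model_coeff :: "L2 \<Rightarrow> int \<Rightarrow> L2" where
  "model_coeff f k = (\<Sum>j=1..n. scaleC (cinner f (basis (j, k))) (basis (j, 0)))"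

lemma B_powi_model_coeff:
  "mult_op (\<lambda>z. B z powi l) (model_coeff f k) = (\<Sum>j=1..n. scaleC (cinner f (basis (j, k))) (basis (j, l)))"
proof -
  have sum_op: "mult_op p (\<Sum>j\<in>A. x j) = (\<Sum>j\<in>A. mult_op p (x j))" for p and A :: "nat set" and x
    by (induction A rule: infinite_finite_induct)
      (auto simp: mult_op_add mult_op_scaleC[of _ 0 0, simplified])
  show ?thesis
    unfolding model_coeff_def sum_op
    by (intro sum.cong refl) (simp add: mult_op_scaleC mult_op_B_powi_basis)
qed

lemma model_coeff_model: "model_coeff f k \<in> model_space B"
  unfolding model_coeff_def
  by (intro L2.subspace_sum L2.subspace_scale model_space_subspace basis_0_model)

lemma B_coeffs_eq: "B_coeffs B f = model_coeff f"
  unfolding B_coeffs_def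
proof (rule the_equality)
  have "((\<lambda>x. scaleC (cinner f (basis x)) (basis x)) has_sum f) indices"
    by (rule orthonormal_basis_expansion[OF orthonormal_basis])
  then show "(\<forall>k. model_coeff f k \<in> model_space B) \<and>
      ((\<lambda>k. mult_op (\<lambda>z. B z powi k) (model_coeff f k)) has_sum f) UNIV"
    using model_coeff_model has_sum_sum_first[where s = f and A = "{1..n}"] by (simp add: B_powi_model_coeff)
next
  \<comment> \<open>Uniqueness: pairing with \<open>e\<^sub>j B\<^sup>l\<close> kills every term but
    \<open>k = l\<close>, and \<open>g l\<close> is determined by its pairings with the
    \<open>e\<^sub>j\<close>.\<close>
  fix g assume g: "(\<forall>k. g k \<in> model_space B) \<and> ((\<lambda>k. mult_op (\<lambda>z. B z powi k) (g k)) has_sum f) UNIV"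
  have "cinner f (basis (j, l)) = cinner (g l) (basis (j, 0))" if j: "j \<in> {1..n}" for j l
  proof -
    have "((\<lambda>k. cinner (mult_op (\<lambda>z. B z powi k) (g k)) (basis (j, l))) has_sum cinner f (basis (j, l))) UNIV"
      using g by (intro has_sum_bounded_linear[OF bounded_linear_cinner_left]) simp
    moreover have "cinner (mult_op (\<lambda>z. B z powi k) (g k)) (basis (j, l))
        = (if k = l then cinner (g l) (basis (j, 0)) else 0)" for k
      unfolding cinner_B_powi mult_op_B_powi_basis[OF j]
      using model_space_orthogonal[OF _ j, of "g k" "l - k"] g by simp
    ultimately have "((\<lambda>k. if k = l then cinner (g l) (basis (j, 0)) else 0) has_sum cinner f (basis (j, l))) UNIV"
      by simp
    moreover have "((\<lambda>k. if k = l then cinner (g l) (basis (j, 0)) else 0) has_sum cinner (g l) (basis (j, 0))) UNIV"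
      by (rule has_sum_finite_neutralI[of "{l}"]) auto
    ultimately show ?thesis
      using has_sum_unique by blast
  qed
  then have "g l = model_coeff f l" for l
    using model_space_expansion[of "g l"] g by (simp add: model_coeff_def)
  then show "g = model_coeff f"
    by blast
qed

text \<open>Corrects the one difference between the two conjugations: \<open>conj_B\<close> inverts
  powers of \<open>B\<close>, while \<open>conj_B_star\<close> keeps them.\<close>

definition flip :: "L2 \<Rightarrow> L2" where
  "flip = transport basis indices (\<lambda>(j, k). (j, - k))"

lemma flip_side_conditions:
  "indices \<subseteq> indices" "inj_on (\<lambda>(j, k). (j, - k)) indices" "(\<lambda>(j, k). (j, - k)) ` indices \<subseteq> indices"
  by (auto simp: inj_on_def)

lemma cinner_flip: "j \<in> {1..n} \<Longrightarrow> cinner (flip f) (basis (j, k)) = cinner f (basis (j, - k))"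
  using cinner_transport[OF orthonormal_fam_basis flip_side_conditions, of "(j, - k)" f]
  by (simp add: flip_def)

lemma flip_add: "flip (f + g) = flip f + flip g"
  unfolding flip_def by (rule transport_add[OF orthonormal_fam_basis flip_side_conditions])

lemma flip_scaleC: "flip (scaleC c f) = scaleC c (flip f)"
  unfolding flip_def by (rule transport_scaleC[OF orthonormal_fam_basis flip_side_conditions])

lemma flip_flip: "flip (flip f) = f"
  by (rule basis_eqI) (simp add: cinner_flip)

lemma cinner_flip_flip: "cinner (flip f) (flip g) = cinner f g"
proof -
  let ?h = "\<lambda>x. cinner f (basis x) * cnj (cinner g (basis x))"
  have "((\<lambda>x. cinner (flip f) (basis x) * cnj (cinner (flip g) (basis x))) has_sum cinner (flip f) (flip g)) indices"
    by (rule parseval[OF orthonormal_basis])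
  also have "?this \<longleftrightarrow> (?h has_sum cinner (flip f) (flip g)) indices"
    by (rule has_sum_reindex_bij_witness[where i = "\<lambda>(j, k). (j, - k)" and j = "\<lambda>(j, k). (j, - k)"])
      (auto simp: cinner_flip)
  finally show ?thesis
    using parseval[OF orthonormal_basis, of f g] has_sum_unique by blast
qed

lemma cinner_flip_commute: "cinner (flip f) g = cinner f (flip g)"
  using cinner_flip_flip[of f "flip g"] by (simp add: flip_flip)

lemma flip_B_powi: "flip (mult_op (\<lambda>z. B z powi k) f) = mult_op (\<lambda>z. B z powi (- k)) (flip f)"
  by (rule basis_eqI) (simp add: cinner_flip cinner_B_powi mult_op_B_powi_basis)

lemma flip_model:
  assumes "h \<in> model_space B"
  shows "flip h = h"
proof (rule basis_eqI)
  fix j k assume "j \<in> {1..n}"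
  then show "cinner (flip h) (basis (j, k)) = cinner h (basis (j, k))"
    using model_space_orthogonal[OF assms, of j k] model_space_orthogonal[OF assms, of j "- k"]
    by (cases "k = 0") (auto simp: cinner_flip)
qed

text \<open>Reflecting the expansion of \<open>f\<close> and applying \<open>conj_B\<close> term by
  term inverts each power twice.\<close>

lemma conj_B_star_eq: "conj_B_star B f = conj_B B (flip f)"
proof -
  have flip: "((\<lambda>x. scaleC (cinner f (basis x)) (basis ((\<lambda>(j, k). (j, - k)) x))) has_sum flip f) indices"
    unfolding flip_def by (rule transport_has_sum[OF orthonormal_fam_basis flip_side_conditions])
  have "((\<lambda>k. mult_op (\<lambda>z. B z powi (- k)) (model_coeff f k)) has_sum flip f) UNIV"
    unfolding B_powi_model_coeff using has_sum_sum_first[OF flip] by simp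
  then have "((\<lambda>k. conj_B B (mult_op (\<lambda>z. B z powi (- k)) (model_coeff f k))) has_sum conj_B B (flip f)) UNIV"
    by (rule has_sum_bounded_linear[OF bounded_linear_conjugation[OF conjugation_conj_B_blaschke]])
  then show ?thesis
    unfolding conj_B_star_def B_coeffs_eq conj_B_B_powi by (simp add: infsumI)
qed

text \<open>Both maps invert powers of \<open>B\<close>, and the images of the
  \<open>e\<^sub>j\<close> under \<open>conj_B\<close> lie in the model space, which
  \<open>flip\<close> fixes. This commutation makes \<open>conj_B_star\<close> an
  involution.\<close>

lemma flip_conj_B: "flip (conj_B B f) = conj_B B (flip f)"
proof (rule basis_eqI)
  fix j k assume j: "j \<in> {1..n}"
  note C = conjugation_cinner[OF conjugation_conj_B_blaschke]
  let ?d = "conj_B B (basis (j, 0))"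
  have *: "conj_B B (basis (j, l)) = mult_op (\<lambda>z. B z powi (- l)) ?d" for l
    by (subst basis_shift[OF j]) (rule conj_B_B_powi)
  have "cinner (flip (conj_B B f)) (basis (j, k)) = cinner (conj_B B (basis (j, - k))) f"
    by (simp only: cinner_flip[OF j] C[of f])
  also have "\<dots> = cinner (flip (conj_B B (basis (j, k)))) f"
    unfolding *[of k] *[of "- k"] flip_B_powi flip_model[OF conj_B_basis_model[OF j]] ..
  also have "\<dots> = cinner (conj_B B (flip f)) (basis (j, k))"
    unfolding cinner_flip_commute by (rule C)
  finally show "cinner (flip (conj_B B f)) (basis (j, k)) = cinner (conj_B B (flip f)) (basis (j, k))" .
qed

lemma conjugation_conj_B_star: "conjugation (conj_B_star B)"
  unfolding conjugation_def
  by (simp add: fun_eq_iff conj_B_star_eq flip_add flip_scaleC flip_conj_B flip_flip cinner_flip_flip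
      conjugationD[OF conjugation_conj_B_blaschke])

lemma conj_B_star_B: "conj_B_star B (mult_op B f) = mult_op B (conj_B_star B f)"
  using flip_B_powi[of 1 f] conj_B_B_powi[of "- 1" "flip f"] by (simp add: conj_B_star_eq)

end

section \<open>Operators commuting with multiplication by a Blaschke product\<close>

lemma norm_L2_mono:
  assumes "f \<in> L2_fun" "g \<in> L2_fun" "\<And>z. cmod z = 1 \<Longrightarrow> cmod (f z) \<le> cmod (g z)"
  shows "norm (L2_of f) \<le> norm (L2_of g)"
proof -
  have "(norm (L2_of f))\<^sup>2 \<le> (norm (L2_of g))\<^sup>2"
    unfolding norm_L2_of[OF assms(1)] norm_L2_of[OF assms(2)]
    using assms by (intro integral_mono) (auto simp: L2_fun_def power_mono)
  then show ?thesis
    by (rule power2_le_imp_le) simp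
qed

text \<open>Testing the adjoint relation on the indicator of \<open>{K + 1 \<le> |\<phi>| \<le> N}\<close> shows that this
  set is null.\<close>

lemma Linf_of_bounded_operator:
  assumes [measurable]: "\<phi> \<in> borel_measurable circle"
    and K: "0 \<le> K" "\<And>f. norm (T f) \<le> K * norm f"
    and T: "\<And>f g. g \<in> L2_fun \<Longrightarrow> (\<lambda>z. cnj (\<phi> z) * g z) \<in> L2_fun \<Longrightarrow>
      cinner (T f) (L2_of g) = cinner f (L2_of (\<lambda>z. cnj (\<phi> z) * g z))"
  shows "\<phi> \<in> Linf_fun"
proof -
  have null: "AE z in circle. \<not> (K + 1 \<le> cmod (\<phi> z) \<and> cmod (\<phi> z) \<le> real N)" for N
  proof -
    \<comment> \<open>The upper cut \<open>N\<close> makes \<open>cnj (\<phi> z) * g z\<close>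
      bounded, so that the adjoint relation applies to it. The 1 in \<open>K + 1\<close> is the gap
      that forces the indicator \<open>g\<close> to vanish.\<close>
    define E where "E = {z \<in> space circle. K + 1 \<le> cmod (\<phi> z) \<and> cmod (\<phi> z) \<le> real N}"
    have [measurable]: "E \<in> sets circle"
      unfolding E_def by measurable
    define g :: "complex \<Rightarrow> complex" where "g z = (if z \<in> E then 1 else 0)" for z
    have [measurable]: "g \<in> borel_measurable circle"
      unfolding g_def by measurable
    have "g \<in> Linf_fun"
      unfolding Linf_fun_def by (auto intro!: exI[of _ 1] AE_I2 simp: g_def)
    then have g: "g \<in> L2_fun"
      by (rule Linf_imp_L2)
    have "(\<lambda>z. cnj (\<phi> z)) \<in> borel_measurable circle"
      by (intro measurable_compose[OF assms(1)] borel_measurable_continuous_onI continuous_intros)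
    then have "(\<lambda>z. cnj (\<phi> z) * g z) \<in> borel_measurable circle"
      by measurable
    moreover have "AE z in circle. cmod (cnj (\<phi> z) * g z) \<le> real N"
      by (intro AE_I2) (simp add: g_def E_def norm_mult)
    ultimately have "(\<lambda>z. cnj (\<phi> z) * g z) \<in> Linf_fun"
      unfolding Linf_fun_def by blast
    then have h: "(\<lambda>z. cnj (\<phi> z) * g z) \<in> L2_fun"
      by (rule Linf_imp_L2)
    let ?h = "L2_of (\<lambda>z. cnj (\<phi> z) * g z)"
    have "(norm ?h)\<^sup>2 = cmod (cinner ?h ?h)"
      unfolding cinner_self_norm norm_of_real by simp
    also have "\<dots> = cmod (cinner (T ?h) (L2_of g))"
      by (simp add: T g h)
    also have "\<dots> \<le> norm (T ?h) * norm (L2_of g)"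
      by (rule cinner_Cauchy_Schwarz)
    also have "\<dots> \<le> (K * norm ?h) * norm (L2_of g)"
      by (intro mult_right_mono K) simp
    finally have "norm ?h * norm ?h \<le> (K * norm (L2_of g)) * norm ?h"
      by (simp add: power2_eq_square mult_ac)
    then have le: "norm ?h \<le> K * norm (L2_of g)"
      using K(1) by (cases "norm ?h = 0") (auto dest: mult_right_le_imp_le)
    have "norm (L2_of (\<lambda>z. complex_of_real (K + 1) * g z)) \<le> norm ?h"
      using K(1) by (intro norm_L2_mono L2_fun_scale g h)
        (auto simp: g_def E_def norm_mult simp del: of_real_add)
    then have "(K + 1) * norm (L2_of g) \<le> norm ?h"
      using K(1) by (simp add: L2_of_scale[OF g, symmetric] norm_scaleC del: of_real_add)
    with le have "norm (L2_of g) \<le> 0"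
      unfolding distrib_right by linarith
    then have "L2_of g = L2_of (\<lambda>_. 0)"
      by (simp add: L2_of_zero)
    then have "AE z in circle. g z = 0"
      using L2_of_eq_iff[OF g L2_fun_const] by simp
    with AE_space show ?thesis
      by eventually_elim (auto simp: g_def E_def split: if_splits)
  qed
  \<comment> \<open>The values of \<open>\<phi>\<close> are finite, so countably many cuts
    \<open>N\<close> exhaust the set where the modulus is at least \<open>K + 1\<close>.\<close>
  have "AE z in circle. \<forall>N. \<not> (K + 1 \<le> cmod (\<phi> z) \<and> cmod (\<phi> z) \<le> real N)"
    unfolding AE_all_countable using null by blast
  then have "AE z in circle. cmod (\<phi> z) \<le> K + 1"
  proof eventually_elim
    case (elim z)
    obtain N where "cmod (\<phi> z) \<le> real N"
      using real_arch_simple by blast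
    with elim show ?case
      by force
  qed
  then show ?thesis
    using assms(1) by (auto simp: Linf_fun_def)
qed

context blaschke_product
begin

lemma blaschke_basis_nonzero:
  assumes "j \<in> {1..n}" "cmod z = 1"
  shows "blaschke_basis lam j z \<noteq> 0"
proof -
  obtain i where i: "j = Suc i"
    using assms by (cases j) auto
  show ?thesis
    using assms i blaschke_nonzero[of i z] weight_nonzero[of j] szego_denom_nonzero[OF lam[of j], of z]
    by (simp add: blaschke_basis_Suc)
qed

section \<open>Linear isometries commuting with multiplication by \<open>B\<close>\<close>

context
  fixes U :: "L2 \<Rightarrow> L2"
  assumes U_add: "U (f + g) = U f + U g" and U_scale: "U (scaleC c f) = scaleC c (U f)"
    and U_norm: "norm (U f) = norm f" and U_B: "U (mult_op B f) = mult_op B (U f)"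
begin

lemma bounded_linear_U: "bounded_linear U"
  by (rule bounded_linear_intro[where K = 1]) (simp_all add: U_add U_scale U_norm scaleR_L2_def)

text \<open>Nonnegative powers go by induction; for negative \<open>k\<close> the relation for
  \<open>- k\<close> is cancelled by the inverse multiplication.\<close>

lemma U_B_powi: "U (mult_op (\<lambda>z. B z powi k) f) = mult_op (\<lambda>z. B z powi k) (U f)"
proof -
  have nat: "U (mult_op (\<lambda>z. B z powi int m) f) = mult_op (\<lambda>z. B z powi int m) (U f)" for m f
  proof (induction m)
    case (Suc m)
    have "mult_op (\<lambda>z. B z powi int (Suc m)) f = mult_op B (mult_op (\<lambda>z. B z powi int m) f)" for f
      using mult_op_B_powi_mult[of 1 "int m" f] by (simp add: add.commute)
    then show ?case
      by (simp only: U_B Suc)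
  qed simp
  show ?thesis
  proof (cases "k \<ge> 0")
    case True
    then show ?thesis
      using nat[of "nat k" f] by simp
  next
    case False
    have inv: "mult_op (\<lambda>z. B z powi (- k)) (mult_op (\<lambda>z. B z powi k) f) = f"
      "mult_op (\<lambda>z. B z powi k) (mult_op (\<lambda>z. B z powi (- k)) f) = f" for f
      unfolding mult_op_B_powi_mult by simp_all
    have "U (mult_op (\<lambda>z. B z powi (- k)) f) = mult_op (\<lambda>z. B z powi (- k)) (U f)" for f
      using nat[of "nat (- k)" f] False by simp
    from this[of "mult_op (\<lambda>z. B z powi k) f"]
    have "mult_op (\<lambda>z. B z powi (- k)) (U (mult_op (\<lambda>z. B z powi k) f)) = U f"
      unfolding inv ..
    from arg_cong[OF this, of "mult_op (\<lambda>z. B z powi k)"] show ?thesis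
      unfolding inv .
  qed
qed

lemma U_basis:
  assumes j: "j \<in> {1..n}" and u: "u \<in> L2_fun" "U (basis (j, 0)) = L2_of u"
  shows "U (basis (j, k)) = L2_of (\<lambda>z. B z powi k * u z)"
  by (subst basis_shift[OF j]) (simp only: U_B_powi u(2) L2_of_mult[OF B_Linf(2) u(1)])

text \<open>Multiplication by \<open>\<phi> = u / e\<^sub>j\<close>, where \<open>u = U e\<^sub>j\<close>, maps \<open>e\<^sub>i B\<^sup>k\<close> to \<open>(e\<^sub>i / e\<^sub>j) \<cdot> U (e\<^sub>j B\<^sup>k)\<close>.
  The same formula defines a bounded operator on all of \<open>L2\<close>, so \<open>\<phi>\<close> is essentially bounded.\<close>

lemma symbol_Linf:
  assumes j: "j \<in> {1..n}" and u: "u \<in> L2_fun" "U (basis (j, 0)) = L2_of u"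
  shows "(\<lambda>z. u z / blaschke_basis lam j z) \<in> Linf_fun"
proof -
  define S where "S i = transport basis ({i} \<times> UNIV) (\<lambda>(_, k). (j, k))" for i :: nat
  \<comment> \<open>These quotients are continuous because \<open>e\<^sub>j\<close> has no zero on
    the circle; this is what keeps \<open>T\<close> bounded.\<close>
  define q where "q i z = blaschke_basis lam i z / blaschke_basis lam j z" for i z
  define T where "T f = (\<Sum>i=1..n. mult_op (q i) (U (S i f)))" for f
  have side: "{i} \<times> UNIV \<subseteq> indices" "inj_on (\<lambda>(_, k). (j, k)) ({i} \<times> (UNIV :: int set))"
    "(\<lambda>(_, k). (j, k)) ` ({i} \<times> UNIV) \<subseteq> indices" if "i \<in> {1..n}" for i
    using that j by (auto simp: inj_on_def)
  have S_add: "S i (f + g) = S i f + S i g" and S_scale: "S i (scaleC c f) = scaleC c (S i f)"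
    and S_norm: "norm (S i f) \<le> norm f"
    and S_coeff: "cinner (S i f) (basis (l, k)) = (if l = j then cinner f (basis (i, k)) else 0)"
    if "i \<in> {1..n}" "l \<in> {1..n}" for i l k f g c
  proof -
    note t = orthonormal_fam_basis side[OF that(1)]
    show "S i (f + g) = S i f + S i g" "S i (scaleC c f) = scaleC c (S i f)" "norm (S i f) \<le> norm f"
      unfolding S_def by (rule transport_add[OF t] transport_scaleC[OF t] norm_transport_le[OF t])+
    show "cinner (S i f) (basis (l, k)) = (if l = j then cinner f (basis (i, k)) else 0)"
    proof (cases "l = j")
      case True
      then show ?thesis
        using cinner_transport[OF t, of "(i, k)" f] by (simp add: S_def)
    next
      case False
      then have "(l, k) \<notin> (\<lambda>(_, k). (j, k)) ` ({i} \<times> UNIV)"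
        by auto
      then show ?thesis
        using cinner_transport_other[OF t, of "(l, k)" f] that False by (simp add: S_def)
    qed
  qed
  have bl_S: "bounded_linear (S i)" if "i \<in> {1..n}" for i
    using S_add[OF that that] S_scale[OF that that] S_norm[OF that that]
    by (intro bounded_linear_intro[where K = 1]) (simp_all add: scaleR_L2_def)
  have S_basis: "S l (basis (i, k)) = (if l = i then basis (j, k) else 0)"
    if "i \<in> {1..n}" "l \<in> {1..n}" for i l k
    using that j by (intro basis_eqI) (auto simp: S_coeff cinner_basis)
  have qc: "continuous_on (sphere 0 1) (q i)" if "i \<in> {1..n}" for i
    unfolding q_def using that j
    by (intro continuous_on_divide continuous_blaschke_basis) (auto simp: blaschke_basis_nonzero)
  have T: "bounded_linear T"
    unfolding T_def
    by (intro bounded_linear_sum bounded_linear_compose[OF bounded_linear_mult_op]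
        bounded_linear_compose[OF bounded_linear_U] bl_S Linf_continuous qc)
  have mult_0: "mult_op p 0 = 0" for p
    using mult_op_scaleC[of p 0 0] by simp
  have U_0: "U 0 = 0"
    using U_scale[of 0 0] by simp
  have T_scale: "T (scaleC c f) = scaleC c (T f)" for c f
    unfolding T_def L2.scale_sum_right
    by (intro sum.cong refl) (simp add: S_scale U_scale mult_op_scaleC)
  have T_basis: "T (basis (i, k)) = L2_of (\<lambda>z. q i z * (B z powi k * u z))" if i: "i \<in> {1..n}" for i k
  proof -
    have "T (basis (i, k)) = (\<Sum>l=1..n. if l = i then mult_op (q i) (U (basis (j, k))) else 0)"
      unfolding T_def using i by (intro sum.cong refl) (simp add: S_basis U_0 mult_0)
    also have "\<dots> = mult_op (q i) (U (basis (j, k)))"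
      using i by simp
    also have "\<dots> = L2_of (\<lambda>z. q i z * (B z powi k * u z))"
      unfolding U_basis[OF j u] using u(1)
      by (intro L2_of_mult L2_fun_mult_Linf B_Linf Linf_continuous qc i)
    finally show ?thesis .
  qed
  obtain K where K: "0 \<le> K" "\<And>f. norm (T f) \<le> norm f * K"
    using bounded_linear.nonneg_bounded[OF T] by blast
  have [measurable]: "u \<in> borel_measurable circle" "blaschke_basis lam j \<in> borel_measurable circle"
    using u(1) continuous_blaschke_basis[OF j]
    by (auto simp: L2_fun_measurable borel_measurable_circle_continuous)
  show ?thesis
  proof (rule Linf_of_bounded_operator[where T = T and K = K])
    show "norm (T f) \<le> K * norm f" for f
      using K(2)[of f] by (simp add: mult.commute)
    show "cinner (T f) (L2_of g) = cinner f (L2_of (\<lambda>z. cnj (u z / blaschke_basis lam j z) * g z))"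
      if g: "g \<in> L2_fun" and h: "(\<lambda>z. cnj (u z / blaschke_basis lam j z) * g z) \<in> L2_fun" for f g
    proof (rule bounded_linear_eq_on_basis[OF orthonormal_basis, where f = f])
      show "bounded_linear (\<lambda>f. cinner (T f) (L2_of g))"
        by (rule bounded_linear_compose[OF bounded_linear_cinner_left T])
      show "bounded_linear (\<lambda>f. cinner f (L2_of (\<lambda>z. cnj (u z / blaschke_basis lam j z) * g z)))"
        by (rule bounded_linear_cinner_left)
      fix x :: "nat \<times> int" assume "x \<in> indices"
      then obtain i k where x: "x = (i, k)" "i \<in> {1..n}"
        by auto
      have "(\<lambda>z. q i z * (B z powi k * u z)) \<in> L2_fun"
        using u(1) by (intro L2_fun_mult_Linf B_Linf Linf_continuous qc x)
      then have "cinner (T (basis (i, k))) (L2_of g) = (LINT z|circle. q i z * (B z powi k * u z) * cnj (g z))"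
        unfolding T_basis[OF x(2)] using g by (rule cinner_L2_of)
      also have "\<dots> = (LINT z|circle. blaschke_basis lam i z * B z powi k
          * cnj (cnj (u z / blaschke_basis lam j z) * g z))"
        by (intro Bochner_Integration.integral_cong refl) (simp add: q_def)
      also have "\<dots> = cinner (basis (i, k)) (L2_of (\<lambda>z. cnj (u z / blaschke_basis lam j z) * g z))"
        unfolding basis_def case_prod_conv
        by (rule cinner_L2_of[symmetric, OF L2_continuous[OF continuous_basis[OF x(2)]] h])
      finally show "cinner (T (basis x)) (L2_of g)
          = cinner (basis x) (L2_of (\<lambda>z. cnj (u z / blaschke_basis lam j z) * g z))"
        by (simp only: x)
    qed (simp add: T_scale cinner_scaleC_left)
  qed (use K in measurable)
qed

text \<open>Both operators are bounded and linear, and on \<open>e\<^sub>i B\<^sup>k\<close> both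
  give \<open>B\<^sup>k\<close> times \<open>U e\<^sub>i\<close>, because the division by
  \<open>e\<^sub>i\<close> in the symbol cancels.\<close>

lemma multi_mult_op_representation:
  "\<exists>\<phi>. (\<forall>j\<in>{1..n}. \<phi> j \<in> Linf_fun) \<and> multi_mult_op lam n \<phi> = U"
proof -
  have "\<exists>u. u \<in> L2_fun \<and> U (basis (j, 0)) = L2_of u" for j
    by (rule L2_cases[of "U (basis (j, 0))"]) auto
  then obtain u where u: "\<And>j. u j \<in> L2_fun" "\<And>j. U (basis (j, 0)) = L2_of (u j)"
    by metis
  define \<phi> where "\<phi> j z = u j z / blaschke_basis lam j z" for j z
  have \<phi>: "\<phi> j \<in> Linf_fun" if "j \<in> {1..n}" for j
    using symbol_Linf[OF that u] by (simp add: \<phi>_def[abs_def])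
  have proj_scale: "proj j (scaleC c f) = scaleC c (proj j f)"
    and bl_proj: "bounded_linear (proj j)" if "j \<in> {1..n}" for j c f
  proof -
    have t: "{j} \<times> UNIV \<subseteq> indices" "inj_on id ({j} \<times> (UNIV :: int set))" "id ` ({j} \<times> UNIV) \<subseteq> indices"
      using that by auto
    note t = orthonormal_fam_basis t
    show sc: "proj j (scaleC c f) = scaleC c (proj j f)" for c f
      unfolding proj_def by (rule transport_scaleC[OF t])
    show "bounded_linear (proj j)"
      using transport_add[OF t] norm_transport_le[OF t]
      by (intro bounded_linear_intro[where K = 1]) (simp_all add: scaleR_L2_def sc, simp_all add: proj_def)
  qed
  have proj_basis: "proj l (basis (i, k)) = (if l = i then basis (i, k) else 0)"
    if "i \<in> {1..n}" "l \<in> {1..n}" for i l k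
    using that by (intro basis_eqI) (auto simp: cinner_proj cinner_basis)
  have mult_0: "mult_op p 0 = 0" for p
    using mult_op_scaleC[of p 0 0] by simp
  have eq: "multi_mult_op lam n \<phi> f = (\<Sum>j=1..n. mult_op (\<phi> j) (proj j f))" for f
    unfolding multi_mult_op_def by (intro sum.cong refl) (simp add: components_eq)
  have "(\<Sum>j=1..n. mult_op (\<phi> j) (proj j f)) = U f" for f
  proof (rule bounded_linear_eq_on_basis[OF orthonormal_basis, where f = f])
    show "bounded_linear (\<lambda>f. \<Sum>j=1..n. mult_op (\<phi> j) (proj j f))"
      by (intro bounded_linear_sum bounded_linear_compose[OF bounded_linear_mult_op] bl_proj \<phi>)
    show "(\<Sum>j=1..n. mult_op (\<phi> j) (proj j (scaleC c f))) = U (scaleC c f)"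
      if "(\<Sum>j=1..n. mult_op (\<phi> j) (proj j f)) = U f" for c f
      unfolding U_scale that[symmetric] L2.scale_sum_right
      by (intro sum.cong refl) (simp add: proj_scale mult_op_scaleC)
    fix x :: "nat \<times> int" assume "x \<in> indices"
    then obtain i k where x: "x = (i, k)" "i \<in> {1..n}"
      by auto
    have "(\<Sum>j=1..n. mult_op (\<phi> j) (proj j (basis (i, k))))
        = (\<Sum>j=1..n. if j = i then mult_op (\<phi> i) (basis (i, k)) else 0)"
      using x(2) by (intro sum.cong refl) (simp add: proj_basis mult_0)
    also have "\<dots> = mult_op (\<phi> i) (basis (i, k))"
      using x(2) by simp
    also have "\<dots> = L2_of (\<lambda>z. \<phi> i z * (blaschke_basis lam i z * B z powi k))"
      unfolding basis_def case_prod_conv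
      by (rule L2_of_mult[OF \<phi>[OF x(2)] L2_continuous[OF continuous_basis[OF x(2)]]])
    also have "\<dots> = L2_of (\<lambda>z. B z powi k * u i z)"
      using blaschke_basis_nonzero[OF x(2)] by (intro L2_of_cong) (simp add: \<phi>_def)
    also have "\<dots> = U (basis (i, k))"
      by (rule U_basis[OF x(2) u, symmetric])
    finally show "(\<Sum>j=1..n. mult_op (\<phi> j) (proj j (basis x))) = U (basis x)"
      by (simp only: x)
  qed (rule bounded_linear_U)
  with eq \<phi> show ?thesis
    by (intro exI[of _ \<phi>]) auto
qed

end

text \<open>Common core of the two cases, which differ only in the conjugation \<open>D\<close> that
  makes \<open>C \<circ> D\<close> commute with multiplication by \<open>B\<close>.\<close>

lemma conjugation_factorization:
  assumes C: "conjugation C" and D: "conjugation D"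
    and comm: "\<And>f. C (D (mult_op B f)) = mult_op B (C (D f))"
  shows "\<exists>\<phi>. (\<forall>j\<in>{1..n}. \<phi> j \<in> Linf_fun) \<and> C = multi_mult_op lam n \<phi> \<circ> D \<and>
    unitary (multi_mult_op lam n \<phi>) \<and> C_symmetric D (multi_mult_op lam n \<phi>)"
proof -
  have "\<exists>\<phi>. (\<forall>j\<in>{1..n}. \<phi> j \<in> Linf_fun) \<and> multi_mult_op lam n \<phi> = C \<circ> D"
    by (rule multi_mult_op_representation)
      (simp_all add: comm conjugationD[OF C] conjugationD[OF D] conjugation_norm C D)
  then obtain \<phi> where \<phi>: "\<forall>j\<in>{1..n}. \<phi> j \<in> Linf_fun" "multi_mult_op lam n \<phi> = C \<circ> D"
    by blast
  have adjoint: "cinner (C (D f)) g = cinner f (D (C g))" for f g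
  proof -
    have "cinner (C (D f)) g = cinner (C g) (D f)"
      by (rule conjugation_cinner[OF C])
    also have "\<dots> = cinner (D (D f)) (D (C g))"
      by (simp only: conjugationD(4)[OF D])
    finally show ?thesis
      by (simp add: conjugationD[OF D])
  qed
  \<comment> \<open>\<open>adj\<close> is a definite description, so uniqueness of the adjoint has
    to be shown along with the relation.\<close>
  have adj: "adj (C \<circ> D) = D \<circ> C"
    unfolding adj_def
  proof (rule the_equality)
    show "\<forall>f g. cinner ((C \<circ> D) f) g = cinner f ((D \<circ> C) g)"
      by (simp add: adjoint)
    fix S assume S: "\<forall>f g. cinner ((C \<circ> D) f) g = cinner f (S g)"
    show "S = D \<circ> C"
    proof
      fix g
      have "cinner (S g) f = cinner ((D \<circ> C) g) f" for f
        using S adjoint[of f g] by (subst (1 2) cinner_commute) simp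
      then show "S g = (D \<circ> C) g"
        by (rule cinner_eqI)
    qed
  qed
  have "bounded_op (C \<circ> D)"
    unfolding bounded_op_def
    by (auto simp: conjugationD[OF C] conjugationD[OF D] conjugation_norm C D intro!: exI[of _ 1])
  then have "unitary (C \<circ> D)" "C_symmetric D (C \<circ> D)"
    unfolding unitary_def C_symmetric_def adj
    by (simp_all add: fun_eq_iff conjugationD[OF C] conjugationD[OF D])
  moreover have "C = (C \<circ> D) \<circ> D"
    by (simp add: fun_eq_iff conjugationD[OF D])
  ultimately show ?thesis
    using \<phi> by auto
qed

end

theorem theorem6p1:
  fixes n :: nat and lam :: "nat \<Rightarrow> complex" and B :: "complex \<Rightarrow> complex"
    and C :: "L2 \<Rightarrow> L2"
  assumes "n \<ge> 1"
    and "\<forall>k\<in>{1..n}. cmod (lam k) < 1"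
    and "B = blaschke lam n"
    and "conjugation C"
  shows "(C \<circ> mult_op B = mult_op (\<lambda>z. cnj (B z)) \<circ> C \<longrightarrow>
           (\<exists>\<phi>. (\<forall>j\<in>{1..n}. \<phi> j \<in> Linf_fun) \<and>
                C = multi_mult_op lam n \<phi> \<circ> conj_B B \<and>
                unitary (multi_mult_op lam n \<phi>) \<and>
                C_symmetric (conj_B B) (multi_mult_op lam n \<phi>))) \<and>
         (C \<circ> mult_op B = mult_op B \<circ> C \<longrightarrow>
           (\<exists>\<psi>. (\<forall>j\<in>{1..n}. \<psi> j \<in> Linf_fun) \<and>
                C = multi_mult_op lam n \<psi> \<circ> conj_B_star B \<and>
                unitary (multi_mult_op lam n \<psi>) \<and>
                C_symmetric (conj_B_star B) (multi_mult_op lam n \<psi>)))"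
proof -
  interpret blaschke_product lam n
    using assms(1,2) by unfold_locales auto
  note CC = conjugationD(3)[OF assms(4)]
  show ?thesis
  proof (intro conjI impI)
    assume comm: "C \<circ> mult_op B = mult_op (\<lambda>z. cnj (B z)) \<circ> C"
    \<comment> \<open>Because \<open>C\<close> is an involution, the hypothesis also holds with
      \<open>B\<close> and its conjugate exchanged; this undoes the conjugation of \<open>B\<close>
      caused by \<open>conj_B\<close>.\<close>
    have "C (mult_op (\<lambda>z. cnj (B z)) f) = mult_op B (C f)" for f
      using fun_cong[OF comm, of "C f"] CC by (metis comp_apply)
    then have "C (conj_B B (mult_op B f)) = mult_op B (C (conj_B B f))" for f
      using assms(3) by (simp add: conj_B_mult_op B_Linf)
    then show "\<exists>\<phi>. (\<forall>j\<in>{1..n}. \<phi> j \<in> Linf_fun) \<and> C = multi_mult_op lam n \<phi> \<circ> conj_B B \<and>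
        unitary (multi_mult_op lam n \<phi>) \<and> C_symmetric (conj_B B) (multi_mult_op lam n \<phi>)"
      using conjugation_factorization[OF assms(4) conjugation_conj_B_blaschke] assms(3) by simp
  next
    assume comm: "C \<circ> mult_op B = mult_op B \<circ> C"
    then have "C (conj_B_star B (mult_op B f)) = mult_op B (C (conj_B_star B f))" for f
      unfolding assms(3) by (simp add: conj_B_star_B fun_eq_iff)
    then show "\<exists>\<psi>. (\<forall>j\<in>{1..n}. \<psi> j \<in> Linf_fun) \<and> C = multi_mult_op lam n \<psi> \<circ> conj_B_star B \<and>
        unitary (multi_mult_op lam n \<psi>) \<and> C_symmetric (conj_B_star B) (multi_mult_op lam n \<psi>)"
      using conjugation_factorization[OF assms(4) conjugation_conj_B_star] assms(3) by simp
  qed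
qed

end
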